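(* There exist infinitely many connected $18$-regular Cayley graphs $G$ such that, writing $n$ for the number of vertices of $G$, the second eigenvalue multiplicity of $G$ is at least $n^{2/5}-1$.
   Context: All graphs are finite and undirected. For a finite group $\Gamma$ and a subset $S=S^{-1}\subset\Gamma$, the Cayley graph $\mathrm{Cay}(\Gamma,S)$ has vertex set $\Gamma$ and edges $(g,gs)$ for all $g\in\Gamma$, $s\in S$. Eigenvalues of a graph $G$ always refer to its adjacency matrix and are listed in descending order with multiplicity as $\lambda_1(G)\ge\lambda_2(G)\ge\cdots\ge\lambda_{|V(G)|}(G)$. The second eigenvalue multiplicity of $G$ is the number of indices $j$ with $\lambda_j(G)=\lambda_2(G)$. *)

theory Defs
  imports
    "HOL-Algebra.Group"
    "Graph_Theory.Graph_Theory"
    "Jordan_Normal_Form.Char_Poly"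
begin

text \<open>
  Undirected graphs are symmetric digraphs whose arcs are pairs of vertices: an edge is
  represented by its two orientations.
\<close>

definition Cay :: "('a, 'b) monoid_scheme \<Rightarrow> 'a set \<Rightarrow> 'a pair_pre_digraph" where
  "Cay \<Gamma> S = \<lparr> pverts = carrier \<Gamma>,
                parcs = {(g, g \<otimes>\<^bsub>\<Gamma>\<^esub> s) | g s. g \<in> carrier \<Gamma> \<and> s \<in> S} \<rparr>"

text \<open>
  The condition \<open>\<one> \<notin> S\<close> makes the graph loop-free, so that its degree is the cardinality of \<open>S\<close>
  under every convention for counting loops.
\<close>

definition is_cayley_graph :: "'a pair_pre_digraph \<Rightarrow> bool" where
  "is_cayley_graph G \<longleftrightarrow>
     (\<exists>(\<Gamma> :: 'a monoid) S. group \<Gamma> \<and> finite (carrier \<Gamma>) \<and>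
        S \<subseteq> carrier \<Gamma> \<and> \<one>\<^bsub>\<Gamma>\<^esub> \<notin> S \<and> m_inv \<Gamma> ` S = S \<and> G = Cay \<Gamma> S)"

definition regular_graph :: "nat \<Rightarrow> 'a pair_pre_digraph \<Rightarrow> bool" where
  "regular_graph d G \<longleftrightarrow> (\<forall>v \<in> pverts G. out_degree (with_proj G) v = d)"

text \<open>
  Rows and columns are indexed by the vertices in increasing order; any other enumeration gives
  a similar matrix, with the same characteristic polynomial.
\<close>

definition adjacency_matrix :: "'a :: linorder pair_pre_digraph \<Rightarrow> real mat" where
  "adjacency_matrix G =
     (let vs = sorted_list_of_set (pverts G)
      in mat (length vs) (length vs) (\<lambda>(i, j). if (vs ! i, vs ! j) \<in> parcs G then 1 else 0))"

text \<open>
  The real roots of the characteristic polynomial, with multiplicity and in descending order.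
  The adjacency matrix of an undirected graph is symmetric, so all its eigenvalues are real and
  the list has one entry per vertex.
\<close>

definition graph_eigenvalues :: "'a :: linorder pair_pre_digraph \<Rightarrow> real list" where
  "graph_eigenvalues G =
     rev (sorted_list_of_multiset (proots (char_poly (adjacency_matrix G))))"

text \<open>Eigenvalues are numbered from 1: \<open>graph_eigenvalue G 1\<close> is the largest.\<close>

definition graph_eigenvalue :: "'a :: linorder pair_pre_digraph \<Rightarrow> nat \<Rightarrow> real" where
  "graph_eigenvalue G j = graph_eigenvalues G ! (j - 1)"

definition second_eigenvalue_multiplicity :: "'a :: linorder pair_pre_digraph \<Rightarrow> nat" where
  "second_eigenvalue_multiplicity G =
     card {j \<in> {1..card (pverts G)}. graph_eigenvalue G j = graph_eigenvalue G 2}"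

end

(*
  For a suitable prime q let SL(2,q) act on the plane over F_q.  The 18 integer quaternions of
  norm 17 of Lubotzky, Phillips and Sarnak give generators of SL(2,q); two mutually inverse ones
  are turned into affine maps that move the origin, the other 16 fix it.  In the Cayley graph of
  the affine group, a function concentrated on the cosets of the stabiliser of the origin has
  Rayleigh quotient larger than 16.11.  On the quotient SL(2,q), however, every nontrivial
  eigenvalue is smaller than 16.11: it has multiplicity at least (q - 1)/2, whereas the number of
  closed walks of length about (11/5) log_17 q is controlled by counting lattice points on
  spheres (the trace method of Sarnak and Xue).  So the second eigenfunctions of the affine
  group are not invariant under translations; SL(2,q) permutes the q^2 - 1 nontrivial characters
  of the translation group transitively, and the second eigenvalue has multiplicity at
  least q^2 - 1, in a group with at most q^5 elements.
*)
theory Submission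
  imports Defs
    "HOL-Computational_Algebra.Primes"
    "Jordan_Normal_Form.Schur_Decomposition"
    "HOL-Algebra.Generated_Groups"
    "HOL-Real_Asymp.Real_Asymp"
    "HOL-Number_Theory.Cong"
begin

section \<open>Integer quaternions and reduced words\<close>

text \<open>SL(2,q) alone would give multiplicity about \<open>q\<close> among \<open>q^3\<close>
  vertices; the affine group gives \<open>q^2\<close> among \<open>q^5\<close>, provided the second
  eigenvalue belongs to functions that are not translation invariant. So the gap for SL(2,q) has to
  beat 16.11. The trace inequality for words of length \<open>m\<close> reads, up to a factor linear
  in \<open>m\<close>, \<open>p(\<mu>)^2 \<le> q^2 * 17^m\<close>, where \<open>p(\<mu>)\<close>
  grows at least like \<open>14.97^m\<close> for \<open>\<mu> \<ge> 16.11\<close>. At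
  \<open>17^m = q^2\<close> it says next to nothing, so \<open>m\<close> must exceed
  \<open>2 log_17 q\<close> by a fixed proportion. Bounding the points on a circle of squared radius
  \<open>N\<close> by a multiple of \<open>N^(1/3)\<close>, which takes only areas of lattice
  triangles, keeps the collisions near \<open>17^m\<close> as long as
  \<open>17^m \<le> q^(11/5)\<close>. This suffices by a narrow margin: \<open>14.97^2\<close> is
  about 224.1 and \<open>17^(21/11)\<close> about 223.4. The same comparison fails for the norms 5
  and 13, whence the norm 17 and the degree 18. The gap also yields connectedness.\<close>

datatype quat = Quat (q0: int) (q1: int) (q2: int) (q3: int)

lemma quat_eq_iff: "x = y \<longleftrightarrow> q0 x = q0 y \<and> q1 x = q1 y \<and> q2 x = q2 y \<and> q3 x = q3 y"
  by (cases x; cases y) auto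

instantiation quat :: ring_1
begin

definition "0 = Quat 0 0 0 0"
definition "1 = Quat 1 0 0 0"
definition "x + y = Quat (q0 x + q0 y) (q1 x + q1 y) (q2 x + q2 y) (q3 x + q3 y)"
definition "x - y = Quat (q0 x - q0 y) (q1 x - q1 y) (q2 x - q2 y) (q3 x - q3 y)"
definition "- x = Quat (- q0 x) (- q1 x) (- q2 x) (- q3 x)"
definition "x * y = Quat
  (q0 x * q0 y - q1 x * q1 y - q2 x * q2 y - q3 x * q3 y)
  (q0 x * q1 y + q1 x * q0 y + q2 x * q3 y - q3 x * q2 y)
  (q0 x * q2 y - q1 x * q3 y + q2 x * q0 y + q3 x * q1 y)
  (q0 x * q3 y + q1 x * q2 y - q2 x * q1 y + q3 x * q0 y)"

instance
  by standard (simp_all add: zero_quat_def one_quat_def plus_quat_def minus_quat_def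
      uminus_quat_def times_quat_def algebra_simps)

end

lemmas quat_arith_defs =
  zero_quat_def one_quat_def plus_quat_def minus_quat_def uminus_quat_def times_quat_def

lemma of_int_quat: "(of_int n :: quat) = Quat n 0 0 0"
proof -
  have "(of_nat m :: quat) = Quat (int m) 0 0 0" for m
    by (induction m) (simp_all add: quat_arith_defs)
  then show ?thesis
    by (cases n rule: int_cases2) (simp_all add: uminus_quat_def)
qed

definition qcnj :: "quat \<Rightarrow> quat" where
  "qcnj x = Quat (q0 x) (- q1 x) (- q2 x) (- q3 x)"

definition qnorm :: "quat \<Rightarrow> int" where
  "qnorm x = (q0 x)\<^sup>2 + (q1 x)\<^sup>2 + (q2 x)\<^sup>2 + (q3 x)\<^sup>2"

text \<open>Divisibility by a rational integer, in two roles: with 17 to detect cancellation in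
  words, and with \<open>q\<close> to express that two products agree modulo
  \<open>q\<close>.\<close>

definition qdvd :: "int \<Rightarrow> quat \<Rightarrow> bool" where
  "qdvd n x \<longleftrightarrow> n dvd q0 x \<and> n dvd q1 x \<and> n dvd q2 x \<and> n dvd q3 x"

lemma qcnj_qcnj [simp]: "qcnj (qcnj x) = x"
  by (simp add: qcnj_def)

lemma qcnj_eq_iff [simp]: "qcnj x = qcnj y \<longleftrightarrow> x = y"
  by (metis qcnj_qcnj)

lemma qcnj_mult: "qcnj (x * y) = qcnj y * qcnj x"
  by (simp add: qcnj_def times_quat_def algebra_simps)

lemma qcnj_one [simp]: "qcnj 1 = 1"
  by (simp add: qcnj_def one_quat_def)

lemma qcnj_mult_self: "qcnj x * x = of_int (qnorm x)"
  by (simp add: qcnj_def times_quat_def of_int_quat qnorm_def power2_eq_square algebra_simps)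

lemma qnorm_qcnj [simp]: "qnorm (qcnj x) = qnorm x"
  by (simp add: qcnj_def qnorm_def)

lemma qnorm_mult: "qnorm (x * y) = qnorm x * qnorm y"
  by (simp add: times_quat_def qnorm_def power2_eq_square algebra_simps)

lemma qnorm_one [simp]: "qnorm 1 = 1"
  by (simp add: one_quat_def qnorm_def)

lemma qdvd_mult: "qdvd n x \<Longrightarrow> qdvd n (y * x)"
  by (simp add: qdvd_def times_quat_def)

lemma qdvd_add: "qdvd n x \<Longrightarrow> qdvd n y \<Longrightarrow> qdvd n (x + y)"
  by (simp add: qdvd_def plus_quat_def)

lemma qdvd_of_int_mult:
  assumes "coprime n c" "qdvd n (of_int c * x)"
  shows "qdvd n x"
  using assms by (simp add: qdvd_def of_int_quat times_quat_def coprime_dvd_mult_right_iff)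

lemma qdvd_of_int_self: "qdvd n (of_int n * x)"
  by (simp add: qdvd_def of_int_quat times_quat_def)

lemma of_int_mult_quat_cancel:
  assumes "c \<noteq> 0" "of_int c * x = (of_int c * y :: quat)"
  shows "x = y"
  using assms by (simp add: quat_eq_iff of_int_quat times_quat_def)

text \<open>Multiplying by \<open>qcnj s\<close> replaces \<open>s\<close> by the integer
  \<open>qnorm s\<close>, a unit modulo \<open>n\<close>. Colliding words can thus be stripped of a
  common first letter.\<close>

lemma qdvd_cancel_left:
  assumes "coprime n (qnorm s)" "qdvd n (s * x - s * y)"
  shows "qdvd n (x - y)"
proof -
  have "qdvd n (qcnj s * (s * x - s * y))" using assms(2) by (rule qdvd_mult)
  also have "qcnj s * (s * x - s * y) = of_int (qnorm s) * (x - y)"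
    by (simp add: right_diff_distrib mult.assoc[symmetric] qcnj_mult_self)
  finally show ?thesis using assms(1) qdvd_of_int_mult by blast
qed

lemma quat_mult_left_cancel:
  assumes "qnorm s \<noteq> 0" "s * x = s * y"
  shows "x = y"
proof -
  have "qcnj s * (s * x) = qcnj s * (s * y)" using assms(2) by simp
  then have "of_int (qnorm s) * x = of_int (qnorm s) * y"
    by (simp add: mult.assoc[symmetric] qcnj_mult_self)
  then show ?thesis using of_int_mult_quat_cancel assms(1) by blast
qed

text \<open>All integer quaternions of norm 17 with odd positive real part and even imaginary
  coordinates: one from each class of the 144 quaternions of norm 17 modulo the eight units. The
  explicit list makes facts about letters and pairs of letters decidable by evaluation.\<close>

definition lps_list :: "quat list" where
  "lps_list =
    [Quat 1 4 0 0, Quat 1 (-4) 0 0, Quat 1 0 4 0, Quat 1 0 (-4) 0, Quat 1 0 0 4, Quat 1 0 0 (-4),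
     Quat 3 2 2 0, Quat 3 2 (-2) 0, Quat 3 (-2) 2 0, Quat 3 (-2) (-2) 0,
     Quat 3 2 0 2, Quat 3 2 0 (-2), Quat 3 (-2) 0 2, Quat 3 (-2) 0 (-2),
     Quat 3 0 2 2, Quat 3 0 2 (-2), Quat 3 0 (-2) 2, Quat 3 0 (-2) (-2)]"

definition lps :: "quat set" where "lps = set lps_list"

lemma finite_lps [simp]: "finite lps"
  by (simp add: lps_def)

lemma card_lps: "card lps = 18"
proof -
  have "distinct lps_list" by (simp add: lps_list_def)
  then show ?thesis by (simp add: lps_def distinct_card) (simp add: lps_list_def)
qed

lemma lps_qcnj: "s \<in> lps \<Longrightarrow> qcnj s \<in> lps"
proof -
  have "\<forall>s\<in>set lps_list. qcnj s \<in> set lps_list" by code_simp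
  then show "s \<in> lps \<Longrightarrow> qcnj s \<in> lps" by (simp add: lps_def)
qed

lemma qcnj_lps_iff [simp]: "qcnj s \<in> lps \<longleftrightarrow> s \<in> lps"
  using lps_qcnj by fastforce

lemma lps_qnorm: "s \<in> lps \<Longrightarrow> qnorm s = 17"
proof -
  have "\<forall>s\<in>set lps_list. qnorm s = 17" by code_simp
  then show "s \<in> lps \<Longrightarrow> qnorm s = 17" by (simp add: lps_def)
qed

lemma lps_not_qdvd: "s \<in> lps \<Longrightarrow> \<not> qdvd 17 s"
proof -
  have "\<forall>s\<in>set lps_list. \<not> qdvd 17 s" by code_simp
  then show "s \<in> lps \<Longrightarrow> \<not> qdvd 17 s" by (simp add: lps_def)
qed

text \<open>A check of 306 pairs. Each letter has norm 0 modulo 17, but \<open>s + qcnj t\<close>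
  stays invertible there unless \<open>t\<close> undoes \<open>s\<close>. This takes the place of
  ideal theory in the quaternion order.\<close>

lemma lps_norm_sum:
  assumes "s \<in> lps" "t \<in> lps" "t \<noteq> qcnj s"
  shows "\<not> 17 dvd qnorm (s + qcnj t)"
proof -
  have "\<forall>s\<in>set lps_list. \<forall>t\<in>set lps_list. t \<noteq> qcnj s \<longrightarrow> \<not> 17 dvd qnorm (s + qcnj t)"
    by code_simp
  then show ?thesis using assms by (auto simp: lps_def)
qed

text \<open>A letter followed by its conjugate contributes only the scalar 17. Excluding this leaves
  the walks without backtracking in the 18-regular tree.\<close>

definition reduced :: "quat list \<Rightarrow> bool" where
  "reduced w \<longleftrightarrow> set w \<subseteq> lps \<and> successively (\<lambda>s t. t \<noteq> qcnj s) w"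

lemma reduced_Nil [simp]: "reduced []"
  by (simp add: reduced_def)

lemma reduced_Cons:
  "reduced (s # w) \<longleftrightarrow> s \<in> lps \<and> reduced w \<and> (w = [] \<or> hd w \<noteq> qcnj s)"
  by (cases w) (auto simp: reduced_def)

definition word_inv :: "quat list \<Rightarrow> quat list" where
  "word_inv w = rev (map qcnj w)"

lemma prod_list_word_inv: "prod_list (word_inv w) = qcnj (prod_list w)"
  by (induction w) (simp_all add: word_inv_def qcnj_mult)

lemma length_word_inv [simp]: "length (word_inv w) = length w"
  by (simp add: word_inv_def)

text \<open>The inverse word ends in \<open>qcnj (hd w)\<close>, whose conjugate is
  \<open>hd w\<close>; nothing cancels at the junction exactly because the two heads differ.\<close>

lemma reduced_word_inv_append:
  assumes "reduced w" "reduced w'" "w \<noteq> []" "w' \<noteq> []" "hd w \<noteq> hd w'"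
  shows "reduced (word_inv w @ w')"
proof -
  have 1: "successively (\<lambda>s t. t \<noteq> qcnj s) (word_inv w)"
    using assms(1) unfolding reduced_def word_inv_def successively_rev successively_map
    by (auto elim!: successively_mono simp: eq_commute)
  have 2: "last (word_inv w) = qcnj (hd w)"
    using assms(3) by (simp add: word_inv_def last_rev hd_map)
  show ?thesis using assms 1 2
    by (auto simp: reduced_def successively_append_iff word_inv_def)
qed

lemma qnorm_prod_list: "set w \<subseteq> lps \<Longrightarrow> qnorm (prod_list w) = 17 ^ length w"
  by (induction w) (auto simp: qnorm_mult lps_qnorm)

text \<open>If 17 divided \<open>s X\<close> for \<open>X = t Y\<close>, it would also divide \<open>qcnj t X = 17 Y\<close>, hence
  \<open>(s + qcnj t) X\<close>, hence \<open>X\<close>, because the norm of \<open>s + qcnj t\<close> is prime to 17.\<close>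

lemma reduced_not_qdvd: "reduced w \<Longrightarrow> \<not> qdvd 17 (prod_list w)"
proof (induction w)
  case Nil
  then show ?case by (simp add: qdvd_def one_quat_def)
next
  case (Cons s w)
  show ?case
  proof (cases w)
    case Nil
    then show ?thesis using Cons.prems lps_not_qdvd by (simp add: reduced_Cons)
  next
    case w: (Cons t v)
    define X where "X = prod_list w"
    have st: "s \<in> lps" "t \<in> lps" "t \<noteq> qcnj s" "reduced w"
      using Cons.prems w by (auto simp: reduced_Cons)
    have tX: "qdvd 17 (qcnj t * X)"
      using qdvd_of_int_self[of 17] lps_qnorm[OF st(2)]
      by (simp add: X_def w mult.assoc[symmetric] qcnj_mult_self)
    show ?thesis
    proof
      assume "qdvd 17 (prod_list (s # w))"
      then have "qdvd 17 ((s + qcnj t) * X)"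
        using tX by (simp add: X_def distrib_right qdvd_add)
      then have "qdvd 17 (qcnj (s + qcnj t) * ((s + qcnj t) * X))" by (rule qdvd_mult)
      then have "qdvd 17 (of_int (qnorm (s + qcnj t)) * X)"
        by (simp add: mult.assoc[symmetric] qcnj_mult_self)
      moreover have "coprime 17 (qnorm (s + qcnj t))"
        using lps_norm_sum[OF st(1-3)] by (intro prime_imp_coprime) (simp_all)
      ultimately have "qdvd 17 X" using qdvd_of_int_mult by blast
      then show False using Cons.IH st(4) X_def by simp
    qed
  qed
qed

text \<open>Equal first letters cancel. If they differ, the inverse of one word followed by the
  other is reduced, yet its product is \<open>qcnj x * x\<close>, a positive power of 17, against
  \<open>reduced_not_qdvd\<close>.\<close>

lemma prod_list_inj_reduced:
  assumes "reduced w" "reduced w'" "length w = length w'" "prod_list w = prod_list w'"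
  shows "w = w'"
  using assms
proof (induction w arbitrary: w')
  case Nil
  then show ?case by simp
next
  case (Cons s a)
  then obtain s' a' where w': "w' = s' # a'" by (cases w') auto
  show ?case
  proof (cases "s = s'")
    case True
    have "qnorm s \<noteq> 0" using Cons.prems lps_qnorm by (simp add: reduced_Cons)
    then have "prod_list a = prod_list a'"
      using Cons.prems w' True quat_mult_left_cancel by simp
    then show ?thesis using Cons.IH[of a'] Cons.prems w' True by (simp add: reduced_Cons)
  next
    case False
    have "reduced (word_inv (s # a) @ w')"
      using reduced_word_inv_append Cons.prems False w' by simp
    then have "\<not> qdvd 17 (prod_list (word_inv (s # a) @ w'))" by (rule reduced_not_qdvd)
    moreover have "prod_list (word_inv (s # a) @ w') = of_int (17 ^ length w')"
      using Cons.prems(4) qnorm_prod_list[of w'] Cons.prems(2)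
      by (simp add: prod_list_word_inv qcnj_mult_self reduced_def)
    ultimately show ?thesis using w' by (simp add: of_int_quat qdvd_def)
  qed
qed

section \<open>Lattice points on circles\<close>

definition circle_points :: "int \<Rightarrow> (int \<times> int) set" where
  "circle_points n = {(x, y). x\<^sup>2 + y\<^sup>2 = n}"

text \<open>The quarter of the circle around the positive vertical axis. There \<open>y\<close> is a
  function of \<open>x\<close> of slope at most 1, and \<open>y^2\<close> is at least
  \<open>n / 2\<close>; reflections and rotations supply the rest of the circle.\<close>

definition octant_points :: "int \<Rightarrow> (int \<times> int) set" where
  "octant_points n = {(x, y). x\<^sup>2 + y\<^sup>2 = n \<and> \<bar>x\<bar> \<le> y}"

lemma abs_le_of_square_le:
  fixes x m :: int
  assumes "x\<^sup>2 \<le> m\<^sup>2" "m \<ge> 0"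
  shows "\<bar>x\<bar> \<le> m"
  using assms abs_le_square_iff[of x m] by simp

lemma circle_points_subset: "n \<le> m\<^sup>2 \<Longrightarrow> m \<ge> 0 \<Longrightarrow> circle_points n \<subseteq> {-m..m} \<times> {-m..m}"
  unfolding circle_points_def
  using abs_le_of_square_le[of _ m] by (auto simp: abs_le_iff) (smt (verit) zero_le_power2)+

lemma finite_circle_points [simp]: "finite (circle_points n)"
proof -
  have "n \<le> (max n 0)\<^sup>2"
    using mult_left_mono[of 1 n n] by (cases "n \<ge> 1") (auto simp: power2_eq_square)
  then show ?thesis
    using circle_points_subset[of n "max n 0"] finite_subset by fastforce
qed

text \<open>A line meets a circle at most twice. Eliminating the centre from the two chord equations
  \<open>1\<close> leaves \<open>b * (b - a) * (a^2 + c^2) = 0\<close>, and a vanishing last factor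
  also gives \<open>a = 0\<close>.\<close>

lemma collinear_points_on_circle:
  fixes x1 x2 x3 y1 y2 y3 :: int
  assumes "x1\<^sup>2 + y1\<^sup>2 = n" "x2\<^sup>2 + y2\<^sup>2 = n" "x3\<^sup>2 + y3\<^sup>2 = n"
    and D: "(x2 - x1) * (y3 - y1) = (x3 - x1) * (y2 - y1)"
  shows "x2 = x1 \<or> x3 = x1 \<or> x3 = x2"
proof -
  define a b c d where "a = x2 - x1" and "b = x3 - x1" and "c = y2 - y1" and "d = y3 - y1"
  have 1: "2 * (x1 * a + y1 * c) = - (a\<^sup>2 + c\<^sup>2)" "2 * (x1 * b + y1 * d) = - (b\<^sup>2 + d\<^sup>2)"
    using assms(1-3) by (simp_all add: a_def b_def c_def d_def power2_eq_square algebra_simps)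
  have ad: "a * d = b * c" using D by (simp add: a_def b_def c_def d_def)
  have "a\<^sup>2 * (2 * (x1 * b + y1 * d)) = a * b * (2 * (x1 * a + y1 * c))"
  proof -
    have "a\<^sup>2 * (2 * (x1 * b + y1 * d)) = 2 * a * (x1 * a * b + y1 * (a * d))"
      by (simp add: power2_eq_square algebra_simps)
    then show ?thesis unfolding ad by (simp add: algebra_simps)
  qed
  then have "a\<^sup>2 * (b\<^sup>2 + d\<^sup>2) = a * b * (a\<^sup>2 + c\<^sup>2)" unfolding 1 by (simp add: algebra_simps)
  moreover have "a\<^sup>2 * (b\<^sup>2 + d\<^sup>2) = b\<^sup>2 * (a\<^sup>2 + c\<^sup>2)"
  proof -
    have "a\<^sup>2 * (b\<^sup>2 + d\<^sup>2) = a\<^sup>2 * b\<^sup>2 + (a * d)\<^sup>2"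
      by (simp add: power2_eq_square algebra_simps)
    then show ?thesis unfolding ad by (simp add: power2_eq_square algebra_simps)
  qed
  ultimately have "b * (b - a) * (a\<^sup>2 + c\<^sup>2) = 0" by (simp add: power2_eq_square algebra_simps)
  then have "b = 0 \<or> b = a \<or> a = 0"
    by (auto simp: add_nonneg_eq_0_iff)
  then show ?thesis by (auto simp: a_def b_def)
qed

text \<open>Twice the area of the triangle spanned by three lattice points is a nonzero integer, while
  for three close points on a large circle it is less than 1.\<close>

lemma octant_points_window:
  assumes n: "n > 2 * t ^ 6"
    and pts: "(x1, y1) \<in> octant_points n" "(x2, y2) \<in> octant_points n" "(x3, y3) \<in> octant_points n"
    and win: "\<bar>x2 - x1\<bar> \<le> t" "\<bar>x3 - x1\<bar> \<le> t" "\<bar>x3 - x2\<bar> \<le> t"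
  shows "x2 = x1 \<or> x3 = x1 \<or> x3 = x2"
proof (rule ccontr)
  assume neg: "\<not> ?thesis"
  have c: "x1\<^sup>2 + y1\<^sup>2 = n" "x2\<^sup>2 + y2\<^sup>2 = n" "x3\<^sup>2 + y3\<^sup>2 = n"
    "\<bar>x1\<bar> \<le> y1" "\<bar>x2\<bar> \<le> y2" "\<bar>x3\<bar> \<le> y3"
    using pts by (auto simp: octant_points_def)
  have t: "t \<ge> 0" using win(1) by linarith
  have npos: "n > 0" using n t by (smt (verit) zero_le_power)
  have sq: "2 * y\<^sup>2 \<ge> n" "y > 0" if "x\<^sup>2 + y\<^sup>2 = n" "\<bar>x\<bar> \<le> y" for x y :: int
  proof -
    have "x\<^sup>2 \<le> y\<^sup>2" using that(2) abs_le_square_iff[of x y] by linarith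
    then show "2 * y\<^sup>2 \<ge> n" using that by simp
    show "y > 0" using that npos by (cases "y = 0") auto
  qed
  note y = sq[OF c(1,4)] sq[OF c(2,5)] sq[OF c(3,6)]
  \<comment> \<open>\<open>D\<close> is twice the signed area of the triangle. After multiplication
    by \<open>(y2 + y1) * (y3 + y1)\<close>, the relations \<open>dy\<close> replace differences of
    ordinates by differences of abscissae, which exposes two small factors; \<open>E\<close>
    contains the third.\<close>
  define D where "D = (x2 - x1) * (y3 - y1) - (x3 - x1) * (y2 - y1)"
  define E where "E = (x2 - x3) * (y3 + y1) + (x3 + x1) * (y3 - y2)"
  have D0: "D \<noteq> 0"
    using collinear_points_on_circle[OF c(1-3)] neg by (auto simp: D_def)
  have dy: "(y2 - y1) * (y2 + y1) = - (x2 - x1) * (x2 + x1)" "(y3 - y1) * (y3 + y1) = - (x3 - x1) * (x3 + x1)"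
    using c(1-3) by (simp_all add: power2_eq_square algebra_simps)
  have DE: "D * (y2 + y1) * (y3 + y1) = (x2 - x1) * (x3 - x1) * E"
  proof -
    have "D * (y2 + y1) * (y3 + y1) = (x2 - x1) * (y2 + y1) * ((y3 - y1) * (y3 + y1))
        - (x3 - x1) * (y3 + y1) * ((y2 - y1) * (y2 + y1))"
      by (simp add: D_def algebra_simps)
    then show ?thesis unfolding dy by (simp add: E_def algebra_simps)
  qed
  \<comment> \<open>The arc has slope at most 1.\<close>
  have y32: "\<bar>y3 - y2\<bar> \<le> \<bar>x3 - x2\<bar>"
  proof -
    have "\<bar>y3 - y2\<bar> * (y3 + y2) = \<bar>(y3 - y2) * (y3 + y2)\<bar>"
      using y by (simp add: abs_mult)
    also have "(y3 - y2) * (y3 + y2) = - (x3 - x2) * (x3 + x2)"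
      using c(2,3) by (simp add: power2_eq_square algebra_simps)
    also have "\<bar>\<dots>\<bar> = \<bar>x3 - x2\<bar> * \<bar>x3 + x2\<bar>" by (simp only: abs_mult abs_minus_cancel)
    also have "\<dots> \<le> \<bar>x3 - x2\<bar> * (y3 + y2)" by (rule mult_left_mono) (use c in auto)
    finally show ?thesis using y by (simp add: mult_le_cancel_right)
  qed
  have "\<bar>E\<bar> \<le> \<bar>x3 - x2\<bar> * (y3 + y1) + (y3 + y1) * \<bar>x3 - x2\<bar>"
  proof -
    have "\<bar>E\<bar> \<le> \<bar>x2 - x3\<bar> * (y3 + y1) + \<bar>x3 + x1\<bar> * \<bar>y3 - y2\<bar>"
      unfolding E_def using y abs_triangle_ineq[of "(x2 - x3) * (y3 + y1)" "(x3 + x1) * (y3 - y2)"]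
      by (simp add: abs_mult)
    also have "\<bar>x3 + x1\<bar> * \<bar>y3 - y2\<bar> \<le> (y3 + y1) * \<bar>x3 - x2\<bar>"
      by (rule mult_mono) (use c y y32 in auto)
    finally show ?thesis by (simp add: abs_minus_commute)
  qed
  then have E: "\<bar>E\<bar> \<le> 2 * t * (y3 + y1)"
    using mult_right_mono[OF win(3), of "y3 + y1"] y by (simp add: algebra_simps)
  have "(y2 + y1) * (y3 + y1) \<le> \<bar>D\<bar> * ((y2 + y1) * (y3 + y1))"
    using D0 y mult_right_mono[of 1 "\<bar>D\<bar>" "(y2 + y1) * (y3 + y1)"] by simp
  also have "\<dots> = \<bar>x2 - x1\<bar> * \<bar>x3 - x1\<bar> * \<bar>E\<bar>"
    using arg_cong[OF DE, of abs] y by (simp add: abs_mult mult.assoc)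
  also have "\<dots> \<le> (t * t) * (2 * t * (y3 + y1))"
    by (intro mult_mono E win) (use t in auto)
  finally have "(y2 + y1) * (y3 + y1) \<le> (2 * t ^ 3) * (y3 + y1)"
    by (simp add: power3_eq_cube algebra_simps)
  then have "y2 + y1 \<le> 2 * t ^ 3" using y by (simp add: mult_le_cancel_right)
  then have "(y2 + y1)\<^sup>2 \<le> (2 * t ^ 3)\<^sup>2" by (rule power_mono) (use y in auto)
  then have "y1\<^sup>2 + y2\<^sup>2 + 2 * (y1 * y2) \<le> 4 * t ^ 6"
    by (simp add: power2_eq_square algebra_simps power_mult_distrib flip: power_add)
  \<comment> \<open>Both ordinates have square at least \<open>n / 2\<close>, so
    \<open>(y1 + y2)^2 \<ge> 2 * n > 4 * t^6\<close>, against the upper bound just found.\<close>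
  moreover have "y1 * y2 \<ge> min (y1\<^sup>2) (y2\<^sup>2)"
    using y by (cases "y1 \<le> y2") (auto simp: power2_eq_square min_le_iff_disj mult_left_mono mult_right_mono)
  ultimately show False using y n by (auto simp: min_le_iff_disj)
qed

lemma card_le_2I:
  assumes "finite A" "\<And>a b c. a \<in> A \<Longrightarrow> b \<in> A \<Longrightarrow> c \<in> A \<Longrightarrow> a = b \<or> a = c \<or> b = c"
  shows "card A \<le> 2"
proof (rule ccontr)
  assume "\<not> card A \<le> 2"
  then have "3 \<le> card A" by simp
  then obtain B where "B \<subseteq> A" "card B = 3" by (rule obtain_subset_with_card_n)
  then obtain x y z where "B = {x, y, z}" "x \<noteq> y" "y \<noteq> z" "x \<noteq> z" by (auto simp: card_3_iff)
  then show False using assms(2)[of x y z] \<open>B \<subseteq> A\<close> by auto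
qed

text \<open>Cut the abscissae into windows of width \<open>t\<close>, each holding at most two
  points. Since \<open>x^2 \<le> n / 2 \<le> (t + 1)^6\<close> and \<open>t + 1 \<le> 2 * t\<close>,
  only \<open>16 * t^2 + 1\<close> windows occur.\<close>

lemma card_octant_points:
  assumes t: "t \<ge> 1" and n: "2 * t ^ 6 < n" "n \<le> 2 * (t + 1) ^ 6"
  shows "int (card (octant_points n)) \<le> 34 * t\<^sup>2"
proof -
  define K where "K = {- (8 * t\<^sup>2)..8 * t\<^sup>2}"
  define W where "W k = {p \<in> octant_points n. fst p div t = k}" for k
  have fin: "finite (octant_points n)"
    by (rule finite_subset[OF _ finite_circle_points[of n]]) (auto simp: octant_points_def circle_points_def)
  have xb: "x div t \<in> K" if "(x, y) \<in> octant_points n" for x y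
  proof -
    have "x\<^sup>2 \<le> y\<^sup>2" "x\<^sup>2 + y\<^sup>2 = n"
      using that abs_le_square_iff[of x y] by (auto simp: octant_points_def)
    then have "x\<^sup>2 \<le> (t + 1) ^ 6" using n(2) by linarith
    also have "\<dots> = ((t + 1) ^ 3)\<^sup>2" by (simp flip: power_mult)
    also have "\<dots> \<le> ((2 * t) ^ 3)\<^sup>2" by (intro power_mono) (use t in auto)
    finally have "\<bar>x\<bar> \<le> (2 * t) ^ 3" by (rule abs_le_of_square_le) (use t in auto)
    then have "- (8 * t\<^sup>2) * t \<le> x" "x \<le> (8 * t\<^sup>2) * t"
      by (auto simp: power_mult_distrib power2_eq_square power3_eq_cube abs_le_iff)
    then have "- (8 * t\<^sup>2) * t div t \<le> x div t \<and> x div t \<le> (8 * t\<^sup>2) * t div t"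
      using t by (intro conjI zdiv_mono1) auto
    moreover have "- (8 * t\<^sup>2) * t div t = - (8 * t\<^sup>2)" "(8 * t\<^sup>2) * t div t = 8 * t\<^sup>2"
      by (rule nonzero_mult_div_cancel_right, use t in simp)+
    ultimately show ?thesis unfolding K_def by (simp only: atLeastAtMost_iff)
  qed
  have W2: "card (W k) \<le> 2" for k
  proof (rule card_le_2I)
    show "finite (W k)" using fin by (simp add: W_def)
    fix a b c assume abc: "a \<in> W k" "b \<in> W k" "c \<in> W k"
    obtain x1 y1 x2 y2 x3 y3 where p: "a = (x1, y1)" "b = (x2, y2)" "c = (x3, y3)"
      by (metis prod.exhaust)
    have O: "(x1, y1) \<in> octant_points n" "(x2, y2) \<in> octant_points n" "(x3, y3) \<in> octant_points n"
      and k: "x1 div t = k" "x2 div t = k" "x3 div t = k"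
      using abc by (auto simp: W_def p)
    have win: "\<bar>x - x'\<bar> \<le> t" if "x div t = k" "x' div t = k" for x x'
    proof -
      have "x = k * t + x mod t" "x' = k * t + x' mod t" using that by (metis div_mult_mod_eq)+
      moreover have "0 \<le> x mod t" "x mod t < t" "0 \<le> x' mod t" "x' mod t < t" using t by auto
      ultimately show ?thesis by linarith
    qed
    have "x2 = x1 \<or> x3 = x1 \<or> x3 = x2"
      by (rule octant_points_window[OF n(1) O]) (use k win in auto)
    moreover have "y = y'" if "(x, y) \<in> octant_points n" "(x, y') \<in> octant_points n" for x y y'
    proof -
      have "y\<^sup>2 = y'\<^sup>2" "y \<ge> 0" "y' \<ge> 0" using that by (auto simp: octant_points_def)
      then show ?thesis by (simp add: power2_eq_iff_nonneg)
    qed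
    ultimately show "a = b \<or> a = c \<or> b = c" using O p by metis
  qed
  have "octant_points n \<subseteq> (\<Union>k\<in>K. W k)" using xb by (auto simp: W_def)
  then have "card (octant_points n) \<le> card (\<Union>k\<in>K. W k)"
    by (rule card_mono[rotated]) (use fin in \<open>auto simp: K_def W_def\<close>)
  also have "\<dots> \<le> (\<Sum>k\<in>K. card (W k))" by (rule card_UN_le) (simp add: K_def)
  also have "\<dots> \<le> card K * 2" using sum_bounded_above[of K "\<lambda>k. card (W k)" 2] W2 by simp
  finally have "int (card (octant_points n)) \<le> int (card K) * 2" by linarith
  also have "int (card K) = 16 * t\<^sup>2 + 1" by (simp add: K_def)
  also have "(16 * t\<^sup>2 + 1) * 2 \<le> 34 * t\<^sup>2" using t by (simp add: one_le_power)
  finally show ?thesis .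
qed

lemma card_circle_points_le: "card (circle_points n) \<le> 4 * card (octant_points n)"
proof -
  let ?O = "octant_points n"
  have fin: "finite ?O"
    by (rule finite_subset[OF _ finite_circle_points[of n]]) (auto simp: octant_points_def circle_points_def)
  define g where "g = (\<lambda>(k :: nat, x :: int, y :: int).
    if k = 0 then (x, y) else if k = 1 then (x, - y) else if k = 2 then (y, x) else (- y, x))"
  have "circle_points n \<subseteq> g ` ({..<4} \<times> ?O)"
  proof safe
    fix x y assume xy: "(x, y) \<in> circle_points n"
    consider "\<bar>x\<bar> \<le> y" | "\<bar>x\<bar> \<le> - y" | "\<bar>y\<bar> \<le> x" | "\<bar>y\<bar> \<le> - x" by linarith
    then show "(x, y) \<in> g ` ({..<4} \<times> ?O)"
    proof cases
      case 1
      then show ?thesis using xy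
        by (intro image_eqI[of _ _ "(0, x, y)"]) (auto simp: g_def octant_points_def circle_points_def)
    next
      case 2
      then show ?thesis using xy
        by (intro image_eqI[of _ _ "(1, x, - y)"]) (auto simp: g_def octant_points_def circle_points_def)
    next
      case 3
      then show ?thesis using xy
        by (intro image_eqI[of _ _ "(2, y, x)"]) (auto simp: g_def octant_points_def circle_points_def)
    next
      case 4
      then show ?thesis using xy
        by (intro image_eqI[of _ _ "(3, y, - x)"]) (auto simp: g_def octant_points_def circle_points_def)
    qed
  qed
  then have "card (circle_points n) \<le> card ({..<4::nat} \<times> ?O)"
    by (rule surj_card_le[rotated]) (use fin in auto)
  then show ?thesis by (simp add: card_cartesian_product)
qed

text \<open>With window width about \<open>(n / 2)^(1/6)\<close>, the count \<open>136 * t^2\<close>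
  becomes a multiple of the cube root. The bound is stated for any real \<open>N\<close> above
  \<open>n\<close>, so that it can be used uniformly over circles of different radii.\<close>

lemma card_circle_points_powr:
  assumes nN: "real_of_int n \<le> N" and N: "N \<ge> 1"
  shows "real (card (circle_points n)) \<le> 200 * N powr (1 / 3)"
proof (cases "n \<le> 2")
  case True
  then have "card (circle_points n) \<le> card ({-2..2::int} \<times> {-2..2::int})"
    by (intro card_mono circle_points_subset) auto
  also have "\<dots> = 25" by (simp add: card_cartesian_product)
  finally have "real (card (circle_points n)) \<le> 200 * 1" by simp
  also have "\<dots> \<le> 200 * N powr (1 / 3)" using N by (intro mult_left_mono ge_one_powr_ge_zero) auto
  finally show ?thesis .
next
  case False
  \<comment> \<open>The least \<open>t\<close> with \<open>P t\<close> satisfies the upper bound of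
    \<open>card_octant_points\<close>; its minimality is the strict lower bound
    \<open>2 * t^6 < n\<close>. Since \<open>n > 2\<close>, it is not 0.\<close>
  define P where "P t \<longleftrightarrow> n \<le> 2 * (int t + 1) ^ 6" for t
  have "P (nat n)"
  proof -
    have "n \<le> (n + 1) ^ 1" by simp
    also have "\<dots> \<le> (n + 1) ^ 6" using False by (intro power_increasing) auto
    finally show ?thesis using False by (simp add: P_def)
  qed
  define t where "t = (LEAST t. P t)"
  have Pt: "P t" unfolding t_def by (rule LeastI[of P, OF \<open>P (nat n)\<close>])
  have "\<not> P 0" using False by (simp add: P_def)
  then have t0: "t \<noteq> 0" using Pt by metis
  have "\<not> P (t - 1)" using t0 not_less_Least[of "t - 1" P] by (simp add: t_def)
  then have lo: "2 * int t ^ 6 < n" using t0 by (simp add: P_def of_nat_diff)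
  have "int (card (octant_points n)) \<le> 34 * (int t)\<^sup>2"
    by (rule card_octant_points) (use t0 lo Pt in \<open>auto simp: P_def\<close>)
  then have "int (card (circle_points n)) \<le> 136 * (int t)\<^sup>2"
    using card_circle_points_le[of n] by linarith
  then have "real_of_int (int (card (circle_points n))) \<le> real_of_int (136 * (int t)\<^sup>2)"
    by (simp only: of_int_le_iff)
  then have *: "real (card (circle_points n)) \<le> 136 * (real t)\<^sup>2" by simp
  have "real_of_int (2 * int t ^ 6) < real_of_int n" using lo by (simp only: of_int_less_iff)
  then have "real t ^ 6 \<le> N" using nN by simp (smt (verit) zero_le_power of_nat_0_le_iff)
  then have "(real t ^ 6) powr (1 / 3) \<le> N powr (1 / 3)" by (intro powr_mono2) auto
  moreover have "(real t ^ 6) powr (1 / 3) = (real t)\<^sup>2"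
  proof -
    have "real t ^ 6 = real t powr 6" using t0 powr_realpow[of "real t" 6] by simp
    then have "(real t ^ 6) powr (1 / 3) = real t powr 2" by (simp only: powr_powr) simp
    then show ?thesis using t0 by simp
  qed
  ultimately show ?thesis using * by simp
qed

section \<open>Collisions of words modulo a prime\<close>

text \<open>Quaternions that look modulo \<open>q\<close> like the scalar \<open>17 ^ l\<close> of
  the same norm. They arise as \<open>qcnj x * y\<close> from colliding products \<open>x\<close>
  and \<open>y\<close> of \<open>l\<close> letters each.\<close>

definition near_ids :: "int \<Rightarrow> nat \<Rightarrow> quat set" where
  "near_ids q l = {x. qnorm x = 17 ^ (2 * l) \<and> qdvd q (x - of_int (17 ^ l))}"

lemma qnorm_coord_bound:
  assumes "qnorm x = X\<^sup>2" "X \<ge> 0"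
  shows "\<bar>q0 x\<bar> \<le> X" "\<bar>q1 x\<bar> \<le> X" "\<bar>q2 x\<bar> \<le> X" "\<bar>q3 x\<bar> \<le> X"
proof -
  have "(q0 x)\<^sup>2 \<le> X\<^sup>2" "(q1 x)\<^sup>2 \<le> X\<^sup>2" "(q2 x)\<^sup>2 \<le> X\<^sup>2" "(q3 x)\<^sup>2 \<le> X\<^sup>2"
    unfolding assms(1)[symmetric] qnorm_def by simp_all
  then show "\<bar>q0 x\<bar> \<le> X" "\<bar>q1 x\<bar> \<le> X" "\<bar>q2 x\<bar> \<le> X" "\<bar>q3 x\<bar> \<le> X"
    using abs_le_of_square_le assms(2) by blast+
qed

lemma finite_near_ids [simp]: "finite (near_ids q l)"
proof (rule finite_subset)
  let ?I = "{- (17 ^ l)..17 ^ l :: int}"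
  show "near_ids q l \<subseteq> (\<lambda>(a, b, c, d). Quat a b c d) ` (?I \<times> ?I \<times> ?I \<times> ?I)"
  proof
    fix x assume "x \<in> near_ids q l"
    then have "qnorm x = (17 ^ l)\<^sup>2" by (simp add: near_ids_def power_mult mult.commute)
    from qnorm_coord_bound[OF this]
    show "x \<in> (\<lambda>(a, b, c, d). Quat a b c d) ` (?I \<times> ?I \<times> ?I \<times> ?I)"
      by (intro image_eqI[of _ _ "(q0 x, q1 x, q2 x, q3 x)"]) (auto simp: abs_le_iff)
  qed
qed auto

lemma coprime_prime_gt:
  fixes q n :: int
  assumes "prime q" "q > n" "n > 0"
  shows "coprime q n"
  using assms zdvd_imp_le[of q n] by (intro prime_imp_coprime) auto

text \<open>A whole factor \<open>q\<close> is gained: by the norm equation \<open>q^2\<close>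
  divides \<open>(X - q0 x) * (X + q0 x)\<close>, and \<open>X + q0 x\<close> is congruent to
  \<open>2 * X\<close>, a unit modulo \<open>q\<close>. So the real coordinate is fixed modulo
  \<open>q^2\<close>, the other three only modulo \<open>q\<close>.\<close>

lemma near_ids_coords:
  fixes q :: int and l :: nat
  assumes q: "prime q" "q > 17" and x: "x \<in> near_ids q l"
  defines "X \<equiv> 17 ^ l :: int"
  obtains k b c d where "x = Quat (X - q\<^sup>2 * k) (q * b) (q * c) (q * d)"
    "k \<in> {0..2 * X div q\<^sup>2}" "b \<in> {- (X div q)..X div q}"
    "c\<^sup>2 + d\<^sup>2 = (X\<^sup>2 - (q0 x)\<^sup>2 - (q1 x)\<^sup>2) div q\<^sup>2"
proof -
  have norm: "qnorm x = X\<^sup>2" using x by (simp add: near_ids_def X_def power_mult mult.commute)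
  note bnd = qnorm_coord_bound[OF norm]
  have X0: "X \<ge> 0" by (simp add: X_def)
  have dv: "q dvd q0 x - X" "q dvd q1 x" "q dvd q2 x" "q dvd q3 x"
    using x by (auto simp: near_ids_def qdvd_def of_int_quat minus_quat_def X_def)
  obtain b c d where bcd: "q1 x = q * b" "q2 x = q * c" "q3 x = q * d"
    using dv by (auto elim!: dvdE)
  have sum: "X\<^sup>2 - (q0 x)\<^sup>2 = q\<^sup>2 * (b\<^sup>2 + c\<^sup>2 + d\<^sup>2)"
    using norm by (simp add: qnorm_def bcd power_mult_distrib algebra_simps)
  have "coprime q 2" "coprime q 17"
    using q by (intro coprime_prime_gt; simp)+
  then have "coprime q (2 * X)" by (simp add: X_def)
  moreover have "gcd q (X + q0 x) = gcd q (2 * X)"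
  proof -
    have "X + q0 x = 2 * X + (q0 x - X)" by simp
    then show ?thesis using dv(1) by (metis dvdE gcd_add_mult mult.commute add.commute)
  qed
  ultimately have "coprime q (X + q0 x)" by (simp add: coprime_iff_gcd_eq_1)
  then have "coprime (q\<^sup>2) (X + q0 x)" by simp
  moreover have "q\<^sup>2 dvd (X - q0 x) * (X + q0 x)"
    using sum by (metis dvd_triv_left square_diff_square_factored power2_eq_square mult.commute)
  ultimately have "q\<^sup>2 dvd X - q0 x" by (simp add: coprime_dvd_mult_left_iff)
  then obtain k where k: "X - q0 x = q\<^sup>2 * k" by (auto elim!: dvdE)
  have q0: "q > 0" "q\<^sup>2 > 0" using q by auto
  have "0 \<le> q\<^sup>2 * k" "q\<^sup>2 * k \<le> 2 * X" using bnd(1) X0 k by (auto simp: abs_le_iff)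
  then have kr: "k \<in> {0..2 * X div q\<^sup>2}"
    using q0 zdiv_mono1[of "q\<^sup>2 * k" "2 * X" "q\<^sup>2"] by (simp add: zero_le_mult_iff)
  have "\<bar>b\<bar> * q \<le> X" using bnd(2) X0 q0 by (simp add: bcd abs_mult mult.commute)
  then have "\<bar>b\<bar> \<le> X div q" using q0 zdiv_mono1[of "\<bar>b\<bar> * q" X q] by simp
  then have br: "b \<in> {- (X div q)..X div q}" by (auto simp: abs_le_iff)
  have "X\<^sup>2 - (q0 x)\<^sup>2 - (q1 x)\<^sup>2 = q\<^sup>2 * (c\<^sup>2 + d\<^sup>2)"
    using sum by (simp add: bcd power_mult_distrib algebra_simps)
  then have "c\<^sup>2 + d\<^sup>2 = (X\<^sup>2 - (q0 x)\<^sup>2 - (q1 x)\<^sup>2) div q\<^sup>2" using q0 by simp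
  moreover have "x = Quat (X - q\<^sup>2 * k) (q * b) (q * c) (q * d)"
    using k bcd by (simp add: quat_eq_iff)
  ultimately show thesis using that kr br by blast
qed

text \<open>The factors count the real coordinate, the first imaginary coordinate, and the points of
  a circle of radius at most \<open>X / q\<close> for the last two. The maximum with 1 covers radii
  below 1.\<close>

lemma card_near_ids:
  fixes q :: int and l :: nat
  assumes q: "prime q" "q > 17"
  defines "X \<equiv> 17 ^ l :: real"
  shows "real (card (near_ids q l))
    \<le> (2 * X / (real_of_int q)\<^sup>2 + 1) * (2 * X / q + 1) * (200 * max 1 (X / q) powr (2 / 3))"
proof -
  define Xi where "Xi = (17 ^ l :: int)"
  have Xi: "real_of_int Xi = X" by (simp add: Xi_def X_def)
  define I where "I = (\<lambda>k. Xi - q\<^sup>2 * k) ` {0..2 * Xi div q\<^sup>2}"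
  define J where "J = (\<lambda>b. q * b) ` {- (Xi div q)..Xi div q}"
  define F where "F = (\<lambda>(u, v). {x \<in> near_ids q l. q0 x = u \<and> q1 x = v})"
  define R where "R = 200 * max 1 (X / q) powr (2 / 3)"
  have q0: "q > 0" "q\<^sup>2 > 0" using q by auto
  have X0: "X > 0" by (simp add: X_def)
  have cF: "real (card (F uv)) \<le> R" for uv
  proof -
    obtain u v where uv: "uv = (u, v)" by (cases uv)
    define n where "n = (Xi\<^sup>2 - u\<^sup>2 - v\<^sup>2) div q\<^sup>2"
    have "card (F uv) \<le> card (circle_points n)"
    proof (rule card_inj_on_le[of "\<lambda>x. (q2 x div q, q3 x div q)"])
      show "inj_on (\<lambda>x. (q2 x div q, q3 x div q)) (F uv)"
      proof (rule inj_onI)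
        fix x y assume "x \<in> F uv" "y \<in> F uv" and eq: "(q2 x div q, q3 x div q) = (q2 y div q, q3 y div q)"
        then have xy: "x \<in> near_ids q l" "y \<in> near_ids q l" "q0 x = q0 y" "q1 x = q1 y"
          by (auto simp: F_def uv)
        have "q dvd q2 x" "q dvd q3 x" "q dvd q2 y" "q dvd q3 y"
          using xy(1,2) by (auto simp: near_ids_def qdvd_def of_int_quat minus_quat_def)
        then have "q2 x = q2 y" "q3 x = q3 y" using eq by (metis dvd_div_mult_self prod.inject)+
        then show "x = y" using xy by (simp add: quat_eq_iff)
      qed
      show "(\<lambda>x. (q2 x div q, q3 x div q)) ` F uv \<subseteq> circle_points n"
      proof safe
        fix x assume "x \<in> F uv"
        then have x: "x \<in> near_ids q l" "q0 x = u" "q1 x = v" by (auto simp: F_def uv)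
        obtain k b c d where "x = Quat (Xi - q\<^sup>2 * k) (q * b) (q * c) (q * d)"
          "c\<^sup>2 + d\<^sup>2 = (Xi\<^sup>2 - (q0 x)\<^sup>2 - (q1 x)\<^sup>2) div q\<^sup>2"
          using near_ids_coords[OF q x(1)] unfolding Xi_def by metis
        then show "(q2 x div q, q3 x div q) \<in> circle_points n"
          using q0 x by (simp add: circle_points_def n_def)
      qed
    qed simp
    then have "real (card (F uv)) \<le> real (card (circle_points n))" by simp
    also have "\<dots> \<le> 200 * (max 1 ((X / q)\<^sup>2)) powr (1 / 3)"
    proof (rule card_circle_points_powr)
      have "n \<le> Xi\<^sup>2 div q\<^sup>2" unfolding n_def using q0 zero_le_power2[of u] zero_le_power2[of v] by (intro zdiv_mono1) linarith+
      then have "real_of_int n \<le> real_of_int (Xi\<^sup>2 div q\<^sup>2)" by simp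
      also have "\<dots> \<le> real_of_int (Xi\<^sup>2) / real_of_int (q\<^sup>2)" by (rule real_of_int_div4)
      also have "\<dots> = (X / q)\<^sup>2" by (simp add: Xi[symmetric] power_divide)
      finally show "real_of_int n \<le> max 1 ((X / q)\<^sup>2)" by simp
    qed simp
    also have "max 1 ((X / q)\<^sup>2) = (max 1 (X / q))\<^sup>2"
    proof (cases "X / q \<le> 1")
      case True
      then show ?thesis using X0 q0 power_le_one[of "X / q" 2] by (simp add: max_def)
    next
      case False
      then show ?thesis using one_le_power[of "X / q" 2] by (simp add: max_def del: power_divide)
    qed
    also have "((max 1 (X / q))\<^sup>2) powr (1 / 3) = max 1 (X / q) powr (2 / 3)"
    proof -
      have "(max 1 (X / q))\<^sup>2 = max 1 (X / q) powr 2" by simp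
      then show ?thesis by (simp only: powr_powr) simp
    qed
    finally show ?thesis by (simp add: R_def)
  qed
  have "near_ids q l \<subseteq> (\<Union>uv\<in>I \<times> J. F uv)"
  proof
    fix x assume x: "x \<in> near_ids q l"
    obtain k b c d where "x = Quat (Xi - q\<^sup>2 * k) (q * b) (q * c) (q * d)"
      "k \<in> {0..2 * Xi div q\<^sup>2}" "b \<in> {- (Xi div q)..Xi div q}"
      using near_ids_coords[OF q x] unfolding Xi_def by metis
    then show "x \<in> (\<Union>uv\<in>I \<times> J. F uv)" using x by (auto simp: I_def J_def F_def)
  qed
  then have "card (near_ids q l) \<le> card (\<Union>uv\<in>I \<times> J. F uv)"
    by (rule card_mono[rotated]) (auto simp: I_def J_def F_def)
  also have "\<dots> \<le> (\<Sum>uv\<in>I \<times> J. card (F uv))" by (rule card_UN_le) (auto simp: I_def J_def)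
  finally have "real (card (near_ids q l)) \<le> (\<Sum>uv\<in>I \<times> J. real (card (F uv)))"
    by (simp flip: of_nat_sum)
  also have "\<dots> \<le> real (card (I \<times> J)) * R" using sum_bounded_above[of "I \<times> J", OF cF] by simp
  also have "\<dots> \<le> ((2 * X / q\<^sup>2 + 1) * (2 * X / q + 1)) * R"
  proof (rule mult_right_mono)
    have "real (card I) \<le> real (card {0..2 * Xi div q\<^sup>2})"
      unfolding I_def using card_image_le[of "{0..2 * Xi div q\<^sup>2}"] by simp
    also have "\<dots> = real_of_int (2 * Xi div q\<^sup>2) + 1"
      using q0 by (simp add: Xi_def pos_imp_zdiv_nonneg_iff)
    also have "\<dots> \<le> 2 * X / q\<^sup>2 + 1"
      using real_of_int_div4[of "2 * Xi" "q\<^sup>2"] by (simp add: Xi)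
    finally have cI: "real (card I) \<le> 2 * X / q\<^sup>2 + 1" .
    have "real (card J) \<le> real (card {- (Xi div q)..Xi div q})"
      unfolding J_def using card_image_le[of "{- (Xi div q)..Xi div q}"] by simp
    also have "\<dots> = 2 * real_of_int (Xi div q) + 1"
      using q0 by (simp add: Xi_def pos_imp_zdiv_nonneg_iff)
    also have "\<dots> \<le> 2 * X / q + 1"
      using real_of_int_div4[of "Xi" "q"] by (simp add: Xi)
    finally have cJ: "real (card J) \<le> 2 * X / q + 1" .
    show "real (card (I \<times> J)) \<le> (2 * X / q\<^sup>2 + 1) * (2 * X / q + 1)"
      unfolding card_cartesian_product of_nat_mult
      by (rule mult_mono[OF cI cJ]) (use X0 q0 in auto)
  qed (simp add: R_def)
  finally show ?thesis by (simp add: R_def)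
qed

text \<open>This is where 11/5 comes from: at \<open>X = q^(11/5)\<close> the three factors have
  orders \<open>q^(1/5)\<close>, \<open>q^(6/5)\<close> and \<open>q^(4/5)\<close>, with product of
  order \<open>X\<close>. For \<open>X \<le> q\<close> all of them are bounded.\<close>

lemma near_ids_bound_real:
  fixes X q :: real
  assumes "X \<ge> 1" "q \<ge> 2" "X \<le> q powr (11 / 5)"
  shows "(2 * X / q\<^sup>2 + 1) * (2 * X / q + 1) * (200 * max 1 (X / q) powr (2 / 3)) \<le> 3600 * X"
proof (cases "X \<le> q")
  case True
  have "X \<le> q * q" using True assms(2) mult_left_mono[of 1 q q] by linarith
  then have "2 * X / q\<^sup>2 + 1 \<le> 3" "2 * X / q + 1 \<le> 3"
    using True assms by (auto simp: field_simps power2_eq_square)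
  then have "(2 * X / q\<^sup>2 + 1) * (2 * X / q + 1) \<le> 3 * 3"
    by (intro mult_mono) (use assms in auto)
  moreover have "max 1 (X / q) = 1" using True assms by (simp add: max_def)
  ultimately show ?thesis using assms(1) by (simp only: powr_one_eq_one mult_1_right)
next
  case False
  define r where "r = X / q"
  have r: "r \<ge> 1" "X = r * q" using False assms by (auto simp: r_def)
  have qp: "q powr (11 / 5) = q powr (6 / 5) * q"
    using assms powr_add[of q "6 / 5" 1] by simp
  have "r \<le> q powr (6 / 5)" using assms(2,3) unfolding r(2) qp by simp
  then have rb: "r powr (2 / 3) \<le> (q powr (6 / 5)) powr (2 / 3)" "r / q \<le> q powr (6 / 5) / q"
    using r assms by (auto intro!: powr_mono2 divide_right_mono)
  have "q powr (6 / 5) = q powr (1 / 5) * q"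
    using assms powr_add[of q "1 / 5" 1] by simp
  then have rq: "r / q \<le> q powr (1 / 5)" using rb(2) assms by simp
  have r23: "r powr (2 / 3) \<le> q powr (4 / 5)" using rb(1) by (simp add: powr_powr)
  have q15: "q powr (1 / 5) \<ge> 1" using assms by (intro ge_one_powr_ge_zero) auto
  have e1: "2 * X / q\<^sup>2 + 1 \<le> 3 * q powr (1 / 5)"
  proof -
    have "2 * X / q\<^sup>2 = 2 * (r / q)" unfolding r(2) using assms by (simp add: power2_eq_square)
    then show ?thesis using rq q15 by linarith
  qed
  have e2: "2 * X / q + 1 \<le> 3 * r"
  proof -
    have "2 * X / q = 2 * r" by (simp add: r_def)
    then show ?thesis using r(1) by linarith
  qed
  have "(2 * X / q\<^sup>2 + 1) * (2 * X / q + 1) * (200 * max 1 (X / q) powr (2 / 3))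
      \<le> (3 * q powr (1 / 5)) * (3 * r) * (200 * q powr (4 / 5))"
    using r(1) r23 assms(1,2) by (intro mult_mono e1 e2) (auto simp: r_def[symmetric] max_def)
  also have "\<dots> = 1800 * r * (q powr (1 / 5) * q powr (4 / 5))" by simp
  also have "\<dots> = 1800 * r * q" using assms by (simp flip: powr_add)
  also have "\<dots> \<le> 3600 * X" unfolding r(2) using r(1) assms(2) by simp
  finally show ?thesis .
qed

section \<open>Pairs of reduced words with congruent products\<close>

definition words :: "quat \<Rightarrow> nat \<Rightarrow> quat list set" where
  "words e m = {w. reduced w \<and> length w = m \<and> (w = [] \<or> hd w \<noteq> e)}"

text \<open>Ordered pairs, the diagonal included. The forbidden first letter \<open>e\<close> makes
  the count recursive: what follows a letter \<open>s\<close> in a reduced word must not begin with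
  \<open>qcnj s\<close>.\<close>

definition collisions :: "int \<Rightarrow> quat \<Rightarrow> nat \<Rightarrow> (quat list \<times> quat list) set" where
  "collisions q e m = {(w, w'). w \<in> words e m \<and> w' \<in> words e m \<and> qdvd q (prod_list w - prod_list w')}"

lemma finite_words [simp]: "finite (words e m)"
  by (rule finite_subset[OF _ finite_lists_length_eq[OF finite_lps, of m]])
    (auto simp: words_def reduced_def)

lemma finite_collisions [simp]: "finite (collisions q e m)"
  by (rule finite_subset[of _ "words e m \<times> words e m"]) (auto simp: collisions_def)

text \<open>With different heads, the inverse of \<open>w\<close> followed by \<open>w'\<close> is a
  reduced word of fixed length. Its product determines the pair by unique factorization, and is
  congruent to \<open>qcnj x * x\<close>, the scalar power of 17.\<close>

lemma card_collisions_distinct_hd: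
  assumes q: "coprime q 17"
  shows "card {(w, w') \<in> collisions q e (Suc m). hd w \<noteq> hd w'} \<le> card (near_ids q (Suc m))"
proof (rule card_inj_on_le[of "\<lambda>(w, w'). prod_list (word_inv w @ w')"])
  let ?A = "{(w, w') \<in> collisions q e (Suc m). hd w \<noteq> hd w'}"
  have A: "reduced w" "reduced w'" "length w = Suc m" "length w' = Suc m" "hd w \<noteq> hd w'"
    "qdvd q (prod_list w - prod_list w')" if "(w, w') \<in> ?A" for w w'
    using that by (auto simp: collisions_def words_def)
  have red: "reduced (word_inv w @ w')" if "(w, w') \<in> ?A" for w w'
    using A[OF that] by (intro reduced_word_inv_append) auto
  show "inj_on (\<lambda>(w, w'). prod_list (word_inv w @ w')) ?A"
  proof (rule inj_onI, clarify)
    fix w w' v v'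
    assume wv: "(w, w') \<in> collisions q e (Suc m)" "hd w \<noteq> hd w'"
      "(v, v') \<in> collisions q e (Suc m)" "hd v \<noteq> hd v'"
      "prod_list (word_inv w @ w') = prod_list (word_inv v @ v')"
    have "word_inv w @ w' = word_inv v @ v'"
      by (rule prod_list_inj_reduced) (use wv A[of w w'] A[of v v'] red[of w w'] red[of v v'] in auto)
    then have "word_inv w = word_inv v" "w' = v'"
      using A[of w w'] A[of v v'] wv by auto
    moreover have "map qcnj (map qcnj u) = u" for u by (simp add: comp_def)
    ultimately show "w = v \<and> w' = v'" unfolding word_inv_def by (metis rev_rev_ident)
  qed
  show "(\<lambda>(w, w'). prod_list (word_inv w @ w')) ` ?A \<subseteq> near_ids q (Suc m)"
  proof clarify
    fix w w' assume "(w, w') \<in> collisions q e (Suc m)" "hd w \<noteq> hd w'"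
    then have w: "(w, w') \<in> ?A" by simp
    have lps: "set w \<subseteq> lps" "set w' \<subseteq> lps" using A(1,2)[OF w] by (auto simp: reduced_def)
    have 1: "prod_list (word_inv w @ w') = qcnj (prod_list w) * prod_list w'"
      by (simp add: prod_list_word_inv)
    have "qnorm (prod_list (word_inv w @ w')) = 17 ^ (2 * Suc m)"
      unfolding 1 qnorm_mult using qnorm_prod_list lps A(3,4)[OF w] by (simp add: mult_2 power_add)
    moreover have "qcnj (prod_list w) * prod_list w' - of_int (17 ^ Suc m)
        = qcnj (prod_list w) * (- (prod_list w - prod_list w'))"
      using qnorm_prod_list[OF lps(1)] A(3)[OF w]
      by (simp add: right_diff_distrib qcnj_mult_self)
    moreover have "qdvd q (- (prod_list w - prod_list w'))"
      using A(6)[OF w] by (simp add: qdvd_def uminus_quat_def)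
    ultimately show "prod_list (word_inv w @ w') \<in> near_ids q (Suc m)"
      unfolding near_ids_def using 1 qdvd_mult by auto
  qed
qed simp

text \<open>Either the heads differ, or the common head \<open>s\<close> cancels modulo
  \<open>q\<close>, because its norm 17 is a unit, and the tails collide.\<close>

lemma card_collisions_Suc:
  assumes q: "coprime q 17"
  shows "card (collisions q e (Suc m))
    \<le> card (near_ids q (Suc m)) + (\<Sum>s\<in>lps - {e}. card (collisions q (qcnj s) m))"
proof -
  define A where "A = {(w, w') \<in> collisions q e (Suc m). hd w \<noteq> hd w'}"
  define B where "B s = (\<lambda>(a, a'). (s # a, s # a')) ` collisions q (qcnj s) m" for s
  have "collisions q e (Suc m) \<subseteq> A \<union> (\<Union>s\<in>lps - {e}. B s)"
  proof clarify
    fix w w' assume c: "(w, w') \<in> collisions q e (Suc m)" and nB: "(w, w') \<notin> (\<Union>s\<in>lps - {e}. B s)"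
    obtain s a s' a' where w: "w = s # a" "w' = s' # a'"
      using c by (cases w; cases w') (auto simp: collisions_def words_def)
    show "(w, w') \<in> A"
    proof (rule ccontr)
      assume "(w, w') \<notin> A"
      then have s: "s' = s" using c w by (auto simp: A_def)
      have sl: "s \<in> lps - {e}" using c w by (auto simp: collisions_def words_def reduced_Cons)
      have "qdvd q (a_prod - a_prod')" if "a_prod = prod_list a" "a_prod' = prod_list a'" for a_prod a_prod'
        using c that qdvd_cancel_left[of q s] lps_qnorm[of s] q sl
        by (auto simp: collisions_def w s)
      then have "(a, a') \<in> collisions q (qcnj s) m"
        using c by (auto simp: collisions_def words_def w s reduced_Cons)
      then show False using nB sl by (auto simp: B_def w s)
    qed
  qed
  then have "card (collisions q e (Suc m)) \<le> card (A \<union> (\<Union>s\<in>lps - {e}. B s))"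
    by (rule card_mono[rotated]) (auto simp: A_def B_def intro: finite_subset[OF _ finite_collisions[of q e "Suc m"]])
  also have "\<dots> \<le> card A + card (\<Union>s\<in>lps - {e}. B s)" by (rule card_Un_le)
  also have "card (\<Union>s\<in>lps - {e}. B s) \<le> (\<Sum>s\<in>lps - {e}. card (B s))" by (rule card_UN_le) simp
  also have "\<dots> \<le> (\<Sum>s\<in>lps - {e}. card (collisions q (qcnj s) m))"
    unfolding B_def by (intro sum_mono card_image_le) simp
  also have "card A \<le> card (near_ids q (Suc m))"
    unfolding A_def by (rule card_collisions_distinct_hd[OF q])
  finally show ?thesis by simp
qed

text \<open>For a letter \<open>e\<close> there are 17 admissible heads, and each tail again forbids
  a letter; iteration produces the geometric weights.\<close>

lemma card_collisions_le_sum: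
  assumes q: "coprime q 17" and e: "e \<in> lps"
  shows "card (collisions q e m) \<le> (\<Sum>l\<le>m. 17 ^ (m - l) * card (near_ids q l))"
  using e
proof (induction m arbitrary: e)
  case 0
  have "collisions q e 0 \<subseteq> {([], [])}" by (auto simp: collisions_def words_def)
  then have "card (collisions q e 0) \<le> 1" using card_mono[of "{([], [])}"] by simp
  moreover have "1 \<in> near_ids q 0" by (simp add: near_ids_def qdvd_def zero_quat_def)
  then have "card (near_ids q 0) \<ge> 1" by (metis One_nat_def Suc_leI card_gt_0_iff empty_iff finite_near_ids)
  ultimately show ?case by simp
next
  case (Suc m)
  let ?B = "\<Sum>l\<le>m. 17 ^ (m - l) * card (near_ids q l)"
  have "card (collisions q e (Suc m)) \<le> card (near_ids q (Suc m)) + (\<Sum>s\<in>lps - {e}. card (collisions q (qcnj s) m))"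
    by (rule card_collisions_Suc[OF q])
  also have "(\<Sum>s\<in>lps - {e}. card (collisions q (qcnj s) m)) \<le> (\<Sum>s\<in>lps - {e}. ?B)"
    using Suc.IH by (intro sum_mono) auto
  also have "\<dots> = 17 * ?B" using Suc.prems card_lps by simp
  also have "17 * ?B = (\<Sum>l\<le>m. 17 ^ (Suc m - l) * card (near_ids q l))"
    unfolding sum_distrib_left by (intro sum.cong refl) (simp add: Suc_diff_le mult.assoc)
  finally show ?case by simp
qed

text \<open>In the permitted range the near identities of level \<open>l\<close> number at most
  \<open>3600 * 17 ^ l\<close>, so each of the \<open>m + 1\<close> weighted terms is of order
  \<open>17 ^ m\<close>: the bound is that of the diagonal, up to a linear factor.\<close>

lemma card_collisions_le:
  assumes q: "prime q" "q > 17" and m: "17 ^ m \<le> real_of_int q powr (11 / 5)"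
  shows "real (card (collisions q e m)) \<le> 7200 * (m + 1) * 17 ^ m"
proof -
  have cop: "coprime q 17" using q by (intro coprime_prime_gt) auto
  have near: "real (card (near_ids q l)) \<le> 3600 * 17 ^ l" if "l \<le> m" for l
  proof -
    have "(17 :: real) ^ l \<le> 17 ^ m" using that by (intro power_increasing) auto
    then have "17 ^ l \<le> real_of_int q powr (11 / 5)" using m by linarith
    then show ?thesis
      using q(2) m by (intro order_trans[OF card_near_ids[OF q, of l] near_ids_bound_real[of "17 ^ l" q]]) auto
  qed
  define B where "B m = (\<Sum>l\<le>m. 17 ^ (m - l) * card (near_ids q l))" for m
  have BB: "17 * B m' \<le> B (Suc m')" for m'
  proof -
    have "17 * B m' = (\<Sum>l\<le>m'. 17 ^ (Suc m' - l) * card (near_ids q l))"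
      unfolding B_def sum_distrib_left by (intro sum.cong refl) (simp add: Suc_diff_le mult.assoc)
    then show ?thesis by (simp add: B_def)
  qed
  \<comment> \<open>Here \<open>e\<close> need not be a letter, so the first step may have 18 heads
    in place of 17; the factor 2 absorbs this.\<close>
  have "card (collisions q e m) \<le> 2 * B m"
  proof (cases m)
    case 0
    have "collisions q e 0 \<subseteq> {([], [])}" by (auto simp: collisions_def words_def)
    then have "card (collisions q e 0) \<le> 1" using card_mono[of "{([], [])}"] by simp
    moreover have "1 \<in> near_ids q 0" by (simp add: near_ids_def qdvd_def zero_quat_def)
    then have "card (near_ids q 0) \<ge> 1" by (metis One_nat_def Suc_leI card_gt_0_iff empty_iff finite_near_ids)
    ultimately show ?thesis by (simp add: B_def 0)
  next
    case (Suc m')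
    have "card (collisions q e m) \<le> card (near_ids q m) + (\<Sum>s\<in>lps - {e}. card (collisions q (qcnj s) m'))"
      unfolding Suc by (rule card_collisions_Suc[OF cop])
    also have "(\<Sum>s\<in>lps - {e}. card (collisions q (qcnj s) m')) \<le> (\<Sum>s\<in>lps - {e}. B m')"
      unfolding B_def using card_collisions_le_sum[OF cop] by (intro sum_mono) auto
    also have "\<dots> \<le> 18 * B m'" using card_lps card_mono[of lps "lps - {e}"] by simp
    finally have "card (collisions q e m) \<le> card (near_ids q m) + 18 * B m'" by simp
    moreover have "B m = card (near_ids q m) + 17 * B m'"
    proof -
      have "17 * B m' = (\<Sum>l\<le>m'. 17 ^ (Suc m' - l) * card (near_ids q l))"
        unfolding B_def sum_distrib_left by (intro sum.cong refl) (simp add: Suc_diff_le mult.assoc)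
      then show ?thesis by (simp add: B_def Suc)
    qed
    ultimately show ?thesis by simp
  qed
  then have "real (card (collisions q e m)) \<le> 2 * real (B m)" by linarith
  also have "real (B m) = (\<Sum>l\<le>m. 17 ^ (m - l) * real (card (near_ids q l)))"
    by (simp add: B_def)
  also have "\<dots> \<le> (\<Sum>l\<le>m. 17 ^ (m - l) * (3600 * 17 ^ l))"
    using near by (intro sum_mono mult_left_mono) auto
  also have "\<dots> = (\<Sum>l\<le>m. 3600 * 17 ^ m)"
    by (intro sum.cong refl) (simp flip: power_add)
  also have "\<dots> = 3600 * (m + 1) * 17 ^ m" by simp
  finally show ?thesis by (simp add: algebra_simps)
qed

section \<open>Spectra of real symmetric matrices\<close>

text \<open>Complete \<open>v\<close> to a basis, orthogonalise and normalise; Gram-Schmidt leaves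
  the first vector unchanged, so only its length is adjusted.\<close>

lemma exists_orthogonal_mat_first_col:
  fixes v :: "real vec"
  assumes v: "v \<in> carrier_vec n" "v \<noteq> 0\<^sub>v n"
  obtains W c where "W \<in> carrier_mat n n" "W\<^sup>T * W = 1\<^sub>m n" "c \<noteq> 0" "col W 0 = c \<cdot>\<^sub>v v"
proof -
  interpret cof_vec_space n "TYPE(real)" .
  define b where "b = basis_completion v"
  define ws where "ws = gram_schmidt n b"
  have n0: "n \<noteq> 0"
    using v by (metis carrier_vecD eq_vecI not_less_zero zero_carrier_vec)
  note bc = basis_completion[OF v, folded b_def]
  have ws: "set ws \<subseteq> carrier_vec n" "corthogonal ws" "length ws = n"
    using gram_schmidt_result[OF bc(2) bc(4) bc(5) ws_def] bc(6) by auto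
  obtain vs where "b = v # vs"
    using bc(6,7) n0 by (cases b) auto
  then have hd: "ws ! 0 = v"
    using gram_schmidt_hd[OF v(1), of vs] n0 ws(3) by (metis hd_conv_nth list.size(3) ws_def)
  have wsi: "ws ! i \<in> carrier_vec n" if "i < n" for i
    using ws that by auto
  have orth: "(ws ! i \<bullet> ws ! j = 0) = (i \<noteq> j)" if "i < n" "j < n" for i j
  proof -
    have "conjugate (ws ! j) = ws ! j"
      by (rule eq_vecI) auto
    then show ?thesis using corthogonalD[OF ws(2)] that ws(3) by fastforce
  qed
  define r where "r j = 1 / sqrt (ws ! j \<bullet> ws ! j)" for j
  have pos: "ws ! j \<bullet> ws ! j > 0" if "j < n" for j
  proof -
    have "ws ! j \<bullet> ws ! j \<ge> 0" by (simp add: scalar_prod_def sum_nonneg)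
    then show ?thesis using orth[OF that that] by linarith
  qed
  define W where "W = mat_of_cols n (map (\<lambda>j. r j \<cdot>\<^sub>v ws ! j) [0..<n])"
  have W: "W \<in> carrier_mat n n"
    unfolding W_def using mat_of_cols_carrier(1)[of n "map (\<lambda>j. r j \<cdot>\<^sub>v ws ! j) [0..<n]"] by simp
  have colW: "col W j = r j \<cdot>\<^sub>v ws ! j" if "j < n" for j
    unfolding W_def using that wsi[OF that] by (subst col_mat_of_cols) auto
  have "W\<^sup>T * W = 1\<^sub>m n"
  proof (rule eq_matI)
    fix i j assume "i < dim_row (1\<^sub>m n :: real mat)" "j < dim_col (1\<^sub>m n :: real mat)"
    then have ij: "i < n" "j < n" by auto
    have "(W\<^sup>T * W) $$ (i, j) = col W i \<bullet> col W j"
      using W ij by simp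
    also have "\<dots> = r i * r j * (ws ! i \<bullet> ws ! j)"
      using wsi[OF ij(1)] wsi[OF ij(2)] by (simp add: colW ij)
    also have "\<dots> = (if i = j then 1 else 0)"
      using orth[OF ij] pos[OF ij(1)] by (auto simp: r_def)
    finally show "(W\<^sup>T * W) $$ (i, j) = 1\<^sub>m n $$ (i, j)" using ij by simp
  qed (use W in auto)
  moreover have "r 0 \<noteq> 0" using pos[of 0] n0 by (simp add: r_def)
  moreover have "col W 0 = r 0 \<cdot>\<^sub>v v" using colW[of 0] n0 hd by simp
  ultimately show thesis using that W by blast
qed

lemma orthogonal_mat_right:
  assumes "(W :: real mat) \<in> carrier_mat n n" "W\<^sup>T * W = 1\<^sub>m n"
  shows "W * W\<^sup>T = 1\<^sub>m n"
  using mat_mult_left_right_inverse[OF _ assms(1,2)] assms(1) by simp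

text \<open>Deflation: an orthogonal matrix whose first column is an eigenvector makes the first
  column diagonal, and symmetry clears the first row as well. The given order of \<open>es\<close>
  is preserved, so the sorted list of eigenvalues can be inserted later.\<close>

lemma symmetric_mat_orthogonal_diag:
  fixes A :: "real mat"
  assumes "A \<in> carrier_mat n n" "A\<^sup>T = A" "char_poly A = (\<Prod>e\<leftarrow>es. [:- e, 1:])"
  shows "\<exists>W \<in> carrier_mat n n. W\<^sup>T * W = 1\<^sub>m n \<and> W\<^sup>T * A * W = mat_diag n ((!) es)"
  using assms
proof (induction es arbitrary: n A)
  case Nil
  then have "n = 0" using degree_monic_char_poly[OF Nil(1)] by simp
  then show ?case using Nil(1) by (intro bexI[of _ "1\<^sub>m n"]) (auto intro!: eq_matI simp: mat_diag_def)
next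
  case (Cons e es)
  note A = Cons.prems(1) and sym = Cons.prems(2) and cp = Cons.prems(3)
  have "degree (char_poly A) = Suc (length es)"
    unfolding cp by (simp only: degree_linear_factors list.size)
  then have n: "n = Suc (length es)" using degree_monic_char_poly[OF A] by simp
  define m where "m = length es"
  have nm: "n = 1 + m" using n m_def by simp
  have "eigenvalue A e"
    unfolding eigenvalue_root_char_poly[OF A] cp by simp
  then obtain v where v: "v \<in> carrier_vec n" "v \<noteq> 0\<^sub>v n" "A *\<^sub>v v = e \<cdot>\<^sub>v v"
    using A unfolding eigenvalue_def eigenvector_def by auto
  obtain W c where W: "W \<in> carrier_mat n n" and WW: "W\<^sup>T * W = 1\<^sub>m n"
    and c: "c \<noteq> 0" "col W 0 = c \<cdot>\<^sub>v v"
    using exists_orthogonal_mat_first_col[OF v(1,2)] .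
  note WWr = orthogonal_mat_right[OF W WW]
  have WT: "W\<^sup>T \<in> carrier_mat n n" using W by simp
  define A' where "A' = W\<^sup>T * A * W"
  have A': "A' \<in> carrier_mat n n" using W A by (simp add: A'_def)
  have sym': "A'\<^sup>T = A'"
    unfolding A'_def using W A sym
    by (simp add: transpose_mult[of _ n n _ n] assoc_mult_mat[of _ n n _ n _ n])
  have "similar_mat A A'"
  proof (rule similar_matI)
    show "{A, A', W, W\<^sup>T} \<subseteq> carrier_mat n n" using A A' W by simp
    show "W * W\<^sup>T = 1\<^sub>m n" "W\<^sup>T * W = 1\<^sub>m n" using WW WWr by auto
    have "W * A' * W\<^sup>T = (W * W\<^sup>T) * A * (W * W\<^sup>T)"
      unfolding A'_def using W A
      by (simp add: assoc_mult_mat[of _ n n _ n _ n])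
    then show "A = W * A' * W\<^sup>T" using WWr A by simp
  qed
  then have cpA': "char_poly A' = char_poly A" using char_poly_similar by metis
  have col0: "A' $$ (i, 0) = (if i = 0 then e else 0)" if "i < n" for i
  proof -
    have "A' $$ (i, 0) = (W\<^sup>T * (A * W)) $$ (i, 0)"
      unfolding A'_def using W A by simp
    also have "\<dots> = row W\<^sup>T i \<bullet> col (A * W) 0"
      using that n W A by (subst index_mult_mat) auto
    also have "\<dots> = col W i \<bullet> (A *\<^sub>v col W 0)"
      using that n W col_mult2[OF A W, of 0] by simp
    also have "A *\<^sub>v col W 0 = e \<cdot>\<^sub>v col W 0"
      using v A c by (simp add: mult_mat_vec smult_smult_assoc mult.commute)
    also have "col W i \<bullet> (e \<cdot>\<^sub>v col W 0) = e * (W\<^sup>T * W) $$ (i, 0)"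
      using that n W by simp
    also have "\<dots> = (if i = 0 then e else 0)"
      unfolding WW using that n by simp
    finally show ?thesis .
  qed
  have symij: "A' $$ (i, j) = A' $$ (j, i)" if "i < n" "j < n" for i j
    using arg_cong[OF sym', of "\<lambda>M. M $$ (i, j)"] that A' by simp
  define A3 where "A3 = mat m m (\<lambda>(i, j). A' $$ (Suc i, Suc j))"
  define E where "E = mat 1 1 (\<lambda>_. e)"
  have A3: "A3 \<in> carrier_mat m m" and E: "E \<in> carrier_mat 1 1" by (auto simp: A3_def E_def)
  have blk: "A' = four_block_mat E (0\<^sub>m 1 m) (0\<^sub>m m 1) A3"
  proof (rule eq_matI)
    fix i j assume "i < dim_row (four_block_mat E (0\<^sub>m 1 m) (0\<^sub>m m 1) A3)"
      "j < dim_col (four_block_mat E (0\<^sub>m 1 m) (0\<^sub>m m 1) A3)"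
    then have ij: "i < n" "j < n" using A3 E nm by auto
    show "A' $$ (i, j) = four_block_mat E (0\<^sub>m 1 m) (0\<^sub>m m 1) A3 $$ (i, j)"
      using ij col0[OF ij(1)] col0[OF ij(2)] symij[of 0 j] nm
      by (auto simp: A3_def E_def)
  qed (use A' A3 E nm in auto)
  have "char_poly A' = char_poly E * char_poly A3"
    unfolding blk by (rule char_poly_four_block_zeros_col[OF E zero_carrier_mat A3])
  moreover have "char_poly E = [:- e, 1:]"
    by (simp add: char_poly_defs E_def det_def)
  ultimately have "[:- e, 1:] * char_poly A3 = [:- e, 1:] * (\<Prod>e\<leftarrow>es. [:- e, 1:])"
    using cp cpA' by simp
  then have cp3: "char_poly A3 = (\<Prod>e\<leftarrow>es. [:- e, 1:])"
    by (metis mult_cancel_left one_neq_zero pCons_eq_0_iff)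
  have sym3: "A3\<^sup>T = A3"
    by (rule eq_matI) (auto simp: A3_def symij nm)
  obtain V where V: "V \<in> carrier_mat m m" "V\<^sup>T * V = 1\<^sub>m m"
    "V\<^sup>T * A3 * V = mat_diag m ((!) es)"
    using Cons.IH[OF A3 sym3 cp3] by auto
  define V' where "V' = four_block_mat (1\<^sub>m 1) (0\<^sub>m 1 m) (0\<^sub>m m 1) V"
  have V': "V' \<in> carrier_mat n n" unfolding V'_def nm using four_block_carrier_mat[OF one_carrier_mat V(1)] .
  have V'T: "V'\<^sup>T = four_block_mat (1\<^sub>m 1) (0\<^sub>m 1 m) (0\<^sub>m m 1) (V\<^sup>T)"
    unfolding V'_def by (subst transpose_four_block_mat[of _ 1 1 _ m _ m]) (use V in auto)
  have VT: "V\<^sup>T \<in> carrier_mat m m" using V(1) by simp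
  have V'V': "V'\<^sup>T * V' = 1\<^sub>m n"
  proof -
    have "V'\<^sup>T * V' = four_block_mat (1\<^sub>m 1) (0\<^sub>m 1 m) (0\<^sub>m m 1) (1\<^sub>m m)"
      unfolding V'T unfolding V'_def
      by (subst mult_four_block_mat[of _ 1 1 _ m _ m _ _ 1 _ m]) (use V in auto)
    then show ?thesis unfolding nm by simp
  qed
  have "V'\<^sup>T * A' * V' = four_block_mat E (0\<^sub>m 1 m) (0\<^sub>m m 1) (V\<^sup>T * A3 * V)"
    unfolding V'T blk unfolding V'_def
    using V(1) VT A3 E
    by (simp add: mult_four_block_mat[of _ 1 1 _ m _ m _ _ 1 _ m])
  also have "\<dots> = mat_diag n ((!) (e # es))"
    unfolding V(3) nm by (rule eq_matI) (auto simp: E_def mat_diag_def)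
  finally have diag: "V'\<^sup>T * A' * V' = mat_diag n ((!) (e # es))" .
  have 1: "(W * V')\<^sup>T * (W * V') = 1\<^sub>m n"
  proof -
    have "(W * V')\<^sup>T * (W * V') = V'\<^sup>T * (W\<^sup>T * W) * V'"
      using W V' by (simp add: transpose_mult[of _ n n _ n] assoc_mult_mat[of _ n n _ n _ n])
    then show ?thesis using WW V'V' V' by simp
  qed
  have 2: "(W * V')\<^sup>T * A * (W * V') = V'\<^sup>T * A' * V'"
    unfolding A'_def using W V' A
    by (simp add: transpose_mult[of _ n n _ n] assoc_mult_mat[of _ n n _ n _ n])
  show ?case
    using 1 2 diag W V' by (intro bexI[of _ "W * V'"]) auto
qed

text \<open>Factor over the complex numbers. For an eigenvector \<open>v\<close> the Hermitian form
  of the matrix, evaluated in two ways, gives \<open>c * N = cnj c * N\<close> with \<open>N\<close>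
  the squared length, so every root is real.\<close>

lemma symmetric_mat_char_poly_splits:
  fixes A :: "real mat"
  assumes A: "A \<in> carrier_mat n n" and sym: "A\<^sup>T = A"
  obtains es where "char_poly A = (\<Prod>e\<leftarrow>es. [:- e, 1:])"
proof -
  define C where "C = map_mat complex_of_real A"
  have C: "C \<in> carrier_mat n n" using A by (simp add: C_def)
  obtain cs where cs: "char_poly C = (\<Prod>c\<leftarrow>cs. [:- c, 1:])"
    using char_poly_factorized[OF C] by blast
  have Csym: "C $$ (i, j) = C $$ (j, i)" "cnj (C $$ (i, j)) = C $$ (i, j)"
    if "i < n" "j < n" for i j
    using arg_cong[OF sym, of "\<lambda>M. M $$ (i, j)"] that A by (simp_all add: C_def)
  have real: "complex_of_real (Re c) = c" if "c \<in> set cs" for c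
  proof -
    have "eigenvalue C c"
      unfolding eigenvalue_root_char_poly[OF C] cs using that
      by (simp add: poly_prod_list prod_list_zero_iff image_iff)
    then obtain v where v: "v \<in> carrier_vec n" "v \<noteq> 0\<^sub>v n" "C *\<^sub>v v = c \<cdot>\<^sub>v v"
      using C unfolding eigenvalue_def eigenvector_def by auto
    have Cv: "(\<Sum>j<n. C $$ (i, j) * v $ j) = c * v $ i" if "i < n" for i
    proof -
      have "(C *\<^sub>v v) $ i = (\<Sum>j<n. C $$ (i, j) * v $ j)"
        using that C v(1) by (auto simp: scalar_prod_def lessThan_atLeast0)
      then show ?thesis using v that by simp
    qed
    define N where "N = (\<Sum>i<n. cnj (v $ i) * v $ i)"
    have "c * N = (\<Sum>i<n. cnj (v $ i) * (\<Sum>j<n. C $$ (i, j) * v $ j))"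
      unfolding N_def by (subst sum_distrib_left, intro sum.cong refl) (simp add: Cv)
    also have "\<dots> = (\<Sum>i<n. \<Sum>j<n. cnj (v $ i) * C $$ (i, j) * v $ j)"
      by (simp add: sum_distrib_left mult.assoc)
    also have "\<dots> = (\<Sum>j<n. \<Sum>i<n. cnj (v $ i) * C $$ (i, j) * v $ j)"
      by (rule sum.swap)
    also have "\<dots> = (\<Sum>j<n. cnj (\<Sum>i<n. C $$ (j, i) * v $ i) * v $ j)"
      unfolding cnj_sum sum_distrib_right
      by (intro sum.cong refl) (use Csym in \<open>auto simp: mult_ac\<close>)
    also have "\<dots> = (\<Sum>j<n. cnj c * (cnj (v $ j) * v $ j))"
      by (intro sum.cong refl) (simp only: Cv lessThan_iff complex_cnj_mult mult.assoc)
    also have "\<dots> = cnj c * N" unfolding N_def by (simp add: sum_distrib_left)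
    finally have *: "c * N = cnj c * N" .
    have "N \<noteq> 0"
    proof -
      obtain i where i: "i < n" "v $ i \<noteq> 0"
        using v by (metis carrier_vecD eq_vecI index_zero_vec)
      have "N = of_real (\<Sum>i<n. (cmod (v $ i))\<^sup>2)"
        unfolding N_def of_real_sum
        by (intro sum.cong refl) (metis complex_norm_square mult.commute of_real_power)
      moreover have "(\<Sum>i<n. (cmod (v $ i))\<^sup>2) > 0"
        using i by (intro sum_pos2[of _ i]) auto
      ultimately show ?thesis by (metis less_irrefl of_real_eq_0_iff)
    qed
    then have "c = cnj c" using * by simp
    then show ?thesis by (metis Reals_cnj_iff of_real_Re)
  qed
  define es where "es = map Re cs"
  interpret poly_hom: map_poly_comm_ring_hom complex_of_real ..
  have "map_poly complex_of_real (char_poly A) = char_poly C"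
    unfolding C_def by (simp add: of_real_hom.char_poly_hom[OF A])
  also have "\<dots> = map_poly complex_of_real (\<Prod>e\<leftarrow>es. [:- e, 1:])"
    unfolding cs es_def using real
  proof (induction cs)
    case (Cons c cs)
    have "map_poly complex_of_real [:- Re c, 1:] = [:- c, 1:]"
      using Cons.prems[of c] by simp
    then show ?case using Cons by (simp only: list.map prod_list.Cons poly_hom.hom_mult) simp
  qed simp
  finally have "char_poly A = (\<Prod>e\<leftarrow>es. [:- e, 1:])"
    by (simp add: poly_eq_iff coeff_map_poly)
  then show thesis using that by blast
qed

text \<open>\<open>r\<close> is the projection of \<open>u\<close> to the span, and the squared
  length of \<open>u - r\<close> is nonnegative. Functions on an arbitrary finite index set allow
  the use both for matrix indices and for group elements; the family is orthogonal but not
  normalised.\<close>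

lemma bessel_inequality:
  fixes w :: "'x \<Rightarrow> 'i \<Rightarrow> complex" and u :: "'i \<Rightarrow> complex"
  assumes fin: "finite I" "finite X"
    and orth: "\<And>x y. x \<in> X \<Longrightarrow> y \<in> X \<Longrightarrow> x \<noteq> y \<Longrightarrow> (\<Sum>i\<in>I. w x i * cnj (w y i)) = 0"
    and pos: "\<And>x. x \<in> X \<Longrightarrow> (\<Sum>i\<in>I. (cmod (w x i))\<^sup>2) > 0"
  shows "(\<Sum>x\<in>X. (cmod (\<Sum>i\<in>I. u i * cnj (w x i)))\<^sup>2 / (\<Sum>i\<in>I. (cmod (w x i))\<^sup>2))
    \<le> (\<Sum>i\<in>I. (cmod (u i))\<^sup>2)"
proof -
  define N where "N x = (\<Sum>i\<in>I. (cmod (w x i))\<^sup>2)" for x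
  define c where "c x = (\<Sum>i\<in>I. u i * cnj (w x i))" for x
  define r where "r i = (\<Sum>x\<in>X. c x / N x * w x i)" for i
  have sq: "complex_of_real ((cmod z)\<^sup>2) = z * cnj z" for z
    by (metis complex_norm_square of_real_power)
  have NN: "(\<Sum>i\<in>I. w x i * cnj (w y i)) = (if x = y then of_real (N x) else 0)"
    if "x \<in> X" "y \<in> X" for x y
    using orth[OF that] by (auto simp: N_def sq of_real_sum simp del: of_real_power)
  have N0: "N x \<noteq> 0" if "x \<in> X" for x using pos[OF that] by (simp add: N_def)
  have ur: "(\<Sum>i\<in>I. u i * cnj (r i)) = (\<Sum>x\<in>X. of_real ((cmod (c x))\<^sup>2 / N x))"
  proof -
    have "(\<Sum>i\<in>I. u i * cnj (r i)) = (\<Sum>i\<in>I. \<Sum>x\<in>X. cnj (c x) / N x * (u i * cnj (w x i)))"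
      unfolding r_def cnj_sum sum_distrib_left by (simp add: mult_ac)
    also have "\<dots> = (\<Sum>x\<in>X. \<Sum>i\<in>I. cnj (c x) / N x * (u i * cnj (w x i)))"
      by (rule sum.swap)
    also have "\<dots> = (\<Sum>x\<in>X. cnj (c x) / N x * c x)"
      by (simp only: c_def sum_distrib_left[symmetric])
    finally show ?thesis by (simp add: sq[symmetric] mult.commute del: of_real_power)
  qed
  have rr: "(\<Sum>i\<in>I. r i * cnj (r i)) = (\<Sum>x\<in>X. of_real ((cmod (c x))\<^sup>2 / N x))"
  proof -
    have "(\<Sum>i\<in>I. r i * cnj (r i))
      = (\<Sum>i\<in>I. \<Sum>x\<in>X. \<Sum>y\<in>X. c x / N x * (cnj (c y) / N y) * (w x i * cnj (w y i)))"
      unfolding r_def cnj_sum sum_product by (simp add: mult_ac)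
    also have "\<dots> = (\<Sum>x\<in>X. \<Sum>i\<in>I. \<Sum>y\<in>X. c x / N x * (cnj (c y) / N y) * (w x i * cnj (w y i)))"
      by (rule sum.swap)
    also have "\<dots> = (\<Sum>x\<in>X. \<Sum>y\<in>X. \<Sum>i\<in>I. c x / N x * (cnj (c y) / N y) * (w x i * cnj (w y i)))"
      by (intro sum.cong refl sum.swap)
    also have "\<dots> = (\<Sum>x\<in>X. \<Sum>y\<in>X. c x / N x * (cnj (c y) / N y) * (if x = y then of_real (N x) else 0))"
      by (intro sum.cong refl) (simp only: sum_distrib_left[symmetric] NN)
    also have "\<dots> = (\<Sum>x\<in>X. c x / N x * (cnj (c x) / N x) * of_real (N x))"
      using fin by (intro sum.cong refl) (simp add: if_distrib[of "\<lambda>t. _ * t"] cong: if_cong)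
    also have "\<dots> = (\<Sum>x\<in>X. of_real ((cmod (c x))\<^sup>2 / N x))"
    proof (intro sum.cong refl)
      fix x assume "x \<in> X"
      then have "c x / N x * (cnj (c x) / N x) * of_real (N x) = (c x * cnj (c x)) / of_real (N x)"
        using N0 by simp
      then show "c x / N x * (cnj (c x) / N x) * of_real (N x) = of_real ((cmod (c x))\<^sup>2 / N x)"
        by (simp only: sq of_real_divide)
    qed
    finally show ?thesis .
  qed
  define B where "B = (\<Sum>x\<in>X. (cmod (c x))\<^sup>2 / N x)"
  have ur': "(\<Sum>i\<in>I. u i * cnj (r i)) = of_real B" and rr': "(\<Sum>i\<in>I. r i * cnj (r i)) = of_real B"
    unfolding ur rr B_def of_real_sum by auto
  have ru': "(\<Sum>i\<in>I. r i * cnj (u i)) = of_real B"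
    using arg_cong[OF ur', of cnj] by (simp add: mult.commute)
  have "complex_of_real (\<Sum>i\<in>I. (cmod (u i - r i))\<^sup>2) = (\<Sum>i\<in>I. (u i - r i) * cnj (u i - r i))"
    by (simp add: sq of_real_sum del: of_real_power)
  also have "\<dots> = (\<Sum>i\<in>I. u i * cnj (u i)) - (\<Sum>i\<in>I. u i * cnj (r i)) - (\<Sum>i\<in>I. r i * cnj (u i))
      + (\<Sum>i\<in>I. r i * cnj (r i))"
    by (simp add: algebra_simps sum.distrib sum_subtractf)
  also have "\<dots> = complex_of_real ((\<Sum>i\<in>I. (cmod (u i))\<^sup>2) - B)"
    unfolding ur' rr' ru' by (simp add: sq of_real_sum del: of_real_power)
  finally have "(\<Sum>i\<in>I. (cmod (u i - r i))\<^sup>2) = (\<Sum>i\<in>I. (cmod (u i))\<^sup>2) - B"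
    by (simp only: of_real_eq_iff)
  moreover have "(\<Sum>i\<in>I. (cmod (u i - r i))\<^sup>2) \<ge> 0" by (intro sum_nonneg) simp
  ultimately show ?thesis by (simp add: B_def c_def N_def)
qed

text \<open>The list inside \<open>graph_eigenvalues\<close>, detached from graphs.\<close>

definition eigen_list :: "real mat \<Rightarrow> real list" where
  "eigen_list M = rev (sorted_list_of_multiset (proots (char_poly M)))"

text \<open>The diagonalisation in coordinates: \<open>v j\<close> is the eigenvector at position
  \<open>j\<close> of the descending list, and orthogonality is available both for rows and for
  columns.\<close>

lemma symmetric_spectral_basis:
  fixes a :: "nat \<Rightarrow> nat \<Rightarrow> real"
  assumes sym: "\<And>i j. i < n \<Longrightarrow> j < n \<Longrightarrow> a i j = a j i"
  defines "es \<equiv> eigen_list (mat n n (\<lambda>(i, j). a i j))"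
  obtains v where "length es = n" "sorted_wrt (\<ge>) es"
    "\<And>j k. j < n \<Longrightarrow> k < n \<Longrightarrow> (\<Sum>i<n. v j i * v k i) = (if j = k then 1 else 0 :: real)"
    "\<And>i k. i < n \<Longrightarrow> k < n \<Longrightarrow> (\<Sum>j<n. v j i * v j k) = (if i = k then 1 else 0 :: real)"
    "\<And>j i. j < n \<Longrightarrow> i < n \<Longrightarrow> (\<Sum>k<n. a i k * v j k) = es ! j * v j i"
proof -
  define M where "M = mat n n (\<lambda>(i, j). a i j)"
  have M: "M \<in> carrier_mat n n" and MT: "M\<^sup>T = M"
    by (auto simp: M_def sym intro!: eq_matI)
  obtain es0 where es0: "char_poly M = (\<Prod>e\<leftarrow>es0. [:- e, 1:])"
    using symmetric_mat_char_poly_splits[OF M MT] .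
  have "proots (\<Prod>e\<leftarrow>es0. [:- e, 1:]) = mset es0"
  proof (induction es0)
    case (Cons e es0)
    have "[:- e, 1:] \<noteq> 0" "(\<Prod>e\<leftarrow>es0. [:- e, 1:]) \<noteq> 0"
      by (auto simp: prod_list_zero_iff)
    then have "proots ([:- e, 1:] * (\<Prod>e\<leftarrow>es0. [:- e, 1:]))
        = proots [:- e, 1:] + proots (\<Prod>e\<leftarrow>es0. [:- e, 1:])" by (rule proots_mult)
    then show ?case using Cons by (simp only: list.map prod_list.Cons proots_linear_factor) simp
  qed simp
  then have mses: "mset es = mset es0"
    unfolding es_def eigen_list_def M_def[symmetric] es0 by simp
  have cp: "char_poly M = (\<Prod>e\<leftarrow>es. [:- e, 1:])"
    unfolding es0 by (metis mses mset_map prod_mset_prod_list)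
  have len: "length es = n"
    using degree_monic_char_poly[OF M] degree_linear_factors[of uminus es] unfolding cp by simp
  have sorted: "sorted_wrt (\<ge>) es"
    unfolding es_def eigen_list_def by (simp add: sorted_wrt_rev)
  obtain W where W: "W \<in> carrier_mat n n" "W\<^sup>T * W = 1\<^sub>m n" "W\<^sup>T * M * W = mat_diag n ((!) es)"
    using symmetric_mat_orthogonal_diag[OF M MT cp] by auto
  note WW = orthogonal_mat_right[OF W(1,2)]
  have MW: "M * W = W * mat_diag n ((!) es)"
  proof -
    have "W * (W\<^sup>T * M * W) = (W * W\<^sup>T) * (M * W)"
      using W(1) M by (simp add: assoc_mult_mat[of _ n n _ n _ n])
    then show ?thesis using WW W M by simp
  qed
  define v where "v j i = W $$ (i, j)" for j i
  show thesis
  proof (rule that[of v])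
    fix j k assume "j < n" "k < n"
    then show "(\<Sum>i<n. v j i * v k i) = (if j = k then 1 else 0)"
      using arg_cong[OF W(2), of "\<lambda>M. M $$ (j, k)"] W(1)
      by (simp add: scalar_prod_def v_def lessThan_atLeast0)
  next
    fix i k assume "i < n" "k < n"
    then show "(\<Sum>j<n. v j i * v j k) = (if i = k then 1 else 0)"
      using arg_cong[OF WW, of "\<lambda>M. M $$ (i, k)"] W(1)
      by (simp add: scalar_prod_def v_def lessThan_atLeast0)
  next
    fix j i assume ij: "j < n" "i < n"
    have "(M * W) $$ (i, j) = (\<Sum>k<n. a i k * v j k)"
      using ij W(1) by (simp add: M_def scalar_prod_def v_def lessThan_atLeast0)
    moreover have "(W * mat_diag n ((!) es)) $$ (i, j) = es ! j * v j i"
      using ij W(1) by (subst mat_diag_mult_right[of _ n]) (auto simp: v_def mult.commute)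
    ultimately show "(\<Sum>k<n. a i k * v j k) = es ! j * v j i" using MW by simp
  qed (fact len sorted)+
qed

section \<open>Multiplicities and the variational description of the second eigenvalue\<close>

context
  fixes a :: "nat \<Rightarrow> nat \<Rightarrow> real" and n :: nat
  assumes sym: "\<And>i j. i < n \<Longrightarrow> j < n \<Longrightarrow> a i j = a j i"
begin

text \<open>A dimension count by double summation. Each \<open>w x\<close> is orthogonal to every
  \<open>v j\<close> with another eigenvalue, so the positions in \<open>J\<close> carry its whole
  norm; conversely Bessel's inequality bounds the total share of each unit vector \<open>v j\<close>
  by 1.\<close>

lemma eigen_list_multiplicity_ge:
  fixes w :: "'x \<Rightarrow> nat \<Rightarrow> complex" and \<mu> :: real
  assumes X: "finite X"
    and eig: "\<And>x i. x \<in> X \<Longrightarrow> i < n \<Longrightarrow> (\<Sum>k<n. a i k * w x k) = \<mu> * w x i"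
    and orth: "\<And>x y. x \<in> X \<Longrightarrow> y \<in> X \<Longrightarrow> x \<noteq> y \<Longrightarrow> (\<Sum>i<n. w x i * cnj (w y i)) = 0"
    and nz: "\<And>x. x \<in> X \<Longrightarrow> \<exists>i<n. w x i \<noteq> 0"
  shows "card X \<le> card {j. j < n \<and> eigen_list (mat n n (\<lambda>(i, j). a i j)) ! j = \<mu>}"
proof -
  define es where "es = eigen_list (mat n n (\<lambda>(i, j). a i j))"
  obtain v :: "nat \<Rightarrow> nat \<Rightarrow> real"
    where len: "length es = n" and sorted: "sorted_wrt (\<ge>) es"
    and on: "\<And>j k. j < n \<Longrightarrow> k < n \<Longrightarrow> (\<Sum>i<n. v j i * v k i) = (if j = k then 1 else 0)"
    and co: "\<And>i k. i < n \<Longrightarrow> k < n \<Longrightarrow> (\<Sum>j<n. v j i * v j k) = (if i = k then 1 else 0)"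
    and ev: "\<And>j i. j < n \<Longrightarrow> i < n \<Longrightarrow> (\<Sum>k<n. a i k * v j k) = es ! j * v j i"
    by (rule symmetric_spectral_basis[of n a, OF sym, folded es_def], assumption, assumption, rule that)
  define J where "J = {j. j < n \<and> es ! j = \<mu>}"
  define c where "c j x = (\<Sum>i<n. v j i * cnj (w x i))" for j x
  have c0: "c j x = 0" if "j < n" "j \<notin> J" "x \<in> X" for j x
  proof -
    have "es ! j * c j x = (\<Sum>i<n. of_real (es ! j * v j i) * cnj (w x i))"
      by (simp add: c_def sum_distrib_left mult.assoc)
    also have "\<dots> = (\<Sum>i<n. of_real (\<Sum>k<n. a i k * v j k) * cnj (w x i))"
      by (intro sum.cong refl) (simp only: ev[OF that(1)] lessThan_iff)
    also have "\<dots> = (\<Sum>i<n. \<Sum>k<n. a i k * v j k * cnj (w x i))"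
      by (simp add: sum_distrib_right)
    also have "\<dots> = (\<Sum>k<n. \<Sum>i<n. a i k * v j k * cnj (w x i))" by (rule sum.swap)
    also have "\<dots> = (\<Sum>k<n. v j k * cnj (\<Sum>i<n. a k i * w x i))"
      unfolding cnj_sum sum_distrib_left by (intro sum.cong refl) (auto simp: sym mult_ac)
    also have "\<dots> = (\<Sum>k<n. v j k * cnj (\<mu> * w x k))"
      by (intro sum.cong refl) (simp only: eig[OF that(3)] lessThan_iff)
    also have "\<dots> = \<mu> * c j x"
      by (simp add: c_def sum_distrib_left mult_ac)
    finally show ?thesis using that by (auto simp: J_def)
  qed
  define N where "N x = (\<Sum>i<n. (cmod (w x i))\<^sup>2)" for x
  have Npos: "N x > 0" if x: "x \<in> X" for x
  proof -
    obtain i where "i < n" "w x i \<noteq> 0" using nz[OF x] by auto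
    then show ?thesis unfolding N_def by (intro sum_pos2[of _ i]) auto
  qed
  have sq: "complex_of_real ((cmod z)\<^sup>2) = z * cnj z" for z
    by (metis complex_norm_square of_real_power)
  have parseval: "(\<Sum>j\<in>J. (cmod (c j x))\<^sup>2) = N x" if x: "x \<in> X" for x
  proof -
    have "complex_of_real (\<Sum>j\<in>J. (cmod (c j x))\<^sup>2) = (\<Sum>j<n. c j x * cnj (c j x))"
      unfolding of_real_sum sq by (rule sum.mono_neutral_left) (use c0 x in \<open>auto simp: J_def\<close>)
    also have "\<dots> = (\<Sum>j<n. \<Sum>i<n. \<Sum>k<n. of_real (v j i * v j k) * (cnj (w x i) * w x k))"
      unfolding c_def cnj_sum sum_product by (simp add: mult_ac)
    also have "\<dots> = (\<Sum>i<n. \<Sum>j<n. \<Sum>k<n. of_real (v j i * v j k) * (cnj (w x i) * w x k))"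
      by (rule sum.swap)
    also have "\<dots> = (\<Sum>i<n. \<Sum>k<n. \<Sum>j<n. of_real (v j i * v j k) * (cnj (w x i) * w x k))"
      by (intro sum.cong refl sum.swap)
    also have "\<dots> = (\<Sum>i<n. \<Sum>k<n. of_real (if i = k then 1 else 0) * (cnj (w x i) * w x k))"
      by (intro sum.cong refl) (simp only: co lessThan_iff of_real_sum[symmetric] sum_distrib_right[symmetric])
    also have "\<dots> = (\<Sum>i<n. cnj (w x i) * w x i)"
      by (intro sum.cong refl) (simp add: if_distrib[of of_real] if_distrib[of "\<lambda>t. t * _"] cong: if_cong)
    also have "\<dots> = of_real (N x)"
      by (simp add: N_def of_real_sum sq mult.commute del: of_real_power)
    finally show ?thesis by (simp only: of_real_eq_iff)
  qed
  have fJ: "finite J" by (simp add: J_def)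
  have "real (card X) = (\<Sum>x\<in>X. (\<Sum>j\<in>J. (cmod (c j x))\<^sup>2) / N x)"
    using Npos by (simp add: parseval less_imp_neq[symmetric])
  also have "\<dots> = (\<Sum>x\<in>X. \<Sum>j\<in>J. (cmod (c j x))\<^sup>2 / N x)"
    by (simp add: sum_divide_distrib)
  also have "\<dots> = (\<Sum>j\<in>J. \<Sum>x\<in>X. (cmod (c j x))\<^sup>2 / N x)"
    by (rule sum.swap)
  also have "\<dots> \<le> (\<Sum>j\<in>J. \<Sum>i<n. (cmod (v j i))\<^sup>2)"
  proof (rule sum_mono)
    fix j
    show "(\<Sum>x\<in>X. (cmod (c j x))\<^sup>2 / N x) \<le> (\<Sum>i<n. (cmod (v j i))\<^sup>2)"
      unfolding c_def N_def using Npos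
      by (intro bessel_inequality X orth) (auto simp: N_def)
  qed
  also have "\<dots> = (\<Sum>j\<in>J. 1)"
  proof (intro sum.cong refl)
    fix j assume "j \<in> J"
    then show "(\<Sum>i<n. (cmod (v j i))\<^sup>2) = 1"
      using on[of j j] by (simp add: J_def power2_eq_square)
  qed
  finally show ?thesis by (simp add: J_def es_def)
qed

text \<open>If the largest eigenvalue \<open>d\<close> is simple, the first basis vector is constant; otherwise
  the second eigenvalue is \<open>d\<close> too and a combination of two basis vectors has zero sum.\<close>

lemma second_eigenvalue_variational:
  assumes n: "n \<ge> 2"
    and nonneg: "\<And>i j. i < n \<Longrightarrow> j < n \<Longrightarrow> a i j \<ge> 0"
    and deg: "\<And>i. i < n \<Longrightarrow> (\<Sum>k<n. a i k) = d"
  defines "\<mu> \<equiv> eigen_list (mat n n (\<lambda>(i, j). a i j)) ! 1"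
  shows "\<exists>f. (\<exists>i<n. f i \<noteq> 0) \<and> (\<Sum>i<n. f i) = 0 \<and> (\<forall>i<n. (\<Sum>k<n. a i k * f k) = \<mu> * f i)"
    and "(\<Sum>i<n. f i) = 0 \<Longrightarrow> (\<Sum>i<n. f i * (\<Sum>k<n. a i k * f k)) \<le> \<mu> * (\<Sum>i<n. (f i)\<^sup>2)"
proof -
  define es where "es = eigen_list (mat n n (\<lambda>(i, j). a i j))"
  obtain v :: "nat \<Rightarrow> nat \<Rightarrow> real" where len: "length es = n" and sorted: "sorted_wrt (\<ge>) es"
    and on: "\<And>j k. j < n \<Longrightarrow> k < n \<Longrightarrow> (\<Sum>i<n. v j i * v k i) = (if j = k then 1 else 0)"
    and co: "\<And>i k. i < n \<Longrightarrow> k < n \<Longrightarrow> (\<Sum>j<n. v j i * v j k) = (if i = k then 1 else 0)"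
    and ev: "\<And>j i. j < n \<Longrightarrow> i < n \<Longrightarrow> (\<Sum>k<n. a i k * v j k) = es ! j * v j i"
    by (rule symmetric_spectral_basis[of n a, OF sym, folded es_def], assumption, assumption, rule that)
  have \<mu>: "\<mu> = es ! 1" by (simp add: \<mu>_def es_def)
  have le_\<mu>: "es ! j \<le> \<mu>" if "j < n" "j \<ge> 1" for j
    unfolding \<mu> using sorted_wrt_nth_less[OF sorted, of 1 j] that len by (cases "j = 1") auto
  have nzv: "\<exists>i<n. v j i \<noteq> 0" if "j < n" for j
  proof (rule ccontr)
    assume "\<not> ?thesis"
    then have "(\<Sum>i<n. v j i * v j i) = 0" by simp
    then show False using on[OF that that] by simp
  qed
  \<comment> \<open>Maximum principle, at a coordinate of largest absolute value.\<close>
  have le_d: "es ! j \<le> d" if j: "j < n" for j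
  proof -
    obtain i0 where i0: "i0 < n" "v j i0 \<noteq> 0" using nzv[OF j] by auto
    define m where "m = Max ((\<lambda>i. \<bar>v j i\<bar>) ` {..<n})"
    have "m \<in> (\<lambda>i. \<bar>v j i\<bar>) ` {..<n}" unfolding m_def using i0 by (intro Max_in) auto
    then obtain i where i: "i < n" "\<bar>v j i\<bar> = m" by auto
    have mx: "\<bar>v j k\<bar> \<le> m" if "k < n" for k unfolding m_def using that by (intro Max_ge) auto
    have mpos: "m > 0" using mx[OF i0(1)] i0(2) by linarith
    have "es ! j * m \<le> \<bar>es ! j * v j i\<bar>" using i mpos by (simp add: abs_mult mult_right_mono)
    also have "\<dots> \<le> (\<Sum>k<n. \<bar>a i k * v j k\<bar>)" unfolding ev[OF j i(1), symmetric] by (rule sum_abs)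
    also have "\<dots> \<le> (\<Sum>k<n. a i k * m)"
      by (intro sum_mono) (use nonneg[OF i(1)] mx in \<open>simp add: abs_mult mult_left_mono\<close>)
    also have "\<dots> = d * m" using deg[OF i(1)] by (simp add: sum_distrib_right[symmetric])
    finally show ?thesis using mpos by simp
  qed
  \<comment> \<open>\<open>b j\<close> is the inner product with the constant function, which is an
    eigenfunction for \<open>d\<close>; hence it vanishes unless \<open>es ! j = d\<close>.\<close>
  define b where "b j = (\<Sum>i<n. v j i)" for j
  have b0: "b j = 0" if "j < n" "es ! j \<noteq> d" for j
  proof -
    have "es ! j * b j = (\<Sum>i<n. \<Sum>k<n. a i k * v j k)"
      unfolding b_def sum_distrib_left by (intro sum.cong refl) (simp add: ev[OF that(1)])
    also have "\<dots> = (\<Sum>k<n. \<Sum>i<n. a i k * v j k)" by (rule sum.swap)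
    also have "\<dots> = (\<Sum>k<n. (\<Sum>i<n. a k i) * v j k)"
      unfolding sum_distrib_right by (intro sum.cong refl) (auto simp: sym)
    also have "\<dots> = d * b j" by (simp add: deg b_def sum_distrib_left)
    finally show ?thesis using that by auto
  qed
  have ones: "(\<Sum>j<n. v j i * b j) = 1" if "i < n" for i
  proof -
    have "(\<Sum>j<n. v j i * b j) = (\<Sum>j<n. \<Sum>k<n. v j i * v j k)" by (simp add: b_def sum_distrib_left)
    also have "\<dots> = (\<Sum>k<n. \<Sum>j<n. v j i * v j k)" by (rule sum.swap)
    also have "\<dots> = (\<Sum>k<n. if i = k then 1 else 0)" by (intro sum.cong refl) (simp add: co that)
    finally show ?thesis using that by simp
  qed
  show "\<exists>f. (\<exists>i<n. f i \<noteq> 0) \<and> (\<Sum>i<n. f i) = 0 \<and> (\<forall>i<n. (\<Sum>k<n. a i k * f k) = \<mu> * f i)"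
  proof (cases "b 1 = 0")
    case True
    then show ?thesis using nzv[of 1] ev[of 1] n by (intro exI[of _ "v 1"]) (auto simp: \<mu> b_def)
  next
    case False
    then have "es ! 1 = d" using b0[of 1] n by auto
    moreover have "es ! 1 \<le> es ! 0" using sorted_wrt_nth_less[OF sorted, of 0 1] len n by auto
    ultimately have e0: "es ! 0 = \<mu>" using le_d[of 0] n \<mu> by simp
    \<comment> \<open>The combination of \<open>v 0\<close> and \<open>v 1\<close> with zero sum. It
      is not zero, because its inner product with \<open>v 0\<close> is \<open>b 1\<close>.\<close>
    define f where "f i = b 1 * v 0 i - b 0 * v 1 i" for i
    have "(\<Sum>i<n. f i * v 0 i) = b 1 * (\<Sum>i<n. v 0 i * v 0 i) - b 0 * (\<Sum>i<n. v 1 i * v 0 i)"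
      by (simp add: f_def sum_subtractf sum_distrib_left left_diff_distrib mult.assoc)
    also have "\<dots> = b 1" using on[of 0 0] on[of 1 0] n by simp
    finally have "\<exists>i<n. f i \<noteq> 0" using False by (metis (no_types, lifting) lessThan_iff mult_zero_left sum.neutral)
    moreover have "(\<Sum>i<n. f i) = 0"
      by (simp add: f_def sum_subtractf sum_distrib_left[symmetric] b_def)
    moreover have "(\<Sum>k<n. a i k * f k) = \<mu> * f i" if "i < n" for i
    proof -
      have "(\<Sum>k<n. a i k * f k) = b 1 * (\<Sum>k<n. a i k * v 0 k) - b 0 * (\<Sum>k<n. a i k * v 1 k)"
        by (simp add: f_def sum_subtractf sum_distrib_left right_diff_distrib mult_ac)
      then show ?thesis using ev[of 0 i] ev[of 1 i] n that e0 \<mu> by (simp add: f_def algebra_simps)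
    qed
    ultimately show ?thesis by blast
  qed
  assume f: "(\<Sum>i<n. f i) = 0"
  define c where "c j = (\<Sum>i<n. f i * v j i)" for j
  have expand: "f i = (\<Sum>j<n. c j * v j i)" if "i < n" for i
  proof -
    have "(\<Sum>j<n. c j * v j i) = (\<Sum>j<n. \<Sum>k<n. f k * (v j i * v j k))"
      unfolding c_def sum_distrib_right by (simp add: mult_ac)
    also have "\<dots> = (\<Sum>k<n. f k * (\<Sum>j<n. v j i * v j k))"
      unfolding sum_distrib_left by (rule sum.swap)
    also have "\<dots> = (\<Sum>k<n. f k * (if i = k then 1 else 0))"
      by (intro sum.cong refl) (simp only: co that lessThan_iff)
    finally show ?thesis using that by (simp add: if_distrib[of "\<lambda>t. _ * t"] cong: if_cong)
  qed
  have Af: "(\<Sum>k<n. a i k * f k) = (\<Sum>j<n. es ! j * c j * v j i)" if "i < n" for i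
  proof -
    have "(\<Sum>k<n. a i k * f k) = (\<Sum>k<n. \<Sum>j<n. c j * (a i k * v j k))"
      by (intro sum.cong refl) (simp add: expand sum_distrib_left mult_ac)
    also have "\<dots> = (\<Sum>j<n. c j * (\<Sum>k<n. a i k * v j k))"
      unfolding sum_distrib_left by (rule sum.swap)
    also have "\<dots> = (\<Sum>j<n. c j * (es ! j * v j i))"
      by (intro sum.cong refl) (simp only: ev that lessThan_iff)
    finally show ?thesis by (simp add: mult_ac)
  qed
  have 1: "(\<Sum>i<n. f i * (\<Sum>k<n. a i k * f k)) = (\<Sum>j<n. es ! j * (c j)\<^sup>2)"
  proof -
    have "(\<Sum>i<n. f i * (\<Sum>k<n. a i k * f k)) = (\<Sum>i<n. \<Sum>j<n. es ! j * c j * (f i * v j i))"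
      by (intro sum.cong refl) (subst Af, simp, simp add: sum_distrib_left mult_ac)
    also have "\<dots> = (\<Sum>j<n. es ! j * c j * (\<Sum>i<n. f i * v j i))"
      unfolding sum_distrib_left by (rule sum.swap)
    finally show ?thesis by (simp add: c_def[symmetric] power2_eq_square mult_ac)
  qed
  have 2: "(\<Sum>i<n. (f i)\<^sup>2) = (\<Sum>j<n. (c j)\<^sup>2)"
  proof -
    have "(\<Sum>i<n. (f i)\<^sup>2) = (\<Sum>i<n. \<Sum>j<n. c j * (f i * v j i))"
      by (intro sum.cong refl) (simp add: power2_eq_square, subst (2) expand, auto simp: sum_distrib_left mult_ac)
    also have "\<dots> = (\<Sum>j<n. c j * (\<Sum>i<n. f i * v j i))"
      unfolding sum_distrib_left by (rule sum.swap)
    finally show ?thesis by (simp add: c_def[symmetric] power2_eq_square)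
  qed
  have "es ! j * (c j)\<^sup>2 \<le> \<mu> * (c j)\<^sup>2" if j: "j < n" for j
  \<comment> \<open>Only position 0 can carry an eigenvalue above \<open>\<mu>\<close>, and then
    only if \<open>\<mu>\<close> differs from \<open>d\<close>. In that case the expansion
    \<open>ones\<close> of the constant function consists of \<open>v 0\<close> alone, and the zero
    sum of \<open>f\<close> forces \<open>c 0 = 0\<close>.\<close>
  proof (cases "j = 0 \<and> \<mu> \<noteq> d")
    case False
    then have "es ! j \<le> \<mu>" using le_\<mu>[OF j] le_d[OF j] by (cases "j = 0") auto
    then show ?thesis by (rule mult_right_mono) simp
  next
    case True
    have bz: "b j = 0" if "j < n" "j \<noteq> 0" for j
      using le_\<mu>[of j] le_d[of 1] True that n by (intro b0) (auto simp: \<mu>)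
    have "v 0 i * b 0 = 1" if i: "i < n" for i
    proof -
      have "(\<Sum>j<n. v j i * b j) = (\<Sum>j\<in>{0}. v j i * b j)"
        by (rule sum.mono_neutral_right) (use n bz in auto)
      then show ?thesis using ones[OF i] by simp
    qed
    then have "c 0 * b 0 = (\<Sum>i<n. f i)"
      by (simp add: c_def sum_distrib_right mult.assoc)
    moreover have "b 0 \<noteq> 0" using \<open>\<And>i. i < n \<Longrightarrow> v 0 i * b 0 = 1\<close>[of 0] n by auto
    ultimately show ?thesis using f True by simp
  qed
  then show "(\<Sum>i<n. f i * (\<Sum>k<n. a i k * f k)) \<le> \<mu> * (\<Sum>i<n. (f i)\<^sup>2)"
    unfolding 1 2 by (subst sum_distrib_left) (intro sum_mono, auto)
qed

end

section \<open>Second eigenvalue of a Cayley graph\<close>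

text \<open>An arbitrary numbering, by which each group is transported to an initial segment of the
  natural numbers. The eigenvalue definitions order the vertices, and graphs from different groups
  have to share one type.\<close>

definition vertex_index :: "('a, 'b) monoid_scheme \<Rightarrow> 'a \<Rightarrow> nat" where
  "vertex_index G = (SOME h. bij_betw h (carrier G) {..<order G})"

definition vertex_label :: "('a, 'b) monoid_scheme \<Rightarrow> nat \<Rightarrow> 'a" where
  "vertex_label G = inv_into (carrier G) (vertex_index G)"

definition nat_copy :: "('a, 'b) monoid_scheme \<Rightarrow> nat monoid" where
  "nat_copy G = \<lparr>carrier = {..<order G},
     mult = (\<lambda>i j. vertex_index G (vertex_label G i \<otimes>\<^bsub>G\<^esub> vertex_label G j)),
     one = vertex_index G \<one>\<^bsub>G\<^esub>\<rparr>"

definition nat_cayley :: "('a, 'b) monoid_scheme \<Rightarrow> 'a set \<Rightarrow> nat pair_pre_digraph" where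
  "nat_cayley G S = Cay (nat_copy G) (vertex_index G ` S)"

locale cayley_set = group G for G (structure) +
  fixes S :: "'a set"
  assumes finite_carrier: "finite (carrier G)"
    and S_carrier: "S \<subseteq> carrier G"
    and S_inv: "m_inv G ` S = S"
    and one_notin_S: "\<one> \<notin> S"
begin

abbreviation "ix \<equiv> vertex_index G"
abbreviation "lab \<equiv> vertex_label G"
abbreviation "nn \<equiv> order G"

lemma ix_bij: "bij_betw ix (carrier G) {..<nn}"
proof -
  have "\<exists>h. bij_betw h (carrier G) {..<nn}"
    using ex_bij_betw_finite_nat[OF finite_carrier] by (simp add: order_def lessThan_atLeast0)
  then show ?thesis unfolding vertex_index_def by (rule someI_ex)
qed

lemma ix_less: "x \<in> carrier G \<Longrightarrow> ix x < nn"
  using ix_bij by (auto simp: bij_betw_def)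

lemma lab_bij: "bij_betw lab {..<nn} (carrier G)"
  unfolding vertex_label_def by (rule bij_betw_inv_into[OF ix_bij])

lemma lab_carrier: "i < nn \<Longrightarrow> lab i \<in> carrier G"
  using lab_bij by (auto simp: bij_betw_def)

lemma lab_ix [simp]: "x \<in> carrier G \<Longrightarrow> lab (ix x) = x"
  unfolding vertex_label_def by (rule bij_betw_inv_into_left[OF ix_bij])

lemma ix_lab [simp]: "i < nn \<Longrightarrow> ix (lab i) = i"
  unfolding vertex_label_def by (rule bij_betw_inv_into_right[OF ix_bij]) simp

lemma nat_copy_simps [simp]:
  "carrier (nat_copy G) = {..<nn}"
  "i \<otimes>\<^bsub>nat_copy G\<^esub> j = ix (lab i \<otimes> lab j)"
  "\<one>\<^bsub>nat_copy G\<^esub> = ix \<one>"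
  by (simp_all add: nat_copy_def)

lemma group_nat_copy: "group (nat_copy G)"
proof (rule groupI)
  fix i assume "i \<in> carrier (nat_copy G)"
  then show "\<exists>j\<in>carrier (nat_copy G). j \<otimes>\<^bsub>nat_copy G\<^esub> i = \<one>\<^bsub>nat_copy G\<^esub>"
    by (intro bexI[of _ "ix (inv (lab i))"]) (auto simp: lab_carrier ix_less)
qed (auto simp: lab_carrier ix_less m_assoc)

lemma inv_nat_copy:
  assumes "x \<in> carrier G"
  shows "inv\<^bsub>nat_copy G\<^esub> (ix x) = ix (inv x)"
proof -
  interpret C: group "nat_copy G" by (rule group_nat_copy)
  show ?thesis by (rule C.inv_equality) (use assms in \<open>auto simp: ix_less\<close>)
qed

lemma pverts_nat_cayley [simp]: "pverts (nat_cayley G S) = {..<nn}"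
  by (simp add: nat_cayley_def Cay_def)

lemma parcs_nat_cayley:
  "(i, j) \<in> parcs (nat_cayley G S) \<longleftrightarrow> i < nn \<and> j < nn \<and> (\<exists>s\<in>S. lab j = lab i \<otimes> s)"
proof -
  have "(i, j) \<in> parcs (nat_cayley G S) \<longleftrightarrow> i < nn \<and> (\<exists>s\<in>S. j = ix (lab i \<otimes> lab (ix s)))"
    unfolding nat_cayley_def Cay_def by auto
  also have "\<dots> \<longleftrightarrow> i < nn \<and> (\<exists>s\<in>S. j = ix (lab i \<otimes> s))"
    using S_carrier by (metis lab_ix subsetD)
  also have "\<dots> \<longleftrightarrow> i < nn \<and> j < nn \<and> (\<exists>s\<in>S. lab j = lab i \<otimes> s)"
  proof -
    have "j = ix (lab i \<otimes> s) \<longleftrightarrow> j < nn \<and> lab j = lab i \<otimes> s" if "i < nn" "s \<in> S" for s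
    proof -
      have "lab i \<otimes> s \<in> carrier G" using that S_carrier lab_carrier by blast
      then show ?thesis using ix_less by (metis ix_lab lab_ix)
    qed
    then show ?thesis by blast
  qed
  finally show ?thesis .
qed

lemma is_cayley_nat_cayley: "is_cayley_graph (nat_cayley G S)"
  unfolding is_cayley_graph_def
proof (intro exI conjI)
  show "group (nat_copy G)" by (rule group_nat_copy)
  show "finite (carrier (nat_copy G))" by simp
  show "ix ` S \<subseteq> carrier (nat_copy G)" using S_carrier by (auto simp: ix_less)
  show "\<one>\<^bsub>nat_copy G\<^esub> \<notin> ix ` S"
    using one_notin_S S_carrier by (auto dest!: arg_cong[of _ _ lab])
  have "m_inv (nat_copy G) ` (ix ` S) = ix ` (m_inv G ` S)"
    unfolding image_image by (intro image_cong refl inv_nat_copy) (use S_carrier in auto)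
  then show "m_inv (nat_copy G) ` (ix ` S) = ix ` S" by (simp add: S_inv)
  show "nat_cayley G S = Cay (nat_copy G) (ix ` S)" by (simp add: nat_cayley_def)
qed

lemma inj_on_mult_S: "x \<in> carrier G \<Longrightarrow> inj_on (\<lambda>s. x \<otimes> s) S"
  using S_carrier inj_on_cmult inj_on_subset by blast

lemma regular_nat_cayley: "regular_graph (card S) (nat_cayley G S)"
  unfolding regular_graph_def
proof
  fix v assume "v \<in> pverts (nat_cayley G S)"
  then have v: "v < nn" by simp
  have "out_arcs (with_proj (nat_cayley G S)) v = (\<lambda>s. (v, ix (lab v \<otimes> s))) ` S"
    using S_carrier v lab_carrier[OF v]
    by (auto simp: out_arcs_def parcs_nat_cayley image_iff ix_less subset_iff)
      (metis ix_lab)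
  then have "out_degree (with_proj (nat_cayley G S)) v = card ((\<lambda>s. (v, ix (lab v \<otimes> s))) ` S)"
    by (simp add: out_degree_def)
  also have "\<dots> = card S"
  proof (rule card_image, rule inj_onI)
    fix s t assume st: "s \<in> S" "t \<in> S" "(v, ix (lab v \<otimes> s)) = (v, ix (lab v \<otimes> t))"
    then have "lab v \<otimes> s = lab v \<otimes> t"
      using S_carrier v lab_carrier[OF v] by (metis lab_ix m_closed prod.inject subsetD)
    then show "s = t" using inj_on_mult_S[OF lab_carrier[OF v]] st by (auto dest: inj_onD)
  qed
  finally show "out_degree (with_proj (nat_cayley G S)) v = card S" .
qed

text \<open>Connectedness is strong connectedness of the symmetric closure. The induction over
  \<open>generate\<close> multiplies on the right, the side on which edges act, and leaves the
  starting vertex free.\<close>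

lemma connected_nat_cayley:
  assumes gen: "generate G S = carrier G"
  shows "Digraph_Component.connected (with_proj (nat_cayley G S))"
proof -
  let ?M = "with_proj (mk_symmetric (with_proj (nat_cayley G S)))"
  have verts: "verts ?M = {..<nn}" by (simp add: mk_symmetric_def)
  have "arcs ?M \<subseteq> {..<nn} \<times> {..<nn}"
    by (auto simp: mk_symmetric_def parcs_nat_cayley)
  then interpret M: wf_digraph ?M
    by unfold_locales (auto simp: verts)
  have arc: "ix x \<rightarrow>\<^bsub>?M\<^esub> ix (x \<otimes> s)" if "x \<in> carrier G" "s \<in> S" for x s
  proof -
    have "(ix x, ix (x \<otimes> s)) \<in> parcs (nat_cayley G S)"
      using that S_carrier by (auto simp: parcs_nat_cayley ix_less subset_iff)
    then have "(ix x, ix (x \<otimes> s)) \<in> arcs ?M" by (auto simp: mk_symmetric_def)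
    then show ?thesis by (auto simp: arcs_ends_def arc_to_ends_def image_iff)
  qed
  have reach: "ix x \<rightarrow>\<^sup>*\<^bsub>?M\<^esub> ix (x \<otimes> k)" if "k \<in> generate G S" "x \<in> carrier G" for k x
    using that
  proof (induction arbitrary: x rule: generate.induct)
    case one
    then show ?case using M.reachable_refl[of "ix x"] by (simp add: verts ix_less)
  next
    case (incl h)
    then show ?case using arc by (intro M.reachable_adjI) auto
  next
    case (inv h)
    then have "inv h \<in> S" using S_inv by blast
    then show ?case using arc inv by (intro M.reachable_adjI) auto
  next
    case (eng h1 h2)
    have h: "h1 \<in> carrier G" "h2 \<in> carrier G"
      using eng.hyps generate_in_carrier[OF S_carrier] by auto
    have "ix x \<rightarrow>\<^sup>*\<^bsub>?M\<^esub> ix (x \<otimes> h1)" using eng by simp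
    moreover have "ix (x \<otimes> h1) \<rightarrow>\<^sup>*\<^bsub>?M\<^esub> ix (x \<otimes> h1 \<otimes> h2)" using eng h by simp
    ultimately show ?case using h eng.prems by (simp add: m_assoc M.reachable_trans)
  qed
  have "u \<rightarrow>\<^sup>*\<^bsub>?M\<^esub> v" if "u < nn" "v < nn" for u v
  proof -
    have l: "lab u \<in> carrier G" "lab v \<in> carrier G" using that lab_carrier by auto
    have "ix (lab u) \<rightarrow>\<^sup>*\<^bsub>?M\<^esub> ix (lab u \<otimes> (inv lab u \<otimes> lab v))"
      using l by (intro reach) (auto simp: gen)
    also have "lab u \<otimes> (inv lab u \<otimes> lab v) = lab v"
      using l by (simp add: m_assoc[symmetric])
    finally show ?thesis using that by simp
  qed
  moreover have "{..<nn} \<noteq> {}" using ix_less[OF one_closed] by auto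
  ultimately show ?thesis
    unfolding Digraph_Component.connected_def strongly_connected_def by (auto simp: verts)
qed

definition adj :: "nat \<Rightarrow> nat \<Rightarrow> real" where
  "adj i j = (if \<exists>s\<in>S. lab j = lab i \<otimes> s then 1 else 0)"

lemma adjacency_nat_cayley: "adjacency_matrix (nat_cayley G S) = mat nn nn (\<lambda>(i, j). adj i j)"
proof -
  have "sorted_list_of_set {..<nn} = [0..<nn]"
    by (simp add: lessThan_atLeast0)
  then show ?thesis
    by (auto simp: adjacency_matrix_def Let_def parcs_nat_cayley adj_def intro!: cong_mat)
qed

lemma adj_sym: "i < nn \<Longrightarrow> j < nn \<Longrightarrow> adj i j = adj j i"
proof -
  have *: "\<exists>s\<in>S. lab i = lab j \<otimes> s" if "\<exists>s\<in>S. lab j = lab i \<otimes> s" "i < nn" "j < nn" for i j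
  proof -
    obtain s where s: "s \<in> S" "lab j = lab i \<otimes> s" using \<open>\<exists>s\<in>S. lab j = lab i \<otimes> s\<close> by auto
    then have "lab i = lab j \<otimes> inv s"
      using S_carrier lab_carrier[OF that(2)] by (simp add: m_assoc subsetD)
    moreover have "inv s \<in> S" using S_inv s by blast
    ultimately show ?thesis by blast
  qed
  show "i < nn \<Longrightarrow> j < nn \<Longrightarrow> adj i j = adj j i"
    using *[of i j] *[of j i] by (auto simp: adj_def)
qed

text \<open>The adjacency matrix is convolution with the indicator of \<open>S\<close>, distinct
  generators leading to distinct neighbours. The codomain is general because test functions are real
  and isotypic components complex.\<close>

lemma adj_sum:
  fixes f :: "'a \<Rightarrow> 'c :: real_algebra_1"
  assumes i: "i < nn"
  shows "(\<Sum>k<nn. of_real (adj i k) * f (lab k)) = (\<Sum>s\<in>S. f (lab i \<otimes> s))"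
proof -
  have "(\<Sum>k<nn. of_real (adj i k) * f (lab k))
      = (\<Sum>k\<in>(\<lambda>s. ix (lab i \<otimes> s)) ` S. of_real (adj i k) * f (lab k))"
    using S_carrier lab_carrier[OF i]
    by (intro sum.mono_neutral_right) (auto simp: adj_def image_iff ix_less, metis ix_lab)
  also have "\<dots> = (\<Sum>s\<in>S. of_real (adj i (ix (lab i \<otimes> s))) * f (lab (ix (lab i \<otimes> s))))"
  proof (rule sum.reindex_cong[OF _ refl refl], rule inj_onI)
    fix s t assume st: "s \<in> S" "t \<in> S" "ix (lab i \<otimes> s) = ix (lab i \<otimes> t)"
    then have "lab i \<otimes> s = lab i \<otimes> t"
      using S_carrier lab_carrier[OF i] by (metis lab_ix m_closed subsetD)
    then show "s = t" using inj_on_mult_S[OF lab_carrier[OF i]] st by (auto dest: inj_onD)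
  qed
  also have "\<dots> = (\<Sum>s\<in>S. f (lab i \<otimes> s))"
  proof (rule sum.cong[OF refl])
    fix s assume s: "s \<in> S"
    then have "lab (ix (lab i \<otimes> s)) = lab i \<otimes> s"
      using S_carrier lab_carrier[OF i] by auto
    moreover from this have "adj i (ix (lab i \<otimes> s)) = 1" using s by (auto simp: adj_def)
    ultimately show "of_real (adj i (ix (lab i \<otimes> s))) * f (lab (ix (lab i \<otimes> s))) = f (lab i \<otimes> s)"
      by simp
  qed
  finally show ?thesis .
qed

lemma sum_lab: "(\<Sum>k<nn. f (lab k)) = (\<Sum>x\<in>carrier G. f x)"
  by (rule sum.reindex_bij_betw[OF lab_bij])

lemma graph_eigenvalue_nat_cayley:
  "graph_eigenvalue (nat_cayley G S) j = eigen_list (mat nn nn (\<lambda>(i, j). adj i j)) ! (j - 1)"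
  by (simp add: graph_eigenvalue_def graph_eigenvalues_def adjacency_nat_cayley eigen_list_def)

lemma second_eigenvalue_eigenfunction:
  assumes "nn \<ge> 2"
  obtains f :: "'a \<Rightarrow> real"
  where "\<exists>x\<in>carrier G. f x \<noteq> 0" "(\<Sum>x\<in>carrier G. f x) = 0"
    "\<And>x. x \<in> carrier G \<Longrightarrow> (\<Sum>s\<in>S. f (x \<otimes> s)) = graph_eigenvalue (nat_cayley G S) 2 * f x"
proof -
  have "adj i k \<ge> 0" for i k by (simp add: adj_def)
  moreover have "(\<Sum>k<nn. adj i k) = card S" if "i < nn" for i
    using adj_sum[OF that, of "\<lambda>_. 1 :: real"] by simp
  ultimately obtain f where f: "\<exists>i<nn. f i \<noteq> 0" "(\<Sum>i<nn. f i) = 0"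
    "\<forall>i<nn. (\<Sum>k<nn. adj i k * f k) = graph_eigenvalue (nat_cayley G S) 2 * f i"
    using second_eigenvalue_variational(1)[of nn adj "real (card S)", OF adj_sym assms]
    unfolding graph_eigenvalue_nat_cayley by auto
  show thesis
  proof (rule that[of "f \<circ> ix"])
    show "\<exists>x\<in>carrier G. (f \<circ> ix) x \<noteq> 0" using f(1) lab_carrier by (metis comp_apply ix_lab)
    show "(\<Sum>x\<in>carrier G. (f \<circ> ix) x) = 0"
      using f(2) sum_lab[of "f \<circ> ix"] by simp
    fix x assume x: "x \<in> carrier G"
    show "(\<Sum>s\<in>S. (f \<circ> ix) (x \<otimes> s)) = graph_eigenvalue (nat_cayley G S) 2 * (f \<circ> ix) x"
      using f(3)[rule_format, OF ix_less[OF x]] adj_sum[OF ix_less[OF x], of "f \<circ> ix"] x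
      by simp
  qed
qed

lemma second_eigenvalue_rayleigh:
  fixes f :: "'a \<Rightarrow> real"
  assumes "nn \<ge> 2" "(\<Sum>x\<in>carrier G. f x) = 0"
  shows "(\<Sum>x\<in>carrier G. f x * (\<Sum>s\<in>S. f (x \<otimes> s)))
    \<le> graph_eigenvalue (nat_cayley G S) 2 * (\<Sum>x\<in>carrier G. (f x)\<^sup>2)"
proof -
  have "adj i k \<ge> 0" for i k by (simp add: adj_def)
  moreover have "(\<Sum>k<nn. adj i k) = card S" if "i < nn" for i
    using adj_sum[OF that, of "\<lambda>_. 1 :: real"] by simp
  moreover have "(\<Sum>i<nn. (f \<circ> lab) i) = 0" using sum_lab[of f] assms by simp
  ultimately have "(\<Sum>i<nn. f (lab i) * (\<Sum>k<nn. adj i k * f (lab k)))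
    \<le> graph_eigenvalue (nat_cayley G S) 2 * (\<Sum>i<nn. (f (lab i))\<^sup>2)"
    using second_eigenvalue_variational(2)[of nn adj "real (card S)" "f \<circ> lab", OF adj_sym assms(1)]
    unfolding graph_eigenvalue_nat_cayley by simp
  moreover have "(\<Sum>i<nn. f (lab i) * (\<Sum>k<nn. adj i k * f (lab k)))
      = (\<Sum>i<nn. f (lab i) * (\<Sum>s\<in>S. f (lab i \<otimes> s)))"
    by (intro sum.cong refl) (use adj_sum[where f = f] in auto)
  ultimately show ?thesis
    using sum_lab[of "\<lambda>x. f x * (\<Sum>s\<in>S. f (x \<otimes> s))"] sum_lab[of "\<lambda>x. (f x)\<^sup>2"] by simp
qed

lemma second_eigenvalue_multiplicity_ge:
  fixes w :: "'x \<Rightarrow> 'a \<Rightarrow> complex"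
  assumes X: "finite X"
    and eig: "\<And>b x. b \<in> X \<Longrightarrow> x \<in> carrier G \<Longrightarrow>
      (\<Sum>s\<in>S. w b (x \<otimes> s)) = graph_eigenvalue (nat_cayley G S) 2 * w b x"
    and orth: "\<And>b c. b \<in> X \<Longrightarrow> c \<in> X \<Longrightarrow> b \<noteq> c \<Longrightarrow> (\<Sum>x\<in>carrier G. w b x * cnj (w c x)) = 0"
    and nz: "\<And>b. b \<in> X \<Longrightarrow> \<exists>x\<in>carrier G. w b x \<noteq> 0"
  shows "card X \<le> second_eigenvalue_multiplicity (nat_cayley G S)"
proof -
  define es where "es = eigen_list (mat nn nn (\<lambda>(i, j). adj i j))"
  have "card X \<le> card {j. j < nn \<and> es ! j = graph_eigenvalue (nat_cayley G S) 2}"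
    unfolding es_def
  proof (rule eigen_list_multiplicity_ge[of nn adj X "\<lambda>b. w b \<circ> lab"])
    fix b i assume "b \<in> X" "i < nn"
    then show "(\<Sum>k<nn. adj i k * (w b \<circ> lab) k)
        = graph_eigenvalue (nat_cayley G S) 2 * (w b \<circ> lab) i"
      using eig lab_carrier adj_sum[where f = "w b"] by simp
  next
    fix b c assume "b \<in> X" "c \<in> X" "b \<noteq> c"
    then show "(\<Sum>i<nn. (w b \<circ> lab) i * cnj ((w c \<circ> lab) i)) = 0"
      using orth sum_lab[of "\<lambda>x. w b x * cnj (w c x)"] by simp
  next
    fix b assume "b \<in> X"
    then show "\<exists>i<nn. (w b \<circ> lab) i \<noteq> 0"
      using nz[of b] by (metis comp_apply ix_less lab_ix)
  qed (auto simp: adj_sym X)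
  \<comment> \<open>Positions in the list start at 0, eigenvalue indices at 1.\<close>
  also have "{j. j < nn \<and> es ! j = graph_eigenvalue (nat_cayley G S) 2}
     = (\<lambda>j. j - 1) ` {j \<in> {1..nn}. graph_eigenvalue (nat_cayley G S) j
          = graph_eigenvalue (nat_cayley G S) 2}" (is "_ = ?g ` ?J")
  proof safe
    fix j assume "j < nn" "es ! j = graph_eigenvalue (nat_cayley G S) 2"
    then show "j \<in> ?g ` ?J"
      by (intro image_eqI[of _ _ "Suc j"]) (auto simp: graph_eigenvalue_nat_cayley es_def)
  qed (auto simp: graph_eigenvalue_nat_cayley[of j for j] es_def)
  also have "card (?g ` ?J) = card ?J"
    by (rule card_image) (auto intro!: inj_onI)
  finally show ?thesis by (simp add: second_eigenvalue_multiplicity_def)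
qed

end

section \<open>Characters and the group SL(2,q)\<close>

text \<open>A finite abelian subgroup of \<open>G\<close>, given by residues \<open>V\<close> with
  their own addition and an embedding \<open>el\<close>, together with its characters indexed by
  \<open>A\<close>. The two instances are the upper unitriangular subgroup of SL(2,q) and the
  translations of the affine group.\<close>

locale char_family = group G for G (structure) +
  fixes V :: "'v set" and add :: "'v \<Rightarrow> 'v \<Rightarrow> 'v" and zero :: 'v and el :: "'v \<Rightarrow> 'a"
    and A :: "'c set" and triv :: 'c and \<chi> :: "'c \<Rightarrow> 'v \<Rightarrow> complex"
  assumes finite_V: "finite V" and finite_A: "finite A" and triv: "triv \<in> A"
    and zero_V: "zero \<in> V" and el_carrier: "v \<in> V \<Longrightarrow> el v \<in> carrier G"
    and el_zero: "el zero = \<one>"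
    and bij_add: "w \<in> V \<Longrightarrow> bij_betw (\<lambda>v. add v w) V V"
    and el_add: "v \<in> V \<Longrightarrow> w \<in> V \<Longrightarrow> el (add v w) = el v \<otimes> el w"
    and \<chi>_add: "a \<in> A \<Longrightarrow> v \<in> V \<Longrightarrow> w \<in> V \<Longrightarrow> \<chi> a (add v w) = \<chi> a v * \<chi> a w"
    and \<chi>_norm: "a \<in> A \<Longrightarrow> v \<in> V \<Longrightarrow> cmod (\<chi> a v) = 1"
    and \<chi>_triv: "v \<in> V \<Longrightarrow> \<chi> triv v = 1"
    and \<chi>_zero: "a \<in> A \<Longrightarrow> \<chi> a zero = 1"
    and \<chi>_sum: "v \<in> V \<Longrightarrow> v \<noteq> zero \<Longrightarrow> (\<Sum>a\<in>A. \<chi> a v) = 0"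
begin

text \<open>Up to the factor \<open>card V\<close>, the projection to the functions that transform
  under left multiplication by \<open>el\<close> according to the character
  \<open>a\<close>.\<close>

definition component :: "'c \<Rightarrow> ('a \<Rightarrow> complex) \<Rightarrow> 'a \<Rightarrow> complex" where
  "component a f x = (\<Sum>v\<in>V. cnj (\<chi> a v) * f (el v \<otimes> x))"

lemma \<chi>_cnj: "a \<in> A \<Longrightarrow> v \<in> V \<Longrightarrow> \<chi> a v * cnj (\<chi> a v) = 1"
  using \<chi>_norm[of a v] complex_norm_square[of "\<chi> a v"] by simp

lemma component_translate:
  assumes a: "a \<in> A" and w: "w \<in> V" and x: "x \<in> carrier G"
  shows "component a f (el w \<otimes> x) = \<chi> a w * component a f x"
proof -
  have "component a f x = (\<Sum>v\<in>V. cnj (\<chi> a (add v w)) * f (el (add v w) \<otimes> x))"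
    unfolding component_def by (rule sum.reindex_bij_betw[OF bij_add[OF w], symmetric])
  also have "\<dots> = (\<Sum>v\<in>V. cnj (\<chi> a w) * (cnj (\<chi> a v) * f (el v \<otimes> (el w \<otimes> x))))"
    using a w x el_carrier by (intro sum.cong refl) (simp add: \<chi>_add el_add m_assoc)
  also have "\<dots> = cnj (\<chi> a w) * component a f (el w \<otimes> x)"
    by (simp add: component_def sum_distrib_left)
  finally have "\<chi> a w * component a f x = (\<chi> a w * cnj (\<chi> a w)) * component a f (el w \<otimes> x)"
    by (simp add: mult.assoc)
  then show ?thesis using \<chi>_cnj[OF a w] by simp
qed

text \<open>Fourier inversion: summing the characters over \<open>A\<close> leaves only the term at
  \<open>zero\<close>.\<close>

lemma sum_component:
  assumes x: "x \<in> carrier G"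
  shows "(\<Sum>a\<in>A. component a f x) = of_nat (card A) * f x"
proof -
  have "(\<Sum>a\<in>A. component a f x) = (\<Sum>v\<in>V. \<Sum>a\<in>A. cnj (\<chi> a v) * f (el v \<otimes> x))"
    unfolding component_def by (rule sum.swap)
  also have "\<dots> = (\<Sum>v\<in>V. cnj (\<Sum>a\<in>A. \<chi> a v) * f (el v \<otimes> x))"
    by (simp add: sum_distrib_right)
  also have "\<dots> = (\<Sum>v\<in>{zero}. cnj (\<Sum>a\<in>A. \<chi> a v) * f (el v \<otimes> x))"
    by (rule sum.mono_neutral_right) (use \<chi>_sum finite_V zero_V in auto)
  also have "\<dots> = of_nat (card A) * f x" using x by (simp add: \<chi>_zero el_zero)
  finally show ?thesis .
qed

text \<open>Otherwise inversion makes a nonzero multiple of \<open>f\<close> equal to its trivial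
  component, which left multiplication by \<open>el w\<close> does not change.\<close>

lemma nontrivial_component:
  assumes x: "x \<in> carrier G" and w: "w \<in> V" and neq: "f (el w \<otimes> x) \<noteq> f x"
  obtains a y where "a \<in> A" "a \<noteq> triv" "y \<in> carrier G" "component a f y \<noteq> 0"
proof (rule ccontr)
  assume "\<not> thesis"
  then have z: "component a f y = 0" if "a \<in> A" "a \<noteq> triv" "y \<in> carrier G" for a y
    using that \<open>(\<And>a y. a \<in> A \<Longrightarrow> a \<noteq> triv \<Longrightarrow> y \<in> carrier G \<Longrightarrow> component a f y \<noteq> 0 \<Longrightarrow> thesis)\<close>
    by blast
  have "of_nat (card A) * f y = component triv f y" if y: "y \<in> carrier G" for y
  proof -
    have "(\<Sum>a\<in>A. component a f y) = (\<Sum>a\<in>{triv}. component a f y)"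
      by (rule sum.mono_neutral_right) (use finite_A triv z y in auto)
    then show ?thesis using sum_component[OF y, of f] by simp
  qed
  from this[OF x] this[of "el w \<otimes> x"]
  have "of_nat (card A) * f (el w \<otimes> x) = of_nat (card A) * f x"
    using component_translate[OF triv w x, of f] \<chi>_triv[OF w] el_carrier[OF w] x by simp
  moreover have "card A \<noteq> 0" using finite_A triv by auto
  ultimately show False using neq by simp
qed

text \<open>Components are averages over left translates, and these commute with right
  multiplication by the generators.\<close>

lemma component_eigenfunction:
  assumes S: "S \<subseteq> carrier G"
    and eig: "\<And>x. x \<in> carrier G \<Longrightarrow> (\<Sum>s\<in>S. f (x \<otimes> s)) = \<mu> * f x"
    and x: "x \<in> carrier G"
  shows "(\<Sum>s\<in>S. component a f (x \<otimes> s)) = \<mu> * component a f x"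
proof -
  have "(\<Sum>s\<in>S. component a f (x \<otimes> s)) = (\<Sum>v\<in>V. \<Sum>s\<in>S. cnj (\<chi> a v) * f (el v \<otimes> (x \<otimes> s)))"
    unfolding component_def by (rule sum.swap)
  also have "\<dots> = (\<Sum>v\<in>V. cnj (\<chi> a v) * (\<Sum>s\<in>S. f (el v \<otimes> x \<otimes> s)))"
    unfolding sum_distrib_left using S x el_carrier
    by (intro sum.cong refl) (simp add: m_assoc subset_iff)
  also have "\<dots> = (\<Sum>v\<in>V. cnj (\<chi> a v) * (\<mu> * f (el v \<otimes> x)))"
    using x el_carrier by (intro sum.cong refl) (simp add: eig)
  finally show ?thesis by (simp add: component_def sum_distrib_left mult_ac)
qed

end

text \<open>Translating the summation variable by \<open>h\<close> multiplies the inner product by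
  \<open>c * cnj d\<close>.\<close>

lemma (in group) orthogonal_translation_eigenfunctions:
  fixes f g :: "'a \<Rightarrow> complex"
  assumes h: "h \<in> carrier G"
    and f: "\<And>x. x \<in> carrier G \<Longrightarrow> f (h \<otimes> x) = c * f x"
    and g: "\<And>x. x \<in> carrier G \<Longrightarrow> g (h \<otimes> x) = d * g x"
    and cd: "c * cnj d \<noteq> 1"
  shows "(\<Sum>x\<in>carrier G. f x * cnj (g x)) = 0"
proof -
  have "bij_betw (\<lambda>x. h \<otimes> x) (carrier G) (carrier G)"
    using h inj_on_cmult surj_const_mult by (auto simp: bij_betw_def)
  then have "(\<Sum>x\<in>carrier G. f x * cnj (g x)) = (\<Sum>x\<in>carrier G. f (h \<otimes> x) * cnj (g (h \<otimes> x)))"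
    by (rule sum.reindex_bij_betw[symmetric])
  also have "\<dots> = (\<Sum>x\<in>carrier G. (c * cnj d) * (f x * cnj (g x)))"
    by (intro sum.cong refl) (simp add: f g mult_ac)
  also have "\<dots> = (c * cnj d) * (\<Sum>x\<in>carrier G. f x * cnj (g x))"
    by (rule sum_distrib_left[symmetric])
  finally show ?thesis using cd by (metis mult_cancel_right1)
qed

section \<open>Additive characters modulo \<open>q\<close>\<close>

definition ech :: "int \<Rightarrow> int \<Rightarrow> complex" where
  "ech q k = cis (2 * pi * real_of_int k / real_of_int q)"

lemma ech_add: "ech q (j + k) = ech q j * ech q k"
  by (simp add: ech_def cis_mult add_divide_distrib distrib_left)

lemma ech_zero [simp]: "ech q 0 = 1"
  by (simp add: ech_def)

lemma cmod_ech [simp]: "cmod (ech q k) = 1"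
  by (simp add: ech_def)

lemma cnj_ech: "cnj (ech q k) = ech q (- k)"
  by (simp add: ech_def cis_cnj)

lemma ech_eq_1_iff:
  assumes "q > 0"
  shows "ech q k = 1 \<longleftrightarrow> q dvd k"
proof
  assume "q dvd k"
  then obtain j where "k = q * j" by (elim dvdE)
  then have "2 * pi * real_of_int k / real_of_int q = 2 * pi * real_of_int j" using assms by simp
  then show "ech q k = 1" unfolding ech_def by (simp only: cis_multiple_2pi[OF Ints_of_int])
next
  assume "ech q k = 1"
  then have "cos (2 * pi * real_of_int k / real_of_int q) = 1"
    by (simp add: ech_def complex_eq_iff)
  then obtain j :: int where "2 * pi * real_of_int k / real_of_int q = real_of_int j * 2 * pi"
    using cos_one_2pi_int by blast
  then have "real_of_int k = real_of_int (j * q)" using assms by (simp add: field_simps)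
  then show "q dvd k" by (metis dvd_triv_right of_int_eq_iff)
qed

lemma ech_cong:
  assumes "q > 0" "j mod q = k mod q"
  shows "ech q j = ech q k"
proof -
  have "ech q (j - k) = 1"
    using assms by (simp add: ech_eq_1_iff mod_eq_dvd_iff)
  then show ?thesis using ech_add[of q "j - k" k] by simp
qed

lemma sum_ech:
  assumes q: "q > 0" and k: "\<not> q dvd k"
  shows "(\<Sum>a\<in>{0..<q}. ech q (a * k)) = 0"
proof -
  have pw: "ech q (int i * k) = ech q k ^ i" for i
    by (induction i) (simp_all add: ech_add distrib_right)
  have "bij_betw int {..<nat q} {0..<q}"
    using q by (intro bij_betwI[of _ _ _ nat]) auto
  then have "(\<Sum>a\<in>{0..<q}. ech q (a * k)) = (\<Sum>i<nat q. ech q (int i * k))"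
    by (rule sum.reindex_bij_betw[symmetric])
  also have "\<dots> = (\<Sum>i<nat q. ech q k ^ i)" by (simp add: pw)
  also have "\<dots> = (ech q k ^ nat q - 1) / (ech q k - 1)"
    using k q by (intro geometric_sum) (simp add: ech_eq_1_iff)
  also have "ech q k ^ nat q = 1"
    unfolding pw[symmetric] using q by (simp add: ech_eq_1_iff)
  finally show ?thesis by simp
qed

section \<open>Two by two matrices modulo \<open>q\<close>\<close>

lemmas int_cong_def = unique_euclidean_semiring_class.cong_def[where 'a = int]

type_synonym mat2 = "int \<times> int \<times> int \<times> int"

fun mmul :: "mat2 \<Rightarrow> mat2 \<Rightarrow> mat2" where
  "mmul (a, b, c, d) (e, f, g, h) = (a * e + b * g, a * f + b * h, c * e + d * g, c * f + d * h)"

fun mdet :: "mat2 \<Rightarrow> int" where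
  "mdet (a, b, c, d) = a * d - b * c"

fun madj :: "mat2 \<Rightarrow> mat2" where
  "madj (a, b, c, d) = (d, - b, - c, a)"

fun mred :: "int \<Rightarrow> mat2 \<Rightarrow> mat2" where
  "mred q (a, b, c, d) = (a mod q, b mod q, c mod q, d mod q)"

lemma mmul_assoc: "mmul (mmul x y) z = mmul x (mmul y z)"
  by (cases x; cases y; cases z) (simp add: algebra_simps)

lemma mdet_mmul: "mdet (mmul x y) = mdet x * mdet y"
  by (cases x; cases y) (simp add: algebra_simps)

lemma mred_mred [simp]: "mred q (mred q x) = mred q x"
  by (cases x) simp

lemma mred_mmul_left [simp]: "mred q (mmul (mred q x) y) = mred q (mmul x y)"
  by (cases x; cases y) (auto simp flip: int_cong_def intro!: cong_add cong_mult)

lemma mred_mmul_right [simp]: "mred q (mmul x (mred q y)) = mred q (mmul x y)"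
  by (cases x; cases y) (auto simp flip: int_cong_def intro!: cong_add cong_mult)

lemma mdet_mred [simp]: "mdet (mred q x) mod q = mdet x mod q"
  by (cases x) (auto simp flip: int_cong_def intro!: cong_diff cong_mult)

lemma mmul_madj: "mmul (madj x) x = (mdet x, 0, 0, mdet x)"
  by (cases x) (simp add: algebra_simps)

lemma mod_eq_self_iff: "q > 0 \<Longrightarrow> a mod q = a \<longleftrightarrow> 0 \<le> a \<and> a < q" for a q :: int
  by (metis mod_pos_pos_trivial pos_mod_bound pos_mod_sign)

text \<open>Elements are reduced integer representatives. Products are formed over the integers and
  reduced once, so group identities follow from polynomial identities.\<close>

definition SL2 :: "int \<Rightarrow> mat2 monoid" where
  "SL2 q = \<lparr>carrier = {x. mred q x = x \<and> mdet x mod q = 1},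
     mult = (\<lambda>x y. mred q (mmul x y)), one = (1, 0, 0, 1)\<rparr>"

lemma SL2_simps [simp]:
  "x \<in> carrier (SL2 q) \<longleftrightarrow> mred q x = x \<and> mdet x mod q = 1"
  "x \<otimes>\<^bsub>SL2 q\<^esub> y = mred q (mmul x y)"
  "\<one>\<^bsub>SL2 q\<^esub> = (1, 0, 0, 1)"
  by (simp_all add: SL2_def)

lemma mdet_mult_mod: "mdet x mod q = 1 \<Longrightarrow> mdet y mod q = 1 \<Longrightarrow> q > 1 \<Longrightarrow> mdet (mmul x y) mod q = 1"
  unfolding mdet_mmul by (metis mod_mult_eq mult_1 mod_pos_pos_trivial zero_le_one)

lemma group_SL2:
  assumes q: "q > 1"
  shows "group (SL2 q)"
proof (rule groupI)
  fix x y assume "x \<in> carrier (SL2 q)" "y \<in> carrier (SL2 q)"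
  then show "x \<otimes>\<^bsub>SL2 q\<^esub> y \<in> carrier (SL2 q)"
    using q mdet_mult_mod by simp
next
  fix x assume x: "x \<in> carrier (SL2 q)"
  have "mred q (madj x) \<otimes>\<^bsub>SL2 q\<^esub> x = \<one>\<^bsub>SL2 q\<^esub>"
    using x by (simp add: mmul_madj)
  moreover have "mred q (madj x) \<in> carrier (SL2 q)"
    using x by (cases x) (simp only: SL2_simps mred_mred mdet_mred, simp add: mult.commute)
  ultimately show "\<exists>y\<in>carrier (SL2 q). y \<otimes>\<^bsub>SL2 q\<^esub> x = \<one>\<^bsub>SL2 q\<^esub>" by blast
next
  fix x assume "x \<in> carrier (SL2 q)"
  then show "\<one>\<^bsub>SL2 q\<^esub> \<otimes>\<^bsub>SL2 q\<^esub> x = x" by (cases x) simp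
qed (use q in \<open>simp_all add: mmul_assoc\<close>)

lemma finite_SL2:
  assumes "q > 0"
  shows "finite (carrier (SL2 q))"
proof (rule finite_subset)
  show "carrier (SL2 q) \<subseteq> {0..<q} \<times> {0..<q} \<times> {0..<q} \<times> {0..<q}"
    using assms by (auto simp: mod_eq_self_iff)
qed auto

lemma mod_inverse_exists:
  fixes q a :: int
  assumes "prime q" "\<not> q dvd a"
  obtains b where "(a * b) mod q = 1"
proof -
  have "coprime a q" using assms by (metis prime_imp_coprime coprime_commute)
  then obtain u v where "u * a + v * q = 1" using bezout_int[of a q] by auto
  then have "a * u - 1 = q * - v" by (simp add: algebra_simps)
  then have "(a * u) mod q = 1 mod q" by (simp add: mod_eq_dvd_iff)
  then show thesis using that prime_gt_1_int[OF assms(1)] by simp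
qed

text \<open>\<open>f\<close> drops the entry that the determinant condition determines:
  \<open>d\<close> if \<open>a\<close> is invertible, and \<open>c\<close> if \<open>a = 0\<close>,
  when \<open>b\<close> must be invertible.\<close>

lemma card_SL2_le:
  assumes q: "prime q"
  shows "card (carrier (SL2 q)) \<le> nat q ^ 3"
proof -
  have q1: "q > 1" using q by (rule prime_gt_1_int)
  define f where "f = (\<lambda>(a :: int, b :: int, c :: int, d :: int). if a = 0 then (a, b, d) else (a, b, c))"
  have rng: "a \<in> {0..<q} \<and> b \<in> {0..<q} \<and> c \<in> {0..<q} \<and> d \<in> {0..<q}"
    if "(a, b, c, d) \<in> carrier (SL2 q)" for a b c d
    using that q1 by (simp add: mod_eq_self_iff)
  have canc: "y = z" if "(x * y) mod q = (x * z) mod q" "\<not> q dvd x" "y \<in> {0..<q}" "z \<in> {0..<q}" for x y z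
  proof -
    have "q dvd x * (y - z)" using that(1) by (simp add: mod_eq_dvd_iff right_diff_distrib)
    then have "q dvd y - z" using that(2) q by (simp add: prime_dvd_mult_iff)
    then have "y mod q = z mod q" by (simp add: mod_eq_dvd_iff)
    then show ?thesis using that by simp
  qed
  have "inj_on f (carrier (SL2 q))"
  proof (rule inj_onI)
    fix x y assume xy: "x \<in> carrier (SL2 q)" "y \<in> carrier (SL2 q)" "f x = f y"
    obtain a b c d a' b' c' d' where x: "x = (a, b, c, d)" and y: "y = (a', b', c', d')"
      by (cases x; cases y)
    have r: "a \<in> {0..<q} \<and> b \<in> {0..<q} \<and> c \<in> {0..<q} \<and> d \<in> {0..<q}"
      "a' \<in> {0..<q} \<and> b' \<in> {0..<q} \<and> c' \<in> {0..<q} \<and> d' \<in> {0..<q}"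
      using rng xy x y by blast+
    have det: "(a * d - b * c) mod q = 1" "(a' * d' - b' * c') mod q = 1"
      using xy x y by auto
    have aa: "a' = a" "b' = b" using xy(3) by (auto simp: f_def x y split: if_splits)
    show "x = y"
    proof (cases "a = 0")
      case True
      then have d: "d' = d" using xy(3) aa by (simp add: f_def x y)
      have "(- (b * c)) mod q = (- (b * c')) mod q" using det True aa by simp
      then have "(- (- (b * c))) mod q = (- (- (b * c'))) mod q" by (rule mod_minus_cong)
      then have "(b * c) mod q = (b * c') mod q" by simp
      moreover have "\<not> q dvd b"
      proof
        assume "q dvd b"
        then have "q dvd a * d - b * c" using True by simp
        then show False using det(1) by (simp add: dvd_imp_mod_0)
      qed
      ultimately show ?thesis using canc r d aa x y by metis
    next
      case False
      then have c: "c' = c" using xy(3) aa by (simp add: f_def x y)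
      have "(a * d) mod q = (a * d') mod q"
        using det aa c by (metis diff_add_cancel mod_add_left_eq)
      moreover have "\<not> q dvd a" using False r zdvd_not_zless[of a q] by auto
      ultimately show ?thesis using canc r c aa x y by metis
    qed
  qed
  moreover have "f ` carrier (SL2 q) \<subseteq> {0..<q} \<times> {0..<q} \<times> {0..<q}"
  proof (rule image_subsetI)
    fix x assume x: "x \<in> carrier (SL2 q)"
    obtain a b c d where abcd: "x = (a, b, c, d)" by (cases x)
    show "f x \<in> {0..<q} \<times> {0..<q} \<times> {0..<q}"
      using rng[of a b c d] x unfolding abcd f_def by (simp del: SL2_simps)
  qed
  ultimately have "card (carrier (SL2 q)) \<le> card ({0..<q} \<times> {0..<q} \<times> {0..<q})"
    by (rule card_inj_on_le) simp
  also have "\<dots> = nat q ^ 3" by (simp add: card_cartesian_product power3_eq_cube)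
  finally show ?thesis .
qed

definition upper :: "int \<Rightarrow> int \<Rightarrow> mat2" where "upper q v = mred q (1, v, 0, 1)"
definition lower :: "int \<Rightarrow> int \<Rightarrow> mat2" where "lower q v = mred q (1, 0, v, 1)"

lemma mred_eqI:
  assumes "q dvd a - a'" "q dvd b - b'" "q dvd c - c'" "q dvd d - d'"
  shows "mred q (a, b, c, d) = mred q (a', b', c', d')"
  using assms by (simp add: mod_eq_dvd_iff)

lemma mred_in_SL2: "q > 1 \<Longrightarrow> mdet x mod q = 1 \<Longrightarrow> mred q x \<in> carrier (SL2 q)"
  by simp

lemma upper_in_SL2: "q > 1 \<Longrightarrow> upper q v \<in> carrier (SL2 q)"
  and lower_in_SL2: "q > 1 \<Longrightarrow> lower q v \<in> carrier (SL2 q)"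
  unfolding upper_def lower_def by (rule mred_in_SL2, simp, simp)+

text \<open>With \<open>e\<close> inverse to \<open>c\<close>, the outer entries are
  \<open>(a - 1) * e\<close> and \<open>(d - 1) * e\<close>; the upper right entry then agrees
  because both sides have determinant 1.\<close>

lemma SL2_elementary_decomposition:
  assumes q: "prime q" and x: "(a, b, c, d) \<in> carrier (SL2 q)" and c: "\<not> q dvd c"
  obtains v w where "(a, b, c, d) = upper q v \<otimes>\<^bsub>SL2 q\<^esub> (lower q c \<otimes>\<^bsub>SL2 q\<^esub> upper q w)"
proof -
  obtain e where e: "(c * e) mod q = 1" using mod_inverse_exists[OF q c] .
  have q1: "q > 1" using q by (rule prime_gt_1_int)
  have "(c * e) mod q = 1 mod q" using e q1 by simp
  then have "q dvd c * e - 1" by (simp only: mod_eq_dvd_iff)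
  then obtain k where "c * e - 1 = q * k" by (elim dvdE)
  then have k: "c * e = 1 + q * k" by simp
  have det: "(a * d - b * c) mod q = 1 mod q" and fx: "mred q (a, b, c, d) = (a, b, c, d)"
    using x q1 by auto
  then have "q dvd a * d - b * c - 1" by (simp add: mod_eq_dvd_iff)
  then obtain j where "a * d - b * c - 1 = q * j" by (elim dvdE)
  then have j: "a * d = 1 + b * c + q * j" by simp
  define v w where "v = (a - 1) * e" and "w = (d - 1) * e"
  have "upper q v \<otimes>\<^bsub>SL2 q\<^esub> (lower q c \<otimes>\<^bsub>SL2 q\<^esub> upper q w)
      = mred q (1 + v * c, w + v * (c * w + 1), c, c * w + 1)"
    unfolding upper_def lower_def SL2_simps mred_mmul_left mred_mmul_right by (simp add: algebra_simps)
  also have "\<dots> = mred q (a, b, c, d)"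
  proof (rule mred_eqI)
    have "1 + v * c - a = (a - 1) * (c * e) - (a - 1)" by (simp add: v_def algebra_simps)
    also have "\<dots> = q * ((a - 1) * k)" unfolding k by (simp add: algebra_simps)
    finally show "q dvd 1 + v * c - a" by simp
    have 1: "c * w + 1 - d = (d - 1) * (c * e) - (d - 1)" by (simp add: w_def algebra_simps)
    also have "\<dots> = q * ((d - 1) * k)" unfolding k by (simp add: algebra_simps)
    finally show cw: "q dvd c * w + 1 - d" by simp
    have "w + v * (c * w + 1) - b = v * (c * w + 1 - d) + (w + v * d - b)" by (simp add: algebra_simps)
    moreover have "w + v * d - b = e * (a * d) - e - b" by (simp add: v_def w_def algebra_simps)
    then have "w + v * d - b = b * (c * e) - b + q * (e * j)" unfolding j by (simp add: algebra_simps)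
    then have "w + v * d - b = q * (b * k + e * j)" unfolding k by (simp add: algebra_simps)
    ultimately show "q dvd w + v * (c * w + 1) - b" using cw by simp
  qed simp
  finally have "(a, b, c, d) = upper q v \<otimes>\<^bsub>SL2 q\<^esub> (lower q c \<otimes>\<^bsub>SL2 q\<^esub> upper q w)"
    unfolding fx by (rule sym)
  then show thesis by (rule that)
qed

text \<open>The elementary factors are peeled off from the left. If \<open>c\<close> is divisible by
  \<open>q\<close>, one multiplies by \<open>lower q 1\<close> beforehand: the new entry
  \<open>a + c\<close> is a unit, since the determinant 1 makes \<open>a\<close> one.\<close>

lemma SL2_function_constant:
  assumes q: "prime q"
    and U: "\<And>v x. x \<in> carrier (SL2 q) \<Longrightarrow> F (upper q v \<otimes>\<^bsub>SL2 q\<^esub> x) = F x"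
    and L: "\<And>v x. x \<in> carrier (SL2 q) \<Longrightarrow> F (lower q v \<otimes>\<^bsub>SL2 q\<^esub> x) = F x"
    and x: "x \<in> carrier (SL2 q)"
  shows "F x = F (1, 0, 0, 1)"
proof -
  have q1: "q > 1" using q by (rule prime_gt_1_int)
  interpret group "SL2 q" by (rule group_SL2[OF q1])
  note cl = upper_in_SL2[OF q1] lower_in_SL2[OF q1]
  have *: "F (a, b, c, d) = F (1, 0, 0, 1)" if y: "(a, b, c, d) \<in> carrier (SL2 q)" "\<not> q dvd c" for a b c d
  proof -
    obtain v w where "(a, b, c, d) = upper q v \<otimes>\<^bsub>SL2 q\<^esub> (lower q c \<otimes>\<^bsub>SL2 q\<^esub> upper q w)"
      using SL2_elementary_decomposition[OF q y] .
    then have "F (a, b, c, d) = F (upper q w)"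
      using U L cl m_closed by presburger
    also have "\<dots> = F (upper q w \<otimes>\<^bsub>SL2 q\<^esub> \<one>\<^bsub>SL2 q\<^esub>)" using r_one[OF cl(1)] by simp
    also have "\<dots> = F \<one>\<^bsub>SL2 q\<^esub>" by (rule U[OF one_closed])
    finally show ?thesis by simp
  qed
  obtain a b c d where [simp]: "x = (a, b, c, d)" by (cases x)
  show ?thesis
  proof (cases "q dvd c")
    case False
    then show ?thesis using * x by simp
  next
    case True
    have "lower q 1 \<otimes>\<^bsub>SL2 q\<^esub> x = mred q (a, b, a + c, b + d)"
      unfolding lower_def SL2_simps mred_mmul_left by simp
    then have l: "lower q 1 \<otimes>\<^bsub>SL2 q\<^esub> x = (a mod q, b mod q, (a + c) mod q, (b + d) mod q)" by simp
    have "\<not> q dvd (a + c) mod q"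
    proof
      assume "q dvd (a + c) mod q"
      then have "q dvd a" using True by (simp add: dvd_mod_iff dvd_add_left_iff)
      then have "q dvd a * d - b * c" using True by simp
      then show False using x by (simp add: dvd_imp_mod_0)
    qed
    moreover have "lower q 1 \<otimes>\<^bsub>SL2 q\<^esub> x \<in> carrier (SL2 q)" using cl x by (intro m_closed)
    ultimately have "F (lower q 1 \<otimes>\<^bsub>SL2 q\<^esub> x) = F (1, 0, 0, 1)" unfolding l using * by blast
    then show ?thesis using L[OF x] by simp
  qed
qed

section \<open>Eigenfunctions on SL(2,q) under the upper unitriangular subgroup\<close>

lemma bij_betw_add_mod:
  fixes q w :: int
  assumes "q > 0"
  shows "bij_betw (\<lambda>v. (v + w) mod q) {0..<q} {0..<q}"
  by (rule bij_betwI[of _ _ _ "\<lambda>v. (v - w) mod q"]) (use assms in \<open>auto simp: mod_simps\<close>)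

lemma upper_char_family:
  assumes q: "prime q"
  shows "char_family (SL2 q) {0..<q} (\<lambda>v w. (v + w) mod q) 0 (upper q) {0..<q} 0 (\<lambda>a v. ech q (a * v))"
proof -
  have q1: "q > 1" "q > 0" using prime_gt_1_int[OF q] by auto
  interpret group "SL2 q" by (rule group_SL2[OF q1(1)])
  show ?thesis
  proof unfold_locales
    show "upper q 0 = \<one>\<^bsub>SL2 q\<^esub>" using q1 by (simp add: upper_def)
    fix v w :: int
    show "upper q v \<in> carrier (SL2 q)" by (rule upper_in_SL2[OF q1(1)])
    show "bij_betw (\<lambda>v. (v + w) mod q) {0..<q} {0..<q}" by (rule bij_betw_add_mod[OF q1(2)])
    have "upper q v \<otimes>\<^bsub>SL2 q\<^esub> upper q w = mred q (1, w + v, 0, 1)"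
      unfolding upper_def SL2_simps mred_mmul_left mred_mmul_right by simp
    then show "upper q ((v + w) mod q) = upper q v \<otimes>\<^bsub>SL2 q\<^esub> upper q w"
      by (simp add: upper_def add.commute)
    fix a :: int
    have "ech q (a * ((v + w) mod q)) = ech q (a * (v + w))"
      using q1 by (intro ech_cong) (simp_all add: mod_simps)
    then show "ech q (a * ((v + w) mod q)) = ech q (a * v) * ech q (a * w)"
      by (simp add: ech_add distrib_left)
    assume "v \<in> {0..<q}" "v \<noteq> 0"
    then have "\<not> q dvd v" using zdvd_not_zless[of v q] by auto
    then show "(\<Sum>a\<in>{0..<q}. ech q (a * v)) = 0" using sum_ech q1 by blast
  qed (use q1 in auto)
qed

text \<open>A nontrivial character of the upper unitriangular subgroup occurs in the translates of the
  eigenfunction; the diagonal torus moves it to \<open>(q - 1) / 2\<close> different ones.\<close>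

lemma SL2_eigenfunction_family:
  fixes F :: "mat2 \<Rightarrow> real"
  assumes q: "prime q" and q3: "q > 2" and S: "S \<subseteq> carrier (SL2 q)"
    and eig: "\<And>x. x \<in> carrier (SL2 q) \<Longrightarrow> (\<Sum>s\<in>S. F (x \<otimes>\<^bsub>SL2 q\<^esub> s)) = \<mu> * F x"
    and sum0: "(\<Sum>x\<in>carrier (SL2 q). F x) = 0" and nz: "\<exists>x\<in>carrier (SL2 q). F x \<noteq> 0"
  obtains w :: "int \<Rightarrow> mat2 \<Rightarrow> complex" where
    "\<And>t x. t \<in> {1..(q - 1) div 2} \<Longrightarrow> x \<in> carrier (SL2 q) \<Longrightarrow>
       (\<Sum>s\<in>S. w t (x \<otimes>\<^bsub>SL2 q\<^esub> s)) = of_real \<mu> * w t x"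
    "\<And>t t'. t \<in> {1..(q - 1) div 2} \<Longrightarrow> t' \<in> {1..(q - 1) div 2} \<Longrightarrow> t \<noteq> t' \<Longrightarrow>
       (\<Sum>x\<in>carrier (SL2 q). w t x * cnj (w t' x)) = 0"
    "\<And>t. t \<in> {1..(q - 1) div 2} \<Longrightarrow> \<exists>x\<in>carrier (SL2 q). w t x \<noteq> 0"
proof -
  have q1: "q > 1" "q > 0" using prime_gt_1_int[OF q] by auto
  interpret H: char_family "SL2 q" "{0..<q}" "\<lambda>v w. (v + w) mod q" 0 "upper q" "{0..<q}" 0 "\<lambda>a v. ech q (a * v)"
    by (rule upper_char_family[OF q])
  note cl = upper_in_SL2[OF q1(1)] lower_in_SL2[OF q1(1)]
  have half: "2 * ((q - 1) div 2) \<le> q - 1" by simp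
  have upper_mod: "upper q (v mod q) = upper q v" for v by (simp add: upper_def)
  \<comment> \<open>Invariance of \<open>F\<close> under upper matrices alone would not be absurd.
    Allowing a left translate by \<open>g\<close> makes the negation cover the conjugate subgroups
    too, hence also the lower matrices, and \<open>F\<close> would be constant.\<close>
  have "\<exists>g\<in>carrier (SL2 q). \<exists>x\<in>carrier (SL2 q). \<exists>v\<in>{0..<q}.
      F (g \<otimes>\<^bsub>SL2 q\<^esub> (upper q v \<otimes>\<^bsub>SL2 q\<^esub> x)) \<noteq> F (g \<otimes>\<^bsub>SL2 q\<^esub> x)"
  proof (rule ccontr)
    assume neg: "\<not> ?thesis"
    have inv: "F (g \<otimes>\<^bsub>SL2 q\<^esub> (upper q v \<otimes>\<^bsub>SL2 q\<^esub> x)) = F (g \<otimes>\<^bsub>SL2 q\<^esub> x)"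
      if "g \<in> carrier (SL2 q)" "x \<in> carrier (SL2 q)" for g x v
    proof -
      have "v mod q \<in> {0..<q}" using q1 by simp
      then show ?thesis using neg that upper_mod[of v] by metis
    qed
    have U: "F (upper q v \<otimes>\<^bsub>SL2 q\<^esub> x) = F x" if x: "x \<in> carrier (SL2 q)" for v x
      using inv[OF H.one_closed x, of v] x cl(1)[of v] H.l_one H.m_closed by metis
    have L: "F (lower q v \<otimes>\<^bsub>SL2 q\<^esub> x) = F x" if x: "x \<in> carrier (SL2 q)" for v x
    proof -
      \<comment> \<open>The Weyl element and its inverse: conjugation takes
        \<open>upper q (- v)\<close> to \<open>lower q v\<close>.\<close>
      define g where "g = mred q (0, - 1, 1, 0)"
      define h where "h = mred q (0, 1, - 1, 0)"
      have g: "g \<in> carrier (SL2 q)" "h \<in> carrier (SL2 q)"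
        unfolding g_def h_def using q1 by (intro mred_in_SL2; simp)+
      obtain a b c d where xx: "x = (a, b, c, d)" by (cases x)
      have fx: "mred q x = x" using x by simp
      have "g \<otimes>\<^bsub>SL2 q\<^esub> (upper q (- v) \<otimes>\<^bsub>SL2 q\<^esub> (h \<otimes>\<^bsub>SL2 q\<^esub> x)) = lower q v \<otimes>\<^bsub>SL2 q\<^esub> x"
        unfolding g_def h_def upper_def lower_def SL2_simps mred_mmul_left mred_mmul_right xx
        by (simp add: algebra_simps)
      moreover have "g \<otimes>\<^bsub>SL2 q\<^esub> (h \<otimes>\<^bsub>SL2 q\<^esub> x) = x"
      proof -
        have "g \<otimes>\<^bsub>SL2 q\<^esub> (h \<otimes>\<^bsub>SL2 q\<^esub> x) = mred q x"
          unfolding g_def h_def SL2_simps mred_mmul_left mred_mmul_right xx by simp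
        then show ?thesis using fx by simp
      qed
      ultimately show ?thesis using inv[OF g(1) H.m_closed[OF g(2) x], of "- v"] by simp
    qed
    have const: "F x = F (1, 0, 0, 1)" if "x \<in> carrier (SL2 q)" for x
      using SL2_function_constant[OF q, of F] U L that by blast
    have "(\<Sum>x\<in>carrier (SL2 q). F x) = (\<Sum>x\<in>carrier (SL2 q). F (1, 0, 0, 1))"
      by (intro sum.cong refl const)
    then have "(\<Sum>x\<in>carrier (SL2 q). F x) = real (card (carrier (SL2 q))) * F (1, 0, 0, 1)"
      by (simp only: sum_constant)
    moreover have "card (carrier (SL2 q)) \<noteq> 0"
      using finite_SL2[OF q1(2)] H.one_closed by (metis card_0_eq empty_iff)
    ultimately have "F (1, 0, 0, 1) = 0" using sum0 by simp
    then show False using nz const by auto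
  qed
  then obtain g x0 v0 where g: "g \<in> carrier (SL2 q)" and x0: "x0 \<in> carrier (SL2 q)" and v0: "v0 \<in> {0..<q}"
    and neq: "F (g \<otimes>\<^bsub>SL2 q\<^esub> (upper q v0 \<otimes>\<^bsub>SL2 q\<^esub> x0)) \<noteq> F (g \<otimes>\<^bsub>SL2 q\<^esub> x0)" by blast
  define f where "f x = complex_of_real (F (g \<otimes>\<^bsub>SL2 q\<^esub> x))" for x
  have feig: "(\<Sum>s\<in>S. f (x \<otimes>\<^bsub>SL2 q\<^esub> s)) = of_real \<mu> * f x" if x: "x \<in> carrier (SL2 q)" for x
  proof -
    have "(\<Sum>s\<in>S. F (g \<otimes>\<^bsub>SL2 q\<^esub> (x \<otimes>\<^bsub>SL2 q\<^esub> s))) = (\<Sum>s\<in>S. F ((g \<otimes>\<^bsub>SL2 q\<^esub> x) \<otimes>\<^bsub>SL2 q\<^esub> s))"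
      by (simp add: mmul_assoc)
    also have "\<dots> = \<mu> * F (g \<otimes>\<^bsub>SL2 q\<^esub> x)" by (rule eig[OF H.m_closed[OF g x]])
    finally show ?thesis unfolding f_def of_real_sum[symmetric] by simp
  qed
  have fneq: "f (upper q v0 \<otimes>\<^bsub>SL2 q\<^esub> x0) \<noteq> f x0"
    using neq unfolding f_def of_real_eq_iff .
  obtain a y where a: "a \<in> {0..<q}" "a \<noteq> 0" and y: "y \<in> carrier (SL2 q)" "H.component a f y \<noteq> 0"
    by (rule H.nontrivial_component[OF x0 v0 fneq])
  have "\<not> q dvd a" using a zdvd_not_zless[of a q] by auto
  define e where "e t = (SOME e. (t * e) mod q = 1)" for t
  define D where "D t = mred q (t, 0, 0, e t)" for t
  have e: "(t * e t) mod q = 1" and D: "D t \<in> carrier (SL2 q)" if "t \<in> {1..(q - 1) div 2}" for t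
  proof -
    have "\<not> q dvd t" using that half zdvd_not_zless[of t q] by simp
    then obtain b where "(t * b) mod q = 1" using mod_inverse_exists[OF q] by blast
    then show e: "(t * e t) mod q = 1" unfolding e_def by (rule someI)
    show "D t \<in> carrier (SL2 q)" unfolding D_def by (rule mred_in_SL2[OF q1(1)]) (simp add: e)
  qed
  define w where "w t x = H.component a f (D t \<otimes>\<^bsub>SL2 q\<^esub> x)" for t x
  have shift: "w t (upper q 1 \<otimes>\<^bsub>SL2 q\<^esub> x) = ech q (a * (t * t)) * w t x"
    if t: "t \<in> {1..(q - 1) div 2}" and x: "x \<in> carrier (SL2 q)" for t x
  proof -
    obtain x1 x2 x3 x4 where xx: "x = (x1, x2, x3, x4)" by (cases x)
    have "(t * e t) mod q = 1 mod q" using e[OF t] q1 by simp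
    then have "q dvd t * e t - 1" by (simp only: mod_eq_dvd_iff)
    then obtain k where "t * e t - 1 = q * k" by (elim dvdE)
    then have k: "t * e t = 1 + q * k" by simp
    have "D t \<otimes>\<^bsub>SL2 q\<^esub> (upper q 1 \<otimes>\<^bsub>SL2 q\<^esub> x) = mred q (mmul (mmul (t, 0, 0, e t) (1, 1, 0, 1)) x)"
      unfolding D_def upper_def SL2_simps mred_mmul_left mred_mmul_right mmul_assoc ..
    also have "\<dots> = mred q (mmul (mred q (t, t, 0, e t)) x)" unfolding mred_mmul_left by simp
    also have "mred q (t, t, 0, e t) = mred q (t, t * t * e t, 0, e t)"
    proof (rule mred_eqI)
      have "t - t * t * e t = t - t * (t * e t)" by simp
      also have "\<dots> = q * (- (t * k))" unfolding k by (simp add: algebra_simps)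
      finally show "q dvd t - t * t * e t" by simp
    qed simp_all
    also have "mred q (mmul (mred q (t, t * t * e t, 0, e t)) x)
        = mred q (mmul (mmul (1, t * t, 0, 1) (t, 0, 0, e t)) x)" unfolding mred_mmul_left by simp
    also have "\<dots> = upper q (t * t) \<otimes>\<^bsub>SL2 q\<^esub> (D t \<otimes>\<^bsub>SL2 q\<^esub> x)"
      unfolding D_def upper_def SL2_simps mred_mmul_left mred_mmul_right mmul_assoc ..
    also have "upper q (t * t) = upper q ((t * t) mod q)" by (simp add: upper_mod)
    finally have "w t (upper q 1 \<otimes>\<^bsub>SL2 q\<^esub> x)
        = H.component a f (upper q ((t * t) mod q) \<otimes>\<^bsub>SL2 q\<^esub> (D t \<otimes>\<^bsub>SL2 q\<^esub> x))" by (simp add: w_def)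
    also have "\<dots> = ech q (a * ((t * t) mod q)) * w t x"
      unfolding w_def by (rule H.component_translate) (use a q1 D[OF t] x H.m_closed in \<open>auto simp del: SL2_simps\<close>)
    also have "ech q (a * ((t * t) mod q)) = ech q (a * (t * t))"
      using q1 by (intro ech_cong) (simp_all add: mod_simps)
    finally show ?thesis .
  qed
  show thesis
  proof (rule that[of w])
    fix t x assume t: "t \<in> {1..(q - 1) div 2}" and x: "x \<in> carrier (SL2 q)"
    have "(\<Sum>s\<in>S. w t (x \<otimes>\<^bsub>SL2 q\<^esub> s)) = (\<Sum>s\<in>S. H.component a f ((D t \<otimes>\<^bsub>SL2 q\<^esub> x) \<otimes>\<^bsub>SL2 q\<^esub> s))"
      unfolding w_def by (simp add: mmul_assoc)
    also have "\<dots> = of_real \<mu> * H.component a f (D t \<otimes>\<^bsub>SL2 q\<^esub> x)"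
      by (rule H.component_eigenfunction[OF S feig]) (use D[OF t] x H.m_closed in \<open>auto simp del: SL2_simps\<close>)
    finally show "(\<Sum>s\<in>S. w t (x \<otimes>\<^bsub>SL2 q\<^esub> s)) = of_real \<mu> * w t x" by (simp add: w_def)
  next
    fix t t' assume t: "t \<in> {1..(q - 1) div 2}" "t' \<in> {1..(q - 1) div 2}" "t \<noteq> t'"
    have "ech q (a * (t * t)) * cnj (ech q (a * (t' * t'))) = ech q (a * ((t - t') * (t + t')))"
      by (simp add: cnj_ech ech_add[symmetric] algebra_simps)
    \<comment> \<open>The range of \<open>t\<close> keeps both \<open>t - t'\<close> and
      \<open>t + t'\<close> from being divisible by \<open>q\<close>, so the squares are distinct
      modulo \<open>q\<close>.\<close>
    moreover have "\<not> q dvd a * ((t - t') * (t + t'))"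
    proof -
      have "\<not> q dvd t - t'"
      proof
        assume "q dvd t - t'"
        then have "q \<le> \<bar>t - t'\<bar>" using t(3) dvd_imp_le_int[of "t - t'" q] q1 by simp
        then show False using t by auto
      qed
      moreover have "\<not> q dvd t + t'" using t half zdvd_not_zless[of "t + t'" q] by simp
      ultimately show ?thesis using \<open>\<not> q dvd a\<close> q by (simp add: prime_dvd_mult_iff)
    qed
    ultimately have "ech q (a * (t * t)) * cnj (ech q (a * (t' * t'))) \<noteq> 1"
      using q1 by (simp add: ech_eq_1_iff)
    then show "(\<Sum>x\<in>carrier (SL2 q). w t x * cnj (w t' x)) = 0"
      using shift t by (intro H.orthogonal_translation_eigenfunctions[OF cl(1)]) blast+
  next
    fix t assume t: "t \<in> {1..(q - 1) div 2}"
    have "inv\<^bsub>SL2 q\<^esub> (D t) \<otimes>\<^bsub>SL2 q\<^esub> y \<in> carrier (SL2 q)"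
      using D[OF t] y(1) by (intro H.m_closed H.inv_closed)
    moreover have "D t \<otimes>\<^bsub>SL2 q\<^esub> (inv\<^bsub>SL2 q\<^esub> (D t) \<otimes>\<^bsub>SL2 q\<^esub> y) = y"
      using D[OF t] y(1) H.m_assoc H.inv_closed H.r_inv H.l_one by metis
    ultimately show "\<exists>x\<in>carrier (SL2 q). w t x \<noteq> 0" using y(2) unfolding w_def by metis
  qed
qed

section \<open>The spectral gap of SL(2,q)\<close>

text \<open>The Chebyshev-like polynomials of the 18-regular tree: applied to the adjacency
  operator, the one of degree \<open>m\<close> sums over walks of length \<open>m\<close> without
  backtracking. The 18 occurs once because the empty word has 18 one-letter extensions.\<close>

fun walk_poly :: "real \<Rightarrow> nat \<Rightarrow> real" where
  "walk_poly x 0 = 1"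
| "walk_poly x (Suc 0) = x"
| "walk_poly x (Suc (Suc m)) = x * walk_poly x (Suc m) - (if m = 0 then 18 else 17) * walk_poly x m"

text \<open>The larger root of \<open>t^2 - 16.11 * t + 17\<close> is about 14.975; the ratio 14.97
  below it reproduces itself, since \<open>17 / 14.97 \<le> 16.11 - 14.97\<close>.\<close>

lemma walk_poly_growth:
  assumes x: "x \<ge> 1611 / 100"
  shows "walk_poly x m > 0 \<and> walk_poly x (Suc m) \<ge> 1497 / 100 * walk_poly x m"
proof (induction m)
  case 0
  then show ?case using x by simp
next
  case (Suc m)
  then have pos: "walk_poly x (Suc m) > 0" by linarith
  have "walk_poly x (Suc (Suc m)) \<ge> 1497 / 100 * walk_poly x (Suc m)"
  proof (cases "m = 0")
    case True
    \<comment> \<open>The first step subtracts 18, and \<open>16.11 * 1.14\<close> is about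
      18.37.\<close>
    have "x * (x - 1497 / 100) \<ge> 1611 / 100 * (114 / 100)" using x by (intro mult_mono) auto
    then show ?thesis using True by (simp add: algebra_simps)
  next
    case False
    have "17 * walk_poly x m \<le> (114 / 100) * walk_poly x (Suc m)" using conjunct2[OF Suc.IH] conjunct1[OF Suc.IH] by linarith
    moreover have "1611 / 100 * walk_poly x (Suc m) \<le> x * walk_poly x (Suc m)" using x pos by (intro mult_right_mono) auto
    ultimately show ?thesis using False by simp
  qed
  then show ?case using pos by simp
qed

lemma walk_poly_lower_bound:
  assumes x: "x \<ge> 1611 / 100"
  shows "walk_poly x m \<ge> (1497 / 100) ^ m"
proof (induction m)
  case (Suc m)
  then show ?case using walk_poly_growth[OF x, of m] by simp
qed simp

section \<open>Sums over reduced words\<close>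

definition rwords :: "nat \<Rightarrow> quat list set" where
  "rwords m = {w. reduced w \<and> length w = m}"

definition letters :: "quat list \<Rightarrow> quat set" where
  "letters v = {s \<in> lps. v = [] \<or> hd v \<noteq> qcnj s}"

lemma rwords_0 [simp]: "rwords 0 = {[]}"
  by (auto simp: rwords_def)

text \<open>\<open>0\<close> is not a letter, so as forbidden head it excludes nothing; all reduced
  words are covered by the collision count with \<open>e = 0\<close>.\<close>

lemma words_zero: "words 0 m = rwords m"
proof -
  have "0 \<notin> lps" using lps_qnorm by (force simp: qnorm_def zero_quat_def)
  then have "hd w \<noteq> 0" if "reduced w" "w \<noteq> []" for w
    using that by (cases w) (auto simp: reduced_Cons)
  then show ?thesis by (auto simp: words_def rwords_def)
qed

lemma finite_rwords [simp]: "finite (rwords m)"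
  unfolding words_zero[symmetric] by simp

lemma finite_letters [simp]: "finite (letters v)"
  by (simp add: letters_def)

lemma rwords_Suc: "rwords (Suc m) = (\<lambda>(v, s). s # v) ` (SIGMA v:rwords m. letters v)"
proof (intro equalityI subsetI)
  fix w assume "w \<in> rwords (Suc m)"
  then obtain s v where w: "w = s # v" "reduced (s # v)" "length v = m"
    by (cases w) (auto simp: rwords_def)
  then have "(v, s) \<in> (SIGMA v:rwords m. letters v)"
    by (auto simp: rwords_def letters_def reduced_Cons)
  then show "w \<in> (\<lambda>(v, s). s # v) ` (SIGMA v:rwords m. letters v)" using w by force
qed (auto simp: rwords_def letters_def reduced_Cons)

lemma sum_rwords_Suc: "(\<Sum>w\<in>rwords (Suc m). g w) = (\<Sum>v\<in>rwords m. \<Sum>s\<in>letters v. g (s # v))"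
proof -
  have "(\<Sum>w\<in>rwords (Suc m). g w) = (\<Sum>p\<in>(SIGMA v:rwords m. letters v). g (snd p # fst p))"
    unfolding rwords_Suc by (subst sum.reindex) (auto simp: inj_on_def case_prod_beta)
  then show ?thesis by (simp add: sum.Sigma case_prod_beta)
qed

lemma letters_Cons: "s \<in> lps \<Longrightarrow> letters (s # v) = lps - {qcnj s}"
  by (auto simp: letters_def)

lemma card_letters: "v \<in> rwords m \<Longrightarrow> card (letters v) = (if m = 0 then 18 else 17)"
proof (cases v)
  case Nil
  then show "v \<in> rwords m \<Longrightarrow> card (letters v) = (if m = 0 then 18 else 17)"
    by (auto simp: rwords_def letters_def card_lps)
next
  case (Cons s u)
  then show "v \<in> rwords m \<Longrightarrow> card (letters v) = (if m = 0 then 18 else 17)"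
    by (auto simp: rwords_def reduced_Cons letters_Cons card_lps)
qed

lemma (in group) sum_translate:
  assumes h: "h \<in> carrier G"
  shows "(\<Sum>x\<in>carrier G. f (h \<otimes> x)) = (\<Sum>x\<in>carrier G. f x)"
proof -
  have "bij_betw (\<lambda>x. h \<otimes> x) (carrier G) (carrier G)"
    using h inj_on_cmult surj_const_mult by (auto simp: bij_betw_def)
  then show ?thesis by (rule sum.reindex_bij_betw)
qed

text \<open>\<open>I\<close> is a square root of -1 and \<open>r\<close> an inverse square root of
  17 modulo \<open>q\<close>. The bound 100 keeps the letters distinct, makes small constants such
  as 2, 17 and 64 units, and later makes a mean value small.\<close>

locale lps_prime =
  fixes q I r :: int
  assumes prime_q: "prime q" and q_gt: "q > 100"
    and I_square: "q dvd I\<^sup>2 + 1" and r_square: "q dvd 17 * r\<^sup>2 - 1"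
begin

lemma q1: "q > 1" "q > 0"
  using q_gt by auto

sublocale H: group "SL2 q"
  by (rule group_SL2[OF q1(1)])

text \<open>The quaternion units act as \<open>i = diag(I, -I)\<close> and \<open>j = (0, 1; -1, 0)\<close>, and \<open>r\<close> is an inverse
  square root of 17, so an element of norm \<open>17 ^ m\<close> gets determinant 1.\<close>

definition lmat :: "nat \<Rightarrow> quat \<Rightarrow> mat2" where
  "lmat m x = mred q (r ^ m * (q0 x + I * q1 x), r ^ m * (q2 x + I * q3 x),
     r ^ m * (I * q3 x - q2 x), r ^ m * (q0 x - I * q1 x))"

abbreviation "rho \<equiv> lmat 1"

lemma lmat_mult: "lmat m x \<otimes>\<^bsub>SL2 q\<^esub> lmat n y = lmat (m + n) (x * y)"
proof -
  \<comment> \<open>\<open>k\<close> records the error in \<open>I * I = - 1\<close> over the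
    integers; each matrix entry then matches exactly up to an explicit multiple of
    \<open>q\<close>.\<close>
  obtain k where k: "I\<^sup>2 + 1 = q * k" using I_square by (elim dvdE)
  then have II: "I * I = q * k - 1" by (simp add: power2_eq_square)
  have IIx: "I * (I * z) = (q * k - 1) * z" for z
    by (simp only: mult.assoc[symmetric] II)
  show ?thesis
    unfolding lmat_def SL2_simps mred_mmul_left mred_mmul_right mmul.simps
  proof (rule mred_eqI)
    let ?a = "q0 x" and ?b = "q1 x" and ?c = "q2 x" and ?d = "q3 x"
    let ?e = "q0 y" and ?f = "q1 y" and ?g = "q2 y" and ?h = "q3 y"
    have "r ^ m * (?a + I * ?b) * (r ^ n * (?e + I * ?f)) + r ^ m * (?c + I * ?d) * (r ^ n * (I * ?h - ?g))
        - r ^ (m + n) * (q0 (x * y) + I * q1 (x * y)) = q * (r ^ (m + n) * (k * (?b * ?f + ?d * ?h)))"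
      by (simp add: power_add times_quat_def algebra_simps IIx)
    then show "q dvd r ^ m * (?a + I * ?b) * (r ^ n * (?e + I * ?f)) + r ^ m * (?c + I * ?d) * (r ^ n * (I * ?h - ?g))
        - r ^ (m + n) * (q0 (x * y) + I * q1 (x * y))" by simp
    have "r ^ m * (?a + I * ?b) * (r ^ n * (?g + I * ?h)) + r ^ m * (?c + I * ?d) * (r ^ n * (?e - I * ?f))
        - r ^ (m + n) * (q2 (x * y) + I * q3 (x * y)) = q * (r ^ (m + n) * (k * (?b * ?h - ?d * ?f)))"
      by (simp add: power_add times_quat_def algebra_simps IIx)
    then show "q dvd r ^ m * (?a + I * ?b) * (r ^ n * (?g + I * ?h)) + r ^ m * (?c + I * ?d) * (r ^ n * (?e - I * ?f))
        - r ^ (m + n) * (q2 (x * y) + I * q3 (x * y))" by simp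
    have "r ^ m * (I * ?d - ?c) * (r ^ n * (?e + I * ?f)) + r ^ m * (?a - I * ?b) * (r ^ n * (I * ?h - ?g))
        - r ^ (m + n) * (I * q3 (x * y) - q2 (x * y)) = q * (r ^ (m + n) * (k * (?d * ?f - ?b * ?h)))"
      by (simp add: power_add times_quat_def algebra_simps IIx)
    then show "q dvd r ^ m * (I * ?d - ?c) * (r ^ n * (?e + I * ?f)) + r ^ m * (?a - I * ?b) * (r ^ n * (I * ?h - ?g))
        - r ^ (m + n) * (I * q3 (x * y) - q2 (x * y))" by simp
    have "r ^ m * (I * ?d - ?c) * (r ^ n * (?g + I * ?h)) + r ^ m * (?a - I * ?b) * (r ^ n * (?e - I * ?f))
        - r ^ (m + n) * (q0 (x * y) - I * q1 (x * y)) = q * (r ^ (m + n) * (k * (?b * ?f + ?d * ?h)))"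
      by (simp add: power_add times_quat_def algebra_simps IIx)
    then show "q dvd r ^ m * (I * ?d - ?c) * (r ^ n * (?g + I * ?h)) + r ^ m * (?a - I * ?b) * (r ^ n * (?e - I * ?f))
        - r ^ (m + n) * (q0 (x * y) - I * q1 (x * y))" by simp
  qed
qed

lemma r_power_mod: "[(17 * r\<^sup>2) ^ m = 1] (mod q)"
proof -
  have "[17 * r\<^sup>2 = 1] (mod q)" using r_square by (simp add: cong_iff_dvd_diff)
  then have "[(17 * r\<^sup>2) ^ m = 1 ^ m] (mod q)" by (rule cong_pow)
  then show ?thesis by simp
qed

lemma lmat_carrier:
  assumes "qnorm x = 17 ^ m"
  shows "lmat m x \<in> carrier (SL2 q)"
  unfolding lmat_def
proof (rule mred_in_SL2[OF q1(1)])
  let ?M = "(r ^ m * (q0 x + I * q1 x), r ^ m * (q2 x + I * q3 x),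
     r ^ m * (I * q3 x - q2 x), r ^ m * (q0 x - I * q1 x))"
  have "mdet ?M = r ^ m * r ^ m * (qnorm x - (I\<^sup>2 + 1) * ((q1 x)\<^sup>2 + (q3 x)\<^sup>2))"
    by (simp add: qnorm_def power2_eq_square algebra_simps)
  also have "\<dots> = (17 * r\<^sup>2) ^ m - (I\<^sup>2 + 1) * (r ^ m * r ^ m * ((q1 x)\<^sup>2 + (q3 x)\<^sup>2))"
    unfolding assms by (simp add: power_mult_distrib power2_eq_square algebra_simps)
  finally have "[mdet ?M = 1 - 0] (mod q)"
    using r_power_mod I_square by (simp only: cong_diff cong_0_iff dvd_mult2)
  then have "q dvd mdet ?M - 1" by (simp only: cong_iff_dvd_diff diff_zero)
  then have "mdet ?M mod q = 1 mod q" by (simp only: mod_eq_dvd_iff)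
  then show "mdet ?M mod q = 1" using q1 by (simp del: mdet.simps)
qed

lemma lmat_0_one [simp]: "lmat 0 1 = (1, 0, 0, 1)"
  using q1 by (simp add: lmat_def one_quat_def)

text \<open>Since 2, \<open>I\<close> and \<open>r\<close> are units modulo \<open>q\<close>, sums
  and differences of the entries recover all four coordinates. Words with equal matrices are
  therefore collisions.\<close>

lemma lmat_inj:
  assumes "lmat m x = lmat m y"
  shows "qdvd q (x - y)"
proof -
  have nI: "\<not> q dvd I" 
  proof
    assume "q dvd I"
    then have "q dvd I\<^sup>2 + 1 - I * I" using I_square by (intro dvd_diff) auto
    then show False using q1 by (simp add: power2_eq_square)
  qed
  have nr: "\<not> q dvd r ^ m"
  proof
    assume "q dvd r ^ m"
    then have "q dvd r" using prime_q prime_dvd_power by blast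
    then have "q dvd 17 * r\<^sup>2" by (simp add: power2_eq_square)
    then have "q dvd 17 * r\<^sup>2 - (17 * r\<^sup>2 - 1)" using r_square by (rule dvd_diff)
    then show False using q1 by simp
  qed
  have n2: "\<not> q dvd 2" using q_gt zdvd_imp_le[of q 2] by auto
  have canc: "q dvd z" if "q dvd r ^ m * z" for z
    using that nr prime_q by (simp add: prime_dvd_mult_iff)
  define z where "z = x - y"
  have zc: "q0 z = q0 x - q0 y" "q1 z = q1 x - q1 y" "q2 z = q2 x - q2 y" "q3 z = q3 x - q3 y"
    by (simp_all add: z_def minus_quat_def)
  have "q dvd r ^ m * (q0 z + I * q1 z)" "q dvd r ^ m * (q2 z + I * q3 z)"
    "q dvd r ^ m * (I * q3 z - q2 z)" "q dvd r ^ m * (q0 z - I * q1 z)"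
    using assms by (simp_all add: lmat_def mod_eq_dvd_iff zc algebra_simps)
  then have d: "q dvd q0 z + I * q1 z" "q dvd q2 z + I * q3 z" "q dvd I * q3 z - q2 z" "q dvd q0 z - I * q1 z"
    using canc by blast+
  have "q dvd 2 * q0 z" using dvd_add[OF d(1) d(4)] by simp
  moreover have "q dvd 2 * I * q1 z" using dvd_diff[OF d(1) d(4)] by (simp add: algebra_simps)
  moreover have "q dvd 2 * q2 z" using dvd_diff[OF d(2) d(3)] by simp
  moreover have "q dvd 2 * I * q3 z" using dvd_add[OF d(2) d(3)] by (simp add: algebra_simps)
  ultimately have "q dvd q0 z" "q dvd q1 z" "q dvd q2 z" "q dvd q3 z"
    using n2 nI prime_q by (simp_all add: prime_dvd_mult_iff)
  then show ?thesis by (simp add: qdvd_def z_def)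
qed

lemma rho_carrier: "s \<in> lps \<Longrightarrow> rho s \<in> carrier (SL2 q)"
  using lmat_carrier[of s 1] lps_qnorm by (simp del: SL2_simps)

lemma rho_qcnj_left: 
  assumes s: "s \<in> lps"
  shows "rho (qcnj s) \<otimes>\<^bsub>SL2 q\<^esub> rho s = \<one>\<^bsub>SL2 q\<^esub>"
proof -
  have "rho (qcnj s) \<otimes>\<^bsub>SL2 q\<^esub> rho s = lmat 2 (of_int 17)"
    unfolding lmat_mult by (simp add: qcnj_mult_self lps_qnorm[OF s] numeral_2_eq_2)
  also have "\<dots> = mred q (1, 0, 0, 1)"
    unfolding lmat_def of_int_quat
    by (rule mred_eqI) (use r_square in \<open>simp_all add: mult.commute\<close>)
  finally show ?thesis using q1 by simp
qed

section \<open>Words evaluated in SL(2,q) and their action on eigenfunctions\<close>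

definition wmat :: "quat list \<Rightarrow> mat2" where
  "wmat w = lmat (length w) (prod_list w)"

lemma wmat_Nil [simp]: "wmat [] = (1, 0, 0, 1)"
  by (simp add: wmat_def)

lemma wmat_Cons: "wmat (s # w) = rho s \<otimes>\<^bsub>SL2 q\<^esub> wmat w"
  unfolding wmat_def lmat_mult by simp

lemma wmat_carrier: "set w \<subseteq> lps \<Longrightarrow> wmat w \<in> carrier (SL2 q)"
  unfolding wmat_def by (intro lmat_carrier qnorm_prod_list)

lemma wmat_cancel: 
  assumes "s \<in> lps" "set w \<subseteq> lps"
  shows "wmat (qcnj s # s # w) = wmat w"
proof -
  have "wmat (qcnj s # s # w) = rho (qcnj s) \<otimes>\<^bsub>SL2 q\<^esub> rho s \<otimes>\<^bsub>SL2 q\<^esub> wmat w"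
    unfolding wmat_Cons by (simp add: mmul_assoc)
  also have "\<dots> = wmat w" 
    unfolding rho_qcnj_left[OF assms(1)] by (rule H.l_one[OF wmat_carrier[OF assms(2)]])
  finally show ?thesis .
qed

lemma rwords_subset: "w \<in> rwords m \<Longrightarrow> set w \<subseteq> lps"
  by (simp add: rwords_def reduced_def)

text \<open>Prefixing a letter to a reduced word of length \<open>m + 1\<close> gives a reduced
  word, or cancels its head and leaves its tail. Hence the sums over reduced words satisfy the
  recurrence of \<open>walk_poly\<close>.\<close>

lemma walk_poly_eigenfunction:
  fixes F :: "mat2 \<Rightarrow> complex"
  assumes eig: "\<And>h. h \<in> carrier (SL2 q) \<Longrightarrow> (\<Sum>s\<in>lps. F (h \<otimes>\<^bsub>SL2 q\<^esub> rho s)) = of_real \<mu> * F h"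
    and h: "h \<in> carrier (SL2 q)"
  shows "(\<Sum>w\<in>rwords m. F (h \<otimes>\<^bsub>SL2 q\<^esub> wmat w)) = of_real (walk_poly \<mu> m) * F h"
proof -
  define E where "E m h = (\<Sum>w\<in>rwords m. F (h \<otimes>\<^bsub>SL2 q\<^esub> wmat w))" for m h
  have step: "(\<Sum>s\<in>lps. E (Suc m) (h \<otimes>\<^bsub>SL2 q\<^esub> rho s))
      = E (Suc (Suc m)) h + (if m = 0 then 18 else 17) * E m h" for m h
  proof -
    define f where "f w = F (h \<otimes>\<^bsub>SL2 q\<^esub> wmat w)" for w
    have "(\<Sum>s\<in>lps. E (Suc m) (h \<otimes>\<^bsub>SL2 q\<^esub> rho s)) = (\<Sum>s\<in>lps. \<Sum>v\<in>rwords (Suc m). f (s # v))"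
      unfolding E_def f_def wmat_Cons by (simp add: mmul_assoc)
    also have "\<dots> = (\<Sum>v\<in>rwords (Suc m). \<Sum>s\<in>lps. f (s # v))" by (rule sum.swap)
    also have "\<dots> = (\<Sum>v\<in>rwords (Suc m). (\<Sum>s\<in>letters v. f (s # v)) + f (tl v))"
    proof (rule sum.cong[OF refl])
      fix v assume v: "v \<in> rwords (Suc m)"
      then obtain t u where tu: "v = t # u" "t \<in> lps" "set u \<subseteq> lps"
        using rwords_subset[OF v] by (cases v) (auto simp: rwords_def)
      have "(\<Sum>s\<in>lps. f (s # v)) = f (qcnj t # v) + (\<Sum>s\<in>lps - {qcnj t}. f (s # v))"
        using tu by (intro sum.remove) auto
      moreover have "f (qcnj t # v) = f u"
        unfolding f_def tu(1) wmat_cancel[OF tu(2,3)] ..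
      ultimately show "(\<Sum>s\<in>lps. f (s # v)) = (\<Sum>s\<in>letters v. f (s # v)) + f (tl v)"
        using tu by (simp add: letters_Cons)
    qed
    also have "\<dots> = E (Suc (Suc m)) h + (\<Sum>v\<in>rwords (Suc m). f (tl v))"
      by (simp add: sum.distrib E_def f_def sum_rwords_Suc)
    \<comment> \<open>Each \<open>u\<close> is the tail of one word for every element of
      \<open>letters u\<close>.\<close>
    also have "(\<Sum>v\<in>rwords (Suc m). f (tl v)) = (\<Sum>u\<in>rwords m. of_nat (card (letters u)) * f u)"
      by (simp add: sum_rwords_Suc)
    also have "\<dots> = (if m = 0 then 18 else 17) * E m h"
      unfolding E_def f_def sum_distrib_left by (intro sum.cong refl) (simp add: card_letters)
    finally show ?thesis .
  qed
  have main: "(\<forall>h\<in>carrier (SL2 q). E m h = of_real (walk_poly \<mu> m) * F h)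
    \<and> (\<forall>h\<in>carrier (SL2 q). E (Suc m) h = of_real (walk_poly \<mu> (Suc m)) * F h)" for m
  proof (induction m)
    case 0
    have 0: "E 0 h = F h" if "h \<in> carrier (SL2 q)" for h
      using H.r_one[OF that] by (simp add: E_def)
    have "E (Suc 0) h = (\<Sum>s\<in>lps. F (h \<otimes>\<^bsub>SL2 q\<^esub> rho s))" for h
    proof -
      have "E (Suc 0) h = (\<Sum>s\<in>letters []. F (h \<otimes>\<^bsub>SL2 q\<^esub> wmat [s]))"
        unfolding E_def sum_rwords_Suc by simp
      also have "\<dots> = (\<Sum>s\<in>lps. F (h \<otimes>\<^bsub>SL2 q\<^esub> rho s))"
        by (intro sum.cong) (auto simp: letters_def wmat_def simp del: SL2_simps)
      finally show ?thesis .
    qed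
    then show ?case using 0 eig by (simp del: SL2_simps)
  next
    case (Suc m)
    have "E (Suc (Suc m)) h = of_real (walk_poly \<mu> (Suc (Suc m))) * F h" if h: "h \<in> carrier (SL2 q)" for h
    proof -
      have "(\<Sum>s\<in>lps. E (Suc m) (h \<otimes>\<^bsub>SL2 q\<^esub> rho s))
          = (\<Sum>s\<in>lps. of_real (walk_poly \<mu> (Suc m)) * F (h \<otimes>\<^bsub>SL2 q\<^esub> rho s))"
        using Suc.IH H.m_closed[OF h rho_carrier] by (intro sum.cong refl) blast
      also have "\<dots> = of_real (walk_poly \<mu> (Suc m)) * (of_real \<mu> * F h)"
        unfolding sum_distrib_left[symmetric] eig[OF h] ..
      finally show ?thesis using step[of m h] Suc.IH h by (simp add: algebra_simps del: SL2_simps)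
    qed
    then show ?case using Suc.IH by blast
  qed
  then show ?thesis using h unfolding E_def by blast
qed

text \<open>Bessel's inequality for the row of the matrix of the operator \<open>walk_poly \<mu> m\<close> at each group
  element, summed over the group.\<close>

lemma eigenfunction_family_bound:
  fixes w :: "'x \<Rightarrow> mat2 \<Rightarrow> complex"
  assumes X: "finite X"
    and eig: "\<And>t x. t \<in> X \<Longrightarrow> x \<in> carrier (SL2 q) \<Longrightarrow> (\<Sum>s\<in>lps. w t (x \<otimes>\<^bsub>SL2 q\<^esub> rho s)) = of_real \<mu> * w t x"
    and orth: "\<And>t t'. t \<in> X \<Longrightarrow> t' \<in> X \<Longrightarrow> t \<noteq> t' \<Longrightarrow> (\<Sum>x\<in>carrier (SL2 q). w t x * cnj (w t' x)) = 0"
    and nz: "\<And>t. t \<in> X \<Longrightarrow> \<exists>x\<in>carrier (SL2 q). w t x \<noteq> 0"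
  shows "real (card X) * (walk_poly \<mu> m)\<^sup>2 \<le> real (card (carrier (SL2 q))) * real (card (collisions q 0 m))"
proof -
  let ?C = "carrier (SL2 q)"
  have fin: "finite ?C" by (rule finite_SL2[OF q1(2)])
  define N where "N t = (\<Sum>x\<in>?C. (cmod (w t x))\<^sup>2)" for t
  have Npos: "N t > 0" if t: "t \<in> X" for t
  proof -
    obtain x where "x \<in> ?C" "w t x \<noteq> 0" using nz[OF t] by blast
    then show ?thesis unfolding N_def using fin by (intro sum_pos2[of _ x]) auto
  qed
  note trans = H.sum_translate
  \<comment> \<open>The kernel of the walk operator: the number of reduced words that evaluate to
    \<open>g\<close>.\<close>
  define M where "M g = card {v \<in> rwords m. wmat v = g}" for g
  have row: "(\<Sum>t\<in>X. (walk_poly \<mu> m)\<^sup>2 * (cmod (w t h))\<^sup>2 / N t) \<le> (\<Sum>g\<in>?C. (real (M g))\<^sup>2)" if h: "h \<in> ?C" for h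
  proof -
    have "(\<Sum>g\<in>?C. of_nat (M g) * cnj (cnj (w t (h \<otimes>\<^bsub>SL2 q\<^esub> g)))) = of_real (walk_poly \<mu> m) * w t h" if t: "t \<in> X" for t
    proof -
      have "(\<Sum>g\<in>?C. of_nat (M g) * w t (h \<otimes>\<^bsub>SL2 q\<^esub> g))
          = (\<Sum>g\<in>?C. \<Sum>v\<in>{v \<in> rwords m. wmat v = g}. w t (h \<otimes>\<^bsub>SL2 q\<^esub> wmat v))"
        by (intro sum.cong refl) (simp add: M_def)
      also have "\<dots> = (\<Sum>v\<in>rwords m. w t (h \<otimes>\<^bsub>SL2 q\<^esub> wmat v))"
        using fin wmat_carrier rwords_subset by (intro sum.group) auto
      also have "\<dots> = of_real (walk_poly \<mu> m) * w t h"
        by (rule walk_poly_eigenfunction[OF eig[OF t] h])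
      finally show ?thesis by simp
    qed
    moreover have "(\<Sum>t\<in>X. (cmod (\<Sum>g\<in>?C. of_nat (M g) * cnj (cnj (w t (h \<otimes>\<^bsub>SL2 q\<^esub> g)))))\<^sup>2
        / (\<Sum>g\<in>?C. (cmod (cnj (w t (h \<otimes>\<^bsub>SL2 q\<^esub> g))))\<^sup>2)) \<le> (\<Sum>g\<in>?C. (cmod (of_nat (M g)))\<^sup>2)"
    proof (rule bessel_inequality[OF fin X])
      fix t t' assume "t \<in> X" "t' \<in> X" "t \<noteq> t'"
      then have "(\<Sum>x\<in>?C. cnj (w t x * cnj (w t' x))) = 0" using orth by (metis cnj_sum complex_cnj_zero)
      then show "(\<Sum>g\<in>?C. cnj (w t (h \<otimes>\<^bsub>SL2 q\<^esub> g)) * cnj (cnj (w t' (h \<otimes>\<^bsub>SL2 q\<^esub> g)))) = 0"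
        using trans[OF h, of "\<lambda>x. cnj (w t x * cnj (w t' x))"] by simp
    next
      fix t assume "t \<in> X"
      then show "(\<Sum>g\<in>?C. (cmod (cnj (w t (h \<otimes>\<^bsub>SL2 q\<^esub> g))))\<^sup>2) > 0"
        using Npos trans[OF h, of "\<lambda>x. (cmod (w t x))\<^sup>2"] by (simp add: N_def)
    qed
    moreover have "(\<Sum>g\<in>?C. (cmod (cnj (w t (h \<otimes>\<^bsub>SL2 q\<^esub> g))))\<^sup>2) = N t" for t
      using trans[OF h, of "\<lambda>x. (cmod (w t x))\<^sup>2"] by (simp add: N_def)
    ultimately show ?thesis by (simp add: norm_mult power_mult_distrib)
  qed
  \<comment> \<open>A sum of squared fibre sizes counts pairs of words with the same matrix, and
    these are collisions.\<close>
  have coll: "(\<Sum>g\<in>?C. (real (M g))\<^sup>2) \<le> real (card (collisions q 0 m))"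
  proof -
    have "(\<Sum>g\<in>?C. (real (M g))\<^sup>2) = (\<Sum>g\<in>?C. \<Sum>v\<in>{v \<in> rwords m. wmat v = g}. real (M (wmat v)))"
      by (intro sum.cong refl) (simp add: M_def power2_eq_square)
    also have "\<dots> = (\<Sum>v\<in>rwords m. real (M (wmat v)))"
      using fin wmat_carrier rwords_subset by (intro sum.group) auto
    also have "\<dots> = real (card (SIGMA v:rwords m. {u \<in> rwords m. wmat u = wmat v}))"
      by (simp add: M_def)
    also have "\<dots> \<le> real (card (collisions q 0 m))"
    proof -
      have "(SIGMA v:rwords m. {u \<in> rwords m. wmat u = wmat v}) \<subseteq> collisions q 0 m"
      proof safe
        fix v u assume vu: "v \<in> rwords m" "u \<in> rwords m" "wmat u = wmat v"
        then have "lmat m (prod_list v) = lmat m (prod_list u)" by (simp add: wmat_def rwords_def)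
        then have "qdvd q (prod_list v - prod_list u)" by (rule lmat_inj)
        then show "(v, u) \<in> collisions q 0 m" using vu by (simp add: collisions_def words_zero)
      qed
      from card_mono[OF finite_collisions this] show ?thesis by (simp only: of_nat_le_iff)
    qed
    finally show ?thesis .
  qed
  have "real (card X) * (walk_poly \<mu> m)\<^sup>2 = (\<Sum>t\<in>X. (walk_poly \<mu> m)\<^sup>2 * N t / N t)"
    using Npos by (simp add: less_imp_neq[symmetric])
  also have "\<dots> = (\<Sum>t\<in>X. \<Sum>h\<in>?C. (walk_poly \<mu> m)\<^sup>2 * (cmod (w t h))\<^sup>2 / N t)"
    by (subst N_def) (simp only: sum_distrib_left sum_divide_distrib)
  also have "\<dots> = (\<Sum>h\<in>?C. \<Sum>t\<in>X. (walk_poly \<mu> m)\<^sup>2 * (cmod (w t h))\<^sup>2 / N t)" by (rule sum.swap)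
  also have "\<dots> \<le> (\<Sum>h\<in>?C. real (card (collisions q 0 m)))"
    using row coll by (intro sum_mono) (rule order_trans)
  also have "\<dots> = real (card ?C) * real (card (collisions q 0 m))" by (simp only: sum_constant)
  finally show ?thesis .
qed

lemma rho_inj: "inj_on rho lps"
proof (rule inj_onI)
  fix s t assume st: "s \<in> lps" "t \<in> lps" "rho s = rho t"
  then have d: "qdvd q (s - t)" by (intro lmat_inj)
  have b: "\<bar>q0 u\<bar> \<le> 5" "\<bar>q1 u\<bar> \<le> 5" "\<bar>q2 u\<bar> \<le> 5" "\<bar>q3 u\<bar> \<le> 5" if "u \<in> lps" for u
  proof -
    have "\<forall>u\<in>set lps_list. \<bar>q0 u\<bar> \<le> 5 \<and> \<bar>q1 u\<bar> \<le> 5 \<and> \<bar>q2 u\<bar> \<le> 5 \<and> \<bar>q3 u\<bar> \<le> 5"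
      by code_simp
    then show "\<bar>q0 u\<bar> \<le> 5" "\<bar>q1 u\<bar> \<le> 5" "\<bar>q2 u\<bar> \<le> 5" "\<bar>q3 u\<bar> \<le> 5"
      using that by (auto simp: lps_def)
  qed
  have "a = b" if "q dvd a - b" "\<bar>a\<bar> \<le> 5" "\<bar>b\<bar> \<le> 5" for a b
    using that dvd_imp_le_int[of "a - b" q] q_gt by (cases "a = b") auto
  then show "s = t"
    using d b[OF st(1)] b[OF st(2)] by (simp add: quat_eq_iff qdvd_def minus_quat_def)
qed

lemma sum_rho: "(\<Sum>s\<in>rho ` lps. f (x \<otimes>\<^bsub>SL2 q\<^esub> s)) = (\<Sum>s\<in>lps. f (x \<otimes>\<^bsub>SL2 q\<^esub> rho s))"
  by (subst sum.reindex[OF rho_inj]) simp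

text \<open>The multiplicity is at least \<open>q / 4\<close>, the group has at most
  \<open>q^3\<close> elements, and the collisions number at most
  \<open>7200 * (m + 1) * 17 ^ m\<close>. Division leaves \<open>q^2\<close> and the constant
  \<open>28800 = 4 * 7200\<close>.\<close>

lemma spectral_inequality:
  fixes F :: "mat2 \<Rightarrow> real"
  assumes eig: "\<And>x. x \<in> carrier (SL2 q) \<Longrightarrow> (\<Sum>s\<in>lps. F (x \<otimes>\<^bsub>SL2 q\<^esub> rho s)) = \<mu> * F x"
    and sum0: "(\<Sum>x\<in>carrier (SL2 q). F x) = 0" and nz: "\<exists>x\<in>carrier (SL2 q). F x \<noteq> 0"
    and m: "17 ^ m \<le> real_of_int q powr (11 / 5)"
  shows "(walk_poly \<mu> m)\<^sup>2 \<le> 28800 * (real_of_int q)\<^sup>2 * (m + 1) * 17 ^ m"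
proof -
  have S: "rho ` lps \<subseteq> carrier (SL2 q)" using rho_carrier by blast
  have eig': "(\<Sum>s\<in>rho ` lps. F (x \<otimes>\<^bsub>SL2 q\<^esub> s)) = \<mu> * F x" if "x \<in> carrier (SL2 q)" for x
    unfolding sum_rho by (rule eig[OF that])
  let ?X = "{1..(q - 1) div 2}"
  obtain w :: "int \<Rightarrow> mat2 \<Rightarrow> complex" where w:
    "\<And>t x. t \<in> ?X \<Longrightarrow> x \<in> carrier (SL2 q) \<Longrightarrow> (\<Sum>s\<in>rho ` lps. w t (x \<otimes>\<^bsub>SL2 q\<^esub> s)) = of_real \<mu> * w t x"
    "\<And>t t'. t \<in> ?X \<Longrightarrow> t' \<in> ?X \<Longrightarrow> t \<noteq> t' \<Longrightarrow> (\<Sum>x\<in>carrier (SL2 q). w t x * cnj (w t' x)) = 0"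
    "\<And>t. t \<in> ?X \<Longrightarrow> \<exists>x\<in>carrier (SL2 q). w t x \<noteq> 0"
    by (rule SL2_eigenfunction_family[OF prime_q _ S eig' sum0 nz]) (use q_gt in simp, assumption, rule that)
  define X where "X = ?X"
  note w = w[folded X_def]
  have b: "real (card X) * (walk_poly \<mu> m)\<^sup>2 \<le> real (card (carrier (SL2 q))) * real (card (collisions q 0 m))"
    by (rule eigenfunction_family_bound[of X w]) (simp add: X_def, fact w(1)[unfolded sum_rho], fact w(2), fact w(3))
  have cX: "real (card X) \<ge> real_of_int q / 4"
  proof -
    have "q - 2 \<le> 2 * ((q - 1) div 2)" by presburger
    then have "real_of_int (q - 2) \<le> real_of_int (2 * ((q - 1) div 2))" by (simp only: of_int_le_iff)
    then show ?thesis using q_gt by (simp add: X_def)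
  qed
  have cH: "real (card (carrier (SL2 q))) \<le> real_of_int q ^ 3"
  proof -
    have "real (card (carrier (SL2 q))) \<le> real (nat q ^ 3)"
      using card_SL2_le[OF prime_q] by (simp only: of_nat_le_iff)
    then show ?thesis using q1 by simp
  qed
  have "real_of_int q / 4 * (walk_poly \<mu> m)\<^sup>2 \<le> real (card X) * (walk_poly \<mu> m)\<^sup>2"
    using cX by (intro mult_right_mono) auto
  also note b
  also have "real (card (carrier (SL2 q))) * real (card (collisions q 0 m))
      \<le> real_of_int q ^ 3 * (7200 * (m + 1) * 17 ^ m)"
    using cH card_collisions_le[OF prime_q _ m, of 0] q_gt q1 by (intro mult_mono) auto
  also have "\<dots> = real_of_int q / 4 * (28800 * (real_of_int q)\<^sup>2 * (m + 1) * 17 ^ m)"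
    by (simp add: power2_eq_square power3_eq_cube)
  finally have le: "real_of_int q / 4 * (walk_poly \<mu> m)\<^sup>2
      \<le> real_of_int q / 4 * (28800 * (real_of_int q)\<^sup>2 * (m + 1) * 17 ^ m)" .
  show ?thesis by (rule mult_left_le_imp_le[OF le]) (use q1 in simp)
qed

end

section \<open>Choice of the walk length\<close>

lemma exists_power_floor:
  fixes z :: real
  assumes "z \<ge> 1"
  obtains m where "17 ^ m \<le> z" "z < 17 ^ Suc m"
proof -
  obtain k where k: "z < 17 ^ k" using real_arch_pow[of 17 z] by auto
  define n where "n = (LEAST k. z < 17 ^ k)"
  have n: "z < 17 ^ n" unfolding n_def by (rule LeastI[of "\<lambda>k. z < 17 ^ k", OF k])
  have "n \<noteq> 0" using n assms by (cases n) auto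
  then obtain m where m: "n = Suc m" by (cases n) auto
  have "\<not> z < 17 ^ m" using not_less_Least[of m "\<lambda>k. z < 17 ^ k"] m n_def by simp
  then show thesis using that[of m] n m by simp
qed

text \<open>For the largest \<open>m\<close> with \<open>17^m \<le> q^(11/5)\<close>,
  \<open>q^2\<close> is about \<open>17^(10 m / 11)\<close>, and an eigenvalue of at least 16.11
  would give \<open>14.97^(2 m)\<close> at most a linear factor times \<open>17^(21 m / 11)\<close>.
  The statement stands outside the locale because one threshold \<open>Q\<close> has to serve all
  \<open>q\<close>, \<open>I\<close> and \<open>r\<close>.\<close>

theorem SL2_spectral_gap:
  "\<exists>Q. \<forall>q I r. lps_prime q I r \<longrightarrow> q \<ge> Q \<longrightarrow> (\<forall>\<mu> F.
     (\<forall>x\<in>carrier (SL2 q). (\<Sum>s\<in>lps. F (x \<otimes>\<^bsub>SL2 q\<^esub> lps_prime.lmat q I r 1 s)) = \<mu> * F x) \<longrightarrow>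
     (\<Sum>x\<in>carrier (SL2 q). F x) = 0 \<longrightarrow> (\<exists>x\<in>carrier (SL2 q). F x \<noteq> 0) \<longrightarrow> \<mu> < (1611 / 100 :: real))"
proof -
  \<comment> \<open>This ratio is only about 1.003; taking 11th powers reduces \<open>c > 1\<close>
    to rational arithmetic.\<close>
  define c where "c = (1497 / 100 :: real)\<^sup>2 / 17 powr (21 / 11)"
  have c1: "c > 1"
  proof -
    have "(17 powr (21 / 11)) ^ 11 = (17 :: real) ^ 21"
      by (simp add: powr_powr flip: powr_realpow)
    also have "\<dots> < ((1497 / 100)\<^sup>2) ^ 11" by (simp add: power_divide)
    finally have "17 powr (21 / 11) < (1497 / 100 :: real)\<^sup>2" by (rule power_less_imp_less_base) simp
    then show ?thesis by (simp add: c_def)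
  qed
  have "filterlim (\<lambda>m. c ^ m / (real m + 1)) at_top at_top" using c1 by real_asymp
  then have "eventually (\<lambda>m. c ^ m / (real m + 1) > 28800 * 17) at_top"
    by (simp add: filterlim_at_top_dense)
  then obtain M where M: "\<And>m. m \<ge> M \<Longrightarrow> c ^ m / (real m + 1) > 28800 * 17"
    by (auto simp: eventually_at_top_linorder)
  show ?thesis
  proof (intro exI[of _ "17 ^ Suc M"] allI impI)
    fix q I r \<mu> and F :: "mat2 \<Rightarrow> real"
    assume L: "lps_prime q I r" and Q: "q \<ge> 17 ^ Suc M"
      and eig: "\<forall>x\<in>carrier (SL2 q). (\<Sum>s\<in>lps. F (x \<otimes>\<^bsub>SL2 q\<^esub> lps_prime.lmat q I r 1 s)) = \<mu> * F x"
      and sum0: "(\<Sum>x\<in>carrier (SL2 q). F x) = 0" and nz: "\<exists>x\<in>carrier (SL2 q). F x \<noteq> 0"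
    interpret lps_prime q I r by (rule L)
    define z where "z = real_of_int q powr (11 / 5)"
    have qr: "real_of_int q \<ge> 1" using q1 by simp
    then have "z \<ge> 1" unfolding z_def by (intro ge_one_powr_ge_zero) auto
    then obtain m where m: "17 ^ m \<le> z" "z < 17 ^ Suc m" by (rule exists_power_floor)
    have "(17 :: real) ^ Suc M \<le> real_of_int q" using Q by (metis of_int_le_iff of_int_numeral of_int_power)
    also have "\<dots> \<le> z" using powr_mono[of 1 "11 / 5" "real_of_int q"] qr by (simp add: z_def)
    also note m(2)
    finally have "Suc M < Suc m" by (rule power_less_imp_less_exp[rotated]) simp
    then have big: "c ^ m > 28800 * 17 * (real m + 1)" using M[of m] by (simp add: field_simps)
    show "\<mu> < 1611 / 100"
    proof (rule ccontr)
      assume "\<not> \<mu> < 1611 / 100"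
      then have "(1497 / 100) ^ m \<le> walk_poly \<mu> m" by (intro walk_poly_lower_bound) simp
      then have "((1497 / 100) ^ m)\<^sup>2 \<le> (walk_poly \<mu> m)\<^sup>2" by (intro power_mono) auto
      also have "\<dots> \<le> 28800 * (real_of_int q)\<^sup>2 * (m + 1) * 17 ^ m"
        by (rule spectral_inequality[of F]) (use eig sum0 nz m(1) in \<open>auto simp: z_def simp del: SL2_simps\<close>)
      \<comment> \<open>\<open>q^2\<close> is the power 10/11 of \<open>z\<close>, which lies below
        \<open>17 ^ Suc m\<close>; the additional 17 pays for the rounding of
        \<open>m\<close>.\<close>
      also have "\<dots> \<le> 28800 * (17 * (17 powr (10 / 11)) ^ m) * (m + 1) * 17 ^ m"
      proof -
        have "(real_of_int q)\<^sup>2 = z powr (10 / 11)"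
          using qr by (simp add: z_def powr_powr)
        also have "\<dots> \<le> (17 ^ Suc m) powr (10 / 11)"
          using m(2) \<open>z \<ge> 1\<close> by (intro powr_mono2) auto
        also have "\<dots> = 17 powr (10 / 11) * (17 powr (10 / 11)) ^ m"
        proof -
          have "((17 :: real) ^ n) powr (10 / 11) = (17 powr (10 / 11)) ^ n" for n
            by (induction n) (simp_all add: powr_mult)
          from this[of "Suc m"] show ?thesis by simp
        qed
        also have "\<dots> \<le> 17 * (17 powr (10 / 11)) ^ m"
          using powr_mono[of "10 / 11" 1 "17 :: real"] by (intro mult_right_mono) auto
        finally show ?thesis by (intro mult_right_mono mult_left_mono) auto
      qed
      also have "\<dots> = 28800 * 17 * (real m + 1) * (17 powr (21 / 11)) ^ m"
      proof -
        have "(17 :: real) powr (21 / 11) = 17 powr (10 / 11) * 17"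
          using powr_add[of "17 :: real" "10 / 11" 1] by simp
        then show ?thesis by (simp add: power_mult_distrib)
      qed
      also have "((1497 / 100) ^ m)\<^sup>2 = c ^ m * (17 powr (21 / 11)) ^ m"
      proof -
        have "((1497 / 100 :: real) ^ m)\<^sup>2 = ((1497 / 100)\<^sup>2) ^ m"
          by (simp only: power_mult[symmetric] mult.commute)
        also have "(1497 / 100)\<^sup>2 = c * 17 powr (21 / 11)" by (simp add: c_def)
        finally show ?thesis by (simp only: power_mult_distrib)
      qed
      finally have "c ^ m \<le> 28800 * 17 * (real m + 1)"
        by (rule mult_right_le_imp_le) simp
      then show False using big by simp
    qed
  qed
qed

section \<open>The affine group\<close>

type_synonym vec2 = "int \<times> int"

fun act :: "mat2 \<Rightarrow> vec2 \<Rightarrow> vec2" where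
  "act (a, b, c, d) (x, y) = (a * x + b * y, c * x + d * y)"

fun vadd :: "vec2 \<Rightarrow> vec2 \<Rightarrow> vec2" where
  "vadd (x, y) (z, w) = (x + z, y + w)"

fun vneg :: "vec2 \<Rightarrow> vec2" where
  "vneg (x, y) = (- x, - y)"

fun vred :: "int \<Rightarrow> vec2 \<Rightarrow> vec2" where
  "vred q (x, y) = (x mod q, y mod q)"

text \<open>The symplectic form that identifies the plane with its dual. As SL(2,q) preserves it,
  characters indexed through it are permuted like vectors.\<close>

fun vdet :: "vec2 \<Rightarrow> vec2 \<Rightarrow> int" where
  "vdet (x, y) (z, w) = x * w - y * z"

definition vecs :: "int \<Rightarrow> vec2 set" where
  "vecs q = {0..<q} \<times> {0..<q}"

lemma vred_vred [simp]: "vred q (vred q v) = vred q v"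
  by (cases v) simp

lemma vred_vadd_left [simp]: "vred q (vadd (vred q v) w) = vred q (vadd v w)"
  by (cases v; cases w) (simp add: mod_simps)

lemma vred_vadd_right [simp]: "vred q (vadd v (vred q w)) = vred q (vadd v w)"
  by (cases v; cases w) (simp add: mod_simps)

lemma vred_act_right [simp]: "vred q (act A (vred q v)) = vred q (act A v)"
  by (cases A; cases v) (auto simp flip: int_cong_def intro!: cong_add cong_mult)

lemma vred_act_left [simp]: "vred q (act (mred q A) v) = vred q (act A v)"
  by (cases A; cases v) (auto simp flip: int_cong_def intro!: cong_add cong_mult)

lemma vred_vadd_act_right [simp]: "vred q (vadd v (act A (vred q w))) = vred q (vadd v (act A w))"
  by (metis vred_vadd_right vred_act_right)

lemma vred_vadd_act_left [simp]: "vred q (vadd v (act (mred q A) w)) = vred q (vadd v (act A w))"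
  by (metis vred_vadd_right vred_act_left)

lemma act_mmul: "act (mmul A B) v = act A (act B v)"
  by (cases A; cases B; cases v) (simp add: algebra_simps)

lemma act_vadd: "act A (vadd v w) = vadd (act A v) (act A w)"
  by (cases A; cases v; cases w) (simp add: algebra_simps)

lemma vadd_assoc: "vadd (vadd u v) w = vadd u (vadd v w)"
  by (cases u; cases v; cases w) simp

lemma vadd_zero [simp]: "vadd v (0, 0) = v" "vadd (0, 0) v = v"
  by (cases v; simp)+

lemma act_zero [simp]: "act A (0, 0) = (0, 0)"
  by (cases A) simp

lemma act_one [simp]: "act (1, 0, 0, 1) v = v"
  by (cases v) simp

lemma vadd_vneg [simp]: "vadd (vneg v) v = (0, 0)" "vadd v (vneg v) = (0, 0)"
  by (cases v; simp)+

lemma vred_zero [simp]: "vred q (0, 0) = (0, 0)"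
  by simp

lemma vred_in_vecs [simp]: "q > 0 \<Longrightarrow> vred q v \<in> vecs q"
  by (cases v) (simp add: vecs_def)

lemma vred_id: "v \<in> vecs q \<Longrightarrow> vred q v = v"
  by (cases v) (simp add: vecs_def)

lemma zero_in_vecs [simp]: "q > 0 \<Longrightarrow> (0, 0) \<in> vecs q"
  by (simp add: vecs_def)

lemma finite_vecs [simp]: "finite (vecs q)"
  by (simp add: vecs_def)

lemma card_vecs: "q > 0 \<Longrightarrow> card (vecs q) = nat q ^ 2"
  by (simp add: vecs_def card_cartesian_product power2_eq_square)

lemma vdet_act: "vdet (act A v) (act A w) = mdet A * vdet v w"
  by (cases A; cases v; cases w) (simp add: algebra_simps)

lemma vdet_vadd: "vdet a (vadd v w) = vdet a v + vdet a w"
  by (cases a; cases v; cases w) (simp add: algebra_simps)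

lemma vdet_vred_right [simp]: "vdet a (vred q v) mod q = vdet a v mod q"
  by (cases a; cases v) (auto simp flip: int_cong_def intro!: cong_diff cong_mult)

lemma vdet_vred_left [simp]: "vdet (vred q a) v mod q = vdet a v mod q"
  by (cases a; cases v) (auto simp flip: int_cong_def intro!: cong_diff cong_mult)

text \<open>The pair \<open>(A, v)\<close> stands for the map that sends \<open>x\<close> to
  \<open>A x + v\<close>; its second component is the image of the origin.\<close>

definition ASL2 :: "int \<Rightarrow> (mat2 \<times> vec2) monoid" where
  "ASL2 q = \<lparr>carrier = carrier (SL2 q) \<times> vecs q,
     mult = (\<lambda>(A, v) (B, w). (A \<otimes>\<^bsub>SL2 q\<^esub> B, vred q (vadd v (act A w)))),
     one = ((1, 0, 0, 1), (0, 0))\<rparr>"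

lemma ASL2_carrier: "(A, v) \<in> carrier (ASL2 q) \<longleftrightarrow> A \<in> carrier (SL2 q) \<and> v \<in> vecs q"
  and ASL2_mult: "(A, v) \<otimes>\<^bsub>ASL2 q\<^esub> (B, w) = (A \<otimes>\<^bsub>SL2 q\<^esub> B, vred q (vadd v (act A w)))"
  and ASL2_one: "\<one>\<^bsub>ASL2 q\<^esub> = ((1, 0, 0, 1), (0, 0))"
  by (simp_all add: ASL2_def)

lemma group_ASL2:
  assumes q: "q > 1"
  shows "group (ASL2 q)"
proof -
  interpret H: group "SL2 q" by (rule group_SL2[OF q])
  have q0: "q > 0" using q by simp
  have one: "(1, 0, 0, 1) \<in> carrier (SL2 q)" using H.one_closed by (simp only: SL2_simps)
  show ?thesis
  proof (rule groupI)
    fix g h assume "g \<in> carrier (ASL2 q)" "h \<in> carrier (ASL2 q)"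
    then show "g \<otimes>\<^bsub>ASL2 q\<^esub> h \<in> carrier (ASL2 q)"
      using q0 H.m_closed by (cases g; cases h) (simp only: ASL2_carrier ASL2_mult vred_in_vecs simp_thms)
  next
    show "\<one>\<^bsub>ASL2 q\<^esub> \<in> carrier (ASL2 q)" using one q0 by (simp only: ASL2_one ASL2_carrier zero_in_vecs simp_thms)
  next
    fix g h k
    show "g \<otimes>\<^bsub>ASL2 q\<^esub> h \<otimes>\<^bsub>ASL2 q\<^esub> k = g \<otimes>\<^bsub>ASL2 q\<^esub> (h \<otimes>\<^bsub>ASL2 q\<^esub> k)"
      by (cases g; cases h; cases k) (simp add: ASL2_mult mmul_assoc act_mmul act_vadd vadd_assoc)
  next
    fix g assume g: "g \<in> carrier (ASL2 q)"
    obtain A v where Av: "g = (A, v)" by (cases g)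
    have "A \<in> carrier (SL2 q)" "v \<in> vecs q" using g by (simp_all only: Av ASL2_carrier)
    then show "\<one>\<^bsub>ASL2 q\<^esub> \<otimes>\<^bsub>ASL2 q\<^esub> g = g"
      using H.l_one[of A] by (simp add: Av ASL2_one ASL2_mult vred_id)
    have i: "inv\<^bsub>SL2 q\<^esub> A \<in> carrier (SL2 q)" "inv\<^bsub>SL2 q\<^esub> A \<otimes>\<^bsub>SL2 q\<^esub> A = (1, 0, 0, 1)"
      using H.inv_closed H.l_inv \<open>A \<in> carrier (SL2 q)\<close> by (auto simp del: SL2_simps(1,2))
    define B where "B = inv\<^bsub>SL2 q\<^esub> A"
    have "(B, vred q (vneg (act B v))) \<otimes>\<^bsub>ASL2 q\<^esub> g = \<one>\<^bsub>ASL2 q\<^esub>"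
      using i(2) by (simp add: Av ASL2_mult ASL2_one B_def)
    moreover have "(B, vred q (vneg (act B v))) \<in> carrier (ASL2 q)"
      using i(1) q0 by (simp only: ASL2_carrier B_def vred_in_vecs simp_thms)
    ultimately show "\<exists>h\<in>carrier (ASL2 q). h \<otimes>\<^bsub>ASL2 q\<^esub> g = \<one>\<^bsub>ASL2 q\<^esub>" by blast
  qed
qed

text \<open>Both vectors are images of \<open>(1, 0)\<close>: a nonzero vector can be completed, as
  first column, to a matrix of determinant 1.\<close>

lemma SL2_transitive:
  assumes q: "prime q" and x: "x \<in> vecs q" "x \<noteq> (0, 0)" and y: "y \<in> vecs q" "y \<noteq> (0, 0)"
  obtains A where "A \<in> carrier (SL2 q)" "vred q (act A x) = y"
proof -
  have q1: "q > 1" "q > 0" using prime_gt_1_int[OF q] by auto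
  interpret H: group "SL2 q" by (rule group_SL2[OF q1(1)])
  have E: "\<exists>A\<in>carrier (SL2 q). vred q (act A (1, 0)) = y" if "y \<in> vecs q" "y \<noteq> (0, 0)" for y
  proof -
    obtain a c where ac: "y = (a, c)" by (cases y)
    then have y: "y = (a, c)" "a \<in> {0..<q}" "c \<in> {0..<q}" using that by (auto simp: vecs_def)
    show ?thesis
    proof (cases "a = 0")
      case False
      then have "\<not> q dvd a" using y zdvd_not_zless[of a q] by auto
      then obtain b where b: "(a * b) mod q = 1" using mod_inverse_exists[OF q] by blast
      have "mred q (a, 0, c, b) \<in> carrier (SL2 q)" by (rule mred_in_SL2[OF q1(1)]) (simp add: b)
      moreover have "vred q (act (mred q (a, 0, c, b)) (1, 0)) = y"
        unfolding vred_act_left using y by simp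
      ultimately show ?thesis by blast
    next
      case True
      then have "\<not> q dvd c" using y that zdvd_not_zless[of c q] by auto
      then obtain b where b: "(c * b) mod q = 1" using mod_inverse_exists[OF q] by blast
      have "mred q (0, - b, c, 0) \<in> carrier (SL2 q)" by (rule mred_in_SL2[OF q1(1)]) (use b in \<open>simp add: mult.commute\<close>)
      moreover have "vred q (act (mred q (0, - b, c, 0)) (1, 0)) = y"
        unfolding vred_act_left using y True by simp
      ultimately show ?thesis by blast
    qed
  qed
  obtain A where A: "A \<in> carrier (SL2 q)" "vred q (act A (1, 0)) = x" using E x by blast
  obtain B where B: "B \<in> carrier (SL2 q)" "vred q (act B (1, 0)) = y" using E y by blast
  define C where "C = inv\<^bsub>SL2 q\<^esub> A"
  have C: "C \<in> carrier (SL2 q)" "C \<otimes>\<^bsub>SL2 q\<^esub> A = (1, 0, 0, 1)"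
    using H.inv_closed[OF A(1)] H.l_inv[OF A(1)] by (auto simp: C_def simp del: SL2_simps(1,2))
  have "vred q (act (B \<otimes>\<^bsub>SL2 q\<^esub> C) x) = vred q (act B (act C (act A (1, 0))))"
    by (simp add: act_mmul A(2)[symmetric])
  also have "act C (act A (1, 0)) = act (mmul C A) (1, 0)" by (simp add: act_mmul)
  also have "vred q (act B (act (mmul C A) (1, 0))) = vred q (act B (vred q (act (C \<otimes>\<^bsub>SL2 q\<^esub> A) (1, 0))))"
    by simp
  also have "\<dots> = y" unfolding C(2) using B(2) by (simp only: act_one vred_act_right)
  finally have "vred q (act (B \<otimes>\<^bsub>SL2 q\<^esub> C) x) = y" .
  then show thesis using that H.m_closed[OF B(1) C(1)] by blast
qed

section \<open>Translations and their characters\<close>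

definition transl :: "int \<Rightarrow> vec2 \<Rightarrow> mat2 \<times> vec2" where
  "transl q v = ((1, 0, 0, 1), vred q v)"

lemma transl_carrier: "q > 1 \<Longrightarrow> transl q v \<in> carrier (ASL2 q)"
  by (simp add: transl_def ASL2_def)

lemma transl_vred [simp]: "transl q (vred q v) = transl q v"
  by (simp add: transl_def)

lemma transl_mult:
  assumes "q > 1" "B \<in> carrier (SL2 q)"
  shows "transl q v \<otimes>\<^bsub>ASL2 q\<^esub> (B, w) = (B, vred q (vadd v w))"
proof -
  interpret H: group "SL2 q" by (rule group_SL2[OF assms(1)])
  show ?thesis using H.l_one[OF assms(2)] by (simp add: transl_def ASL2_mult)
qed

lemma bij_betw_vadd:
  assumes "q > 0"
  shows "bij_betw (\<lambda>v. vred q (vadd v w)) (vecs q) (vecs q)"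
proof (rule bij_betwI[of _ _ _ "\<lambda>v. vred q (vadd v (vneg w))"])
  fix v assume v: "v \<in> vecs q"
  show "vred q (vadd (vred q (vadd v w)) (vneg w)) = v" "vred q (vadd (vred q (vadd v (vneg w))) w) = v"
    using v by (simp_all add: vadd_assoc vred_id)
qed (use assms in auto)

lemma translation_char_family:
  assumes q: "prime q"
  shows "char_family (ASL2 q) (vecs q) (\<lambda>v w. vred q (vadd v w)) (0, 0) (transl q) (vecs q) (0, 0)
    (\<lambda>a v. ech q (vdet a v))"
proof -
  have q1: "q > 1" "q > 0" using prime_gt_1_int[OF q] by auto
  interpret group "ASL2 q" by (rule group_ASL2[OF q1(1)])
  interpret H: group "SL2 q" by (rule group_SL2[OF q1(1)])
  show ?thesis
  proof unfold_locales
    show "transl q (0, 0) = \<one>\<^bsub>ASL2 q\<^esub>" by (simp add: transl_def ASL2_one)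
    fix v w a :: vec2
    show "transl q v \<in> carrier (ASL2 q)" by (rule transl_carrier[OF q1(1)])
    show "bij_betw (\<lambda>v. vred q (vadd v w)) (vecs q) (vecs q)" by (rule bij_betw_vadd[OF q1(2)])
    show "transl q (vred q (vadd v w)) = transl q v \<otimes>\<^bsub>ASL2 q\<^esub> transl q w"
      using transl_mult[OF q1(1) H.one_closed, of v "vred q w"] by (simp add: transl_def)
    have "ech q (vdet a (vred q (vadd v w))) = ech q (vdet a (vadd v w))"
      using q1 by (intro ech_cong) simp_all
    then show "ech q (vdet a (vred q (vadd v w))) = ech q (vdet a v) * ech q (vdet a w)"
      by (simp add: vdet_vadd ech_add)
    show "ech q (vdet (0, 0) v) = 1" "ech q (vdet a (0, 0)) = 1" by (cases v; cases a; simp)+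
    show "cmod (ech q (vdet a v)) = 1" by simp
    assume v: "v \<in> vecs q" "v \<noteq> (0, 0)"
    obtain x y where xy: "v = (x, y)" by (cases v)
    \<comment> \<open>The sum splits into one sum for each coordinate, and a nonzero coordinate
      makes its sum vanish.\<close>
    have "(\<Sum>a\<in>vecs q. ech q (vdet a v)) = (\<Sum>a1\<in>{0..<q}. \<Sum>a2\<in>{0..<q}. ech q (a1 * y) * ech q (a2 * - x))"
      unfolding vecs_def sum.cartesian_product
      by (intro sum.cong refl) (auto simp: xy ech_add[symmetric])
    also have "\<dots> = (\<Sum>a1\<in>{0..<q}. ech q (a1 * y)) * (\<Sum>a2\<in>{0..<q}. ech q (a2 * - x))"
      by (simp only: sum_product)
    also have "\<dots> = 0"
    proof (cases "y = 0")
      case True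
      then have "\<not> q dvd - x" using v xy zdvd_not_zless[of x q] by (auto simp: vecs_def)
      then show ?thesis using sum_ech[OF q1(2), of "- x"] by simp
    next
      case False
      then have "\<not> q dvd y" using v xy zdvd_not_zless[of y q] by (auto simp: vecs_def)
      then show ?thesis using sum_ech[OF q1(2), of y] by simp
    qed
    finally show "(\<Sum>a\<in>vecs q. ech q (vdet a v)) = 0" .
  qed (use q1 in auto)
qed

text \<open>A nontrivial character of the translation subgroup occurs in the eigenfunction, and
  \<open>SL2\<close> permutes the nontrivial characters transitively.\<close>

lemma ASL2_eigenfunction_family:
  fixes f :: "mat2 \<times> vec2 \<Rightarrow> complex"
  assumes q: "prime q" and S: "S \<subseteq> carrier (ASL2 q)"
    and eig: "\<And>x. x \<in> carrier (ASL2 q) \<Longrightarrow> (\<Sum>s\<in>S. f (x \<otimes>\<^bsub>ASL2 q\<^esub> s)) = \<mu> * f x"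
    and x0: "x0 \<in> carrier (ASL2 q)" and v0: "v0 \<in> vecs q"
    and neq: "f (transl q v0 \<otimes>\<^bsub>ASL2 q\<^esub> x0) \<noteq> f x0"
  obtains w :: "vec2 \<Rightarrow> mat2 \<times> vec2 \<Rightarrow> complex" where
    "\<And>b x. b \<in> vecs q - {(0, 0)} \<Longrightarrow> x \<in> carrier (ASL2 q) \<Longrightarrow> (\<Sum>s\<in>S. w b (x \<otimes>\<^bsub>ASL2 q\<^esub> s)) = \<mu> * w b x"
    "\<And>b c. b \<in> vecs q - {(0, 0)} \<Longrightarrow> c \<in> vecs q - {(0, 0)} \<Longrightarrow> b \<noteq> c \<Longrightarrow>
       (\<Sum>x\<in>carrier (ASL2 q). w b x * cnj (w c x)) = 0"
    "\<And>b. b \<in> vecs q - {(0, 0)} \<Longrightarrow> \<exists>x\<in>carrier (ASL2 q). w b x \<noteq> 0"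
proof -
  have q1: "q > 1" "q > 0" using prime_gt_1_int[OF q] by auto
  interpret H: group "SL2 q" by (rule group_SL2[OF q1(1)])
  interpret char_family "ASL2 q" "vecs q" "\<lambda>v w. vred q (vadd v w)" "(0, 0)" "transl q" "vecs q" "(0, 0)"
    "\<lambda>a v. ech q (vdet a v)" by (rule translation_char_family[OF q])
  obtain a y where a: "a \<in> vecs q" "a \<noteq> (0, 0)" and y: "y \<in> carrier (ASL2 q)" "component a f y \<noteq> 0"
    by (rule nontrivial_component[OF x0 v0 neq])
  have "\<exists>A. \<forall>b\<in>vecs q - {(0, 0)}. A b \<in> carrier (SL2 q) \<and> vred q (act (A b) b) = a"
    using SL2_transitive[OF q _ _ a] by (intro bchoice) (metis DiffE insertI1)
  then obtain M where M: "\<And>b. b \<in> vecs q - {(0, 0)} \<Longrightarrow> M b \<in> carrier (SL2 q)"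
    "\<And>b. b \<in> vecs q - {(0, 0)} \<Longrightarrow> vred q (act (M b) b) = a" by blast
  \<comment> \<open>A linear element that carries \<open>b\<close> to \<open>a\<close>; translating
    by it changes the character \<open>a\<close> into \<open>b\<close>.\<close>
  define D where "D b = (M b, (0, 0) :: vec2)" for b
  have D: "D b \<in> carrier (ASL2 q)" if "b \<in> vecs q - {(0, 0)}" for b
    using M(1)[OF that] q1 by (simp only: D_def ASL2_carrier zero_in_vecs simp_thms)
  define w where "w b x = component a f (D b \<otimes>\<^bsub>ASL2 q\<^esub> x)" for b x
  have shift: "w b (transl q v \<otimes>\<^bsub>ASL2 q\<^esub> x) = ech q (vdet b v) * w b x"
    if b: "b \<in> vecs q - {(0, 0)}" and x: "x \<in> carrier (ASL2 q)" for b v x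
  proof -
    have "D b \<otimes>\<^bsub>ASL2 q\<^esub> transl q v = transl q (act (M b) v) \<otimes>\<^bsub>ASL2 q\<^esub> D b"
    proof -
      have "D b \<otimes>\<^bsub>ASL2 q\<^esub> transl q v = (M b, vred q (act (M b) v))"
        using H.r_one[OF M(1)[OF b]] by (simp add: D_def transl_def ASL2_mult)
      then show ?thesis using transl_mult[OF q1(1) M(1)[OF b]] by (simp add: D_def)
    qed
    then have "D b \<otimes>\<^bsub>ASL2 q\<^esub> transl q v \<otimes>\<^bsub>ASL2 q\<^esub> x
        = transl q (act (M b) v) \<otimes>\<^bsub>ASL2 q\<^esub> D b \<otimes>\<^bsub>ASL2 q\<^esub> x" by simp
    then have comm: "D b \<otimes>\<^bsub>ASL2 q\<^esub> (transl q v \<otimes>\<^bsub>ASL2 q\<^esub> x)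
        = transl q (vred q (act (M b) v)) \<otimes>\<^bsub>ASL2 q\<^esub> (D b \<otimes>\<^bsub>ASL2 q\<^esub> x)"
      by (simp only: transl_vred m_assoc[OF D[OF b] transl_carrier[OF q1(1)] x] m_assoc[OF transl_carrier[OF q1(1)] D[OF b] x])
    have "w b (transl q v \<otimes>\<^bsub>ASL2 q\<^esub> x) = ech q (vdet a (vred q (act (M b) v))) * w b x"
      unfolding w_def comm by (rule component_translate[OF a(1) vred_in_vecs[OF q1(2)] m_closed[OF D[OF b] x]])
    \<comment> \<open>Replace \<open>a\<close> by the image of \<open>b\<close>: both arguments are
      then moved by \<open>M b\<close>, and the form is invariant.\<close>
    also have "ech q (vdet a (vred q (act (M b) v))) = ech q (vdet b v)"
    proof (rule ech_cong[OF q1(2)])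
      have "vdet a (vred q (act (M b) v)) mod q = vdet (act (M b) b) (act (M b) v) mod q"
        unfolding M(2)[OF b, symmetric] by simp
      also have "\<dots> = (mdet (M b) mod q * vdet b v) mod q" unfolding vdet_act by (simp add: mod_simps)
      also have "\<dots> = vdet b v mod q" using M(1)[OF b] by simp
      finally show "vdet a (vred q (act (M b) v)) mod q = vdet b v mod q" .
    qed
    finally show ?thesis .
  qed
  show thesis
  proof (rule that[of w])
    fix b x assume b: "b \<in> vecs q - {(0, 0)}" and x: "x \<in> carrier (ASL2 q)"
    have "(\<Sum>s\<in>S. w b (x \<otimes>\<^bsub>ASL2 q\<^esub> s)) = (\<Sum>s\<in>S. component a f ((D b \<otimes>\<^bsub>ASL2 q\<^esub> x) \<otimes>\<^bsub>ASL2 q\<^esub> s))"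
      unfolding w_def using S D[OF b] x by (intro sum.cong refl) (simp add: m_assoc subsetD[OF S])
    also have "\<dots> = \<mu> * component a f (D b \<otimes>\<^bsub>ASL2 q\<^esub> x)"
      using D[OF b] x by (intro component_eigenfunction[OF S eig]) auto
    finally show "(\<Sum>s\<in>S. w b (x \<otimes>\<^bsub>ASL2 q\<^esub> s)) = \<mu> * w b x" by (simp add: w_def)
  next
    fix b c assume bc: "b \<in> vecs q - {(0, 0)}" "c \<in> vecs q - {(0, 0)}" "b \<noteq> c"
    obtain b1 b2 c1 c2 where e: "b = (b1, b2)" "c = (c1, c2)" by (cases b; cases c)
    have nd: "\<not> q dvd z - z'" if "z \<in> {0..<q}" "z' \<in> {0..<q}" "z \<noteq> z'" for z z'
      using that dvd_imp_le_int[of "z - z'" q] by auto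
    \<comment> \<open>Different vectors give characters that a standard basis vector already
      separates.\<close>
    have "\<exists>v. \<not> q dvd vdet b v - vdet c v"
    proof (cases "b1 = c1")
      case False
      then show ?thesis using nd[of b1 c1] bc e by (intro exI[of _ "(0, 1)"]) (auto simp: vecs_def)
    next
      case True
      then show ?thesis using nd[of c2 b2] bc e by (intro exI[of _ "(1, 0)"]) (auto simp: vecs_def)
    qed
    then obtain v where v: "\<not> q dvd vdet b v - vdet c v" by blast
    have "ech q (vdet b v) * cnj (ech q (vdet c v)) \<noteq> 1"
      using v q1 by (simp add: cnj_ech ech_add[symmetric] ech_eq_1_iff)
    then show "(\<Sum>x\<in>carrier (ASL2 q). w b x * cnj (w c x)) = 0"
      using shift bc by (intro orthogonal_translation_eigenfunctions[OF transl_carrier[OF q1(1)]]) blast+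
  next
    fix b assume b: "b \<in> vecs q - {(0, 0)}"
    have "D b \<otimes>\<^bsub>ASL2 q\<^esub> (inv\<^bsub>ASL2 q\<^esub> (D b) \<otimes>\<^bsub>ASL2 q\<^esub> y) = y"
      using D[OF b] y(1) by (simp add: m_assoc[symmetric])
    then show "\<exists>x\<in>carrier (ASL2 q). w b x \<noteq> 0"
      using y D[OF b] unfolding w_def by (intro bexI[of _ "inv\<^bsub>ASL2 q\<^esub> (D b) \<otimes>\<^bsub>ASL2 q\<^esub> y"]) auto
  qed
qed

section \<open>The Cayley graph of the affine group\<close>

context lps_prime
begin

sublocale G: group "ASL2 q"
  by (rule group_ASL2[OF q1(1)])

abbreviation "lps_t \<equiv> Quat 1 4 0 0"
abbreviation "lps_t' \<equiv> Quat 1 (-4) 0 0"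

text \<open>Only \<open>1 + 4 i\<close> and its conjugate receive a translation part; that of the
  conjugate is the one that makes the two affine maps inverse to each other. Their linear parts are
  diagonal, which keeps the image of the origin on one axis.\<close>

definition shift :: "quat \<Rightarrow> vec2" where
  "shift s = (if s = lps_t then (1, 0) else if s = lps_t' then vred q (act (rho s) (-1, 0)) else (0, 0))"

definition gen :: "quat \<Rightarrow> mat2 \<times> vec2" where
  "gen s = (rho s, shift s)"

lemma lps_t [simp]: "lps_t \<in> lps" "lps_t' \<in> lps" "qcnj lps_t = lps_t'" "qcnj lps_t' = lps_t"
  by (simp_all add: lps_def lps_list_def qcnj_def)

lemma shift_vecs: "shift s \<in> vecs q"
  using q1 by (auto simp: shift_def) (simp add: vecs_def)

lemma gen_carrier: "s \<in> lps \<Longrightarrow> gen s \<in> carrier (ASL2 q)"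
  using rho_carrier shift_vecs by (simp only: gen_def ASL2_carrier)

lemma gen_qcnj_mult:
  assumes s: "s \<in> lps"
  shows "gen (qcnj s) \<otimes>\<^bsub>ASL2 q\<^esub> gen s = \<one>\<^bsub>ASL2 q\<^esub>"
proof -
  have 1: "rho (qcnj s) \<otimes>\<^bsub>SL2 q\<^esub> rho s = (1, 0, 0, 1)"
    using rho_qcnj_left[OF s] by (simp only: SL2_simps)
  have "vred q (vadd (shift (qcnj s)) (act (rho (qcnj s)) (shift s))) = (0, 0)"
  proof -
    consider "s = lps_t" | "s = lps_t'" | "s \<noteq> lps_t" "s \<noteq> lps_t'" by blast
    then show ?thesis
    proof cases
      case 1
      have "vred q (vadd (vred q (act (rho lps_t') (-1, 0))) (act (rho lps_t') (1, 0)))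
        = vred q (act (rho lps_t') (vadd (-1, 0) (1, 0)))"
        by (simp only: vred_vadd_left act_vadd)
      then show ?thesis using 1 by (simp add: shift_def)
    next
      case 2
      have m: "vred q (act (rho lps_t) (act (rho lps_t') (-1, 0))) = vred q (-1, 0)"
      proof -
        have "vred q (act (rho lps_t) (act (rho lps_t') (-1, 0)))
          = vred q (act (rho lps_t \<otimes>\<^bsub>SL2 q\<^esub> rho lps_t') (-1, 0))"
          by (simp only: SL2_simps vred_act_left act_mmul)
        then show ?thesis using \<open>rho (qcnj s) \<otimes>\<^bsub>SL2 q\<^esub> rho s = (1, 0, 0, 1)\<close> 2
          by (simp only: lps_t act_one)
      qed
      have "vred q (vadd (1, 0) (act (rho lps_t) (vred q (act (rho lps_t') (-1, 0)))))
        = vred q (vadd (1, 0) (vred q (act (rho lps_t) (act (rho lps_t') (-1, 0)))))"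
        by (simp only: vred_vadd_act_right vred_vadd_right)
      also have "\<dots> = vred q (vadd (1, 0) (-1, 0))" unfolding m vred_vadd_right ..
      finally show ?thesis using 2 by (simp add: shift_def)
    next
      case 3
      then have "qcnj s \<noteq> lps_t" "qcnj s \<noteq> lps_t'" by (metis lps_t(3,4) qcnj_qcnj)+
      then show ?thesis using 3 by (simp add: shift_def)
    qed
  qed
  then show ?thesis unfolding gen_def ASL2_mult 1 ASL2_one by simp
qed

lemma inv_gen: "s \<in> lps \<Longrightarrow> inv\<^bsub>ASL2 q\<^esub> (gen s) = gen (qcnj s)"
  using gen_qcnj_mult gen_carrier by (intro G.inv_equality) auto

lemma gen_inj: "inj_on gen lps"
  using rho_inj by (auto simp: gen_def inj_on_def)

lemma lps_qcnj_neq: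
  assumes "s \<in> lps"
  shows "qcnj s \<noteq> s"
proof -
  have "\<forall>s\<in>set lps_list. qcnj s \<noteq> s" by code_simp
  then show ?thesis using assms by (simp add: lps_def)
qed

text \<open>A generator equal to the identity would coincide with its inverse, but no letter is its
  own conjugate and \<open>gen\<close> is injective.\<close>

lemma one_notin_gen: "\<one>\<^bsub>ASL2 q\<^esub> \<notin> gen ` lps"
proof
  assume "\<one>\<^bsub>ASL2 q\<^esub> \<in> gen ` lps"
  then obtain s where s: "s \<in> lps" "gen s = \<one>\<^bsub>ASL2 q\<^esub>" by (metis imageE)
  then have "gen (qcnj s) = gen s" using inv_gen by (metis G.inv_one)
  then show False using s lps_qcnj_neq gen_inj by (metis inj_onD lps_qcnj)
qed

sublocale C: cayley_set "ASL2 q" "gen ` lps"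
proof
  show "finite (carrier (ASL2 q))" using finite_SL2[OF q1(2)] by (simp add: ASL2_def)
  show "gen ` lps \<subseteq> carrier (ASL2 q)" using gen_carrier by blast
  have "m_inv (ASL2 q) ` gen ` lps = gen ` qcnj ` lps"
    unfolding image_image by (intro image_cong refl inv_gen)
  also have "qcnj ` lps = lps" using lps_qcnj by (auto intro!: image_eqI[of _ qcnj "qcnj _"])
  finally show "m_inv (ASL2 q) ` gen ` lps = gen ` lps" .
qed (rule one_notin_gen)

lemma order_ASL2: "order (ASL2 q) = card (carrier (SL2 q)) * nat q ^ 2"
  using q1 by (simp add: order_def ASL2_def card_cartesian_product card_vecs)

lemma sum_ASL2_snd: "(\<Sum>g\<in>carrier (ASL2 q). \<psi> (snd g)) = of_nat (card (carrier (SL2 q))) * (\<Sum>v\<in>vecs q. \<psi> v :: real)"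
proof -
  have "(\<Sum>g\<in>carrier (ASL2 q). \<psi> (snd g)) = (\<Sum>A\<in>carrier (SL2 q). \<Sum>v\<in>vecs q. \<psi> v)"
    by (subst sum.cartesian_product) (simp add: ASL2_def case_prod_beta)
  then show ?thesis by (simp only: sum_constant)
qed

text \<open>The affine action of a generator on the plane.\<close>

definition move :: "quat \<Rightarrow> vec2 \<Rightarrow> vec2" where
  "move s v = vred q (vadd (shift s) (act (rho s) v))"

lemma snd_gen_mult: "snd (gen s \<otimes>\<^bsub>ASL2 q\<^esub> g) = move s (snd g)"
  by (cases g) (simp add: gen_def ASL2_mult move_def)

lemma move_vecs: "move s v \<in> vecs q"
  using q1 by (simp add: move_def)

lemma move_zero: "move s (0, 0) = shift s"
  using shift_vecs by (simp add: move_def vred_id)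

lemma move_cancel:
  assumes "s \<in> lps" "v \<in> vecs q"
  shows "move (qcnj s) (move s v) = v"
proof -
  define g where "g = ((1, 0, 0, 1) :: mat2, v)"
  have g: "g \<in> carrier (ASL2 q)" using H.one_closed assms(2) by (simp only: g_def ASL2_carrier SL2_simps)
  have "move (qcnj s) (move s (snd g)) = snd (gen (qcnj s) \<otimes>\<^bsub>ASL2 q\<^esub> (gen s \<otimes>\<^bsub>ASL2 q\<^esub> g))"
    by (simp only: snd_gen_mult)
  also have "gen (qcnj s) \<otimes>\<^bsub>ASL2 q\<^esub> (gen s \<otimes>\<^bsub>ASL2 q\<^esub> g) = g"
    using assms gen_carrier g gen_qcnj_mult by (simp flip: G.m_assoc)
  finally show ?thesis by (simp add: g_def)
qed

lemma sum_move: 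
  assumes "s \<in> lps"
  shows "(\<Sum>v\<in>vecs q. \<psi> (move s v)) = (\<Sum>v\<in>vecs q. \<psi> v)"
proof (rule sum.reindex_bij_betw, rule bij_betwI[of _ _ _ "move (qcnj s)"])
  fix v assume v: "v \<in> vecs q"
  show "move (qcnj s) (move s v) = v" by (rule move_cancel[OF assms v])
  show "move s (move (qcnj s) v) = v" using move_cancel[OF lps_qcnj[OF assms] v] by simp
qed (use move_vecs in auto)

section \<open>Lower bound for the second eigenvalue\<close>

abbreviation "snd_eig \<equiv> graph_eigenvalue (nat_cayley (ASL2 q) (gen ` lps)) 2"

lemma order_ge: "order (ASL2 q) \<ge> nat q ^ 2"
proof -
  have "card (carrier (SL2 q)) \<noteq> 0"
    using finite_SL2[OF q1(2)] H.one_closed by (metis card_0_eq empty_iff)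
  then show ?thesis unfolding order_ASL2 by simp
qed

lemma order_ge_2: "order (ASL2 q) \<ge> 2"
proof -
  have "2 \<le> nat q" using q1 by simp
  also have "\<dots> \<le> nat q ^ 2" using q1 by (simp add: power2_eq_square)
  finally show ?thesis using order_ge by linarith
qed

text \<open>Test functions \<open>\<psi> (g\<inverse> 0)\<close>: the adjacency operator acts on them through the action
  of the generators on the plane.\<close>

lemma rayleigh_plane:
  fixes \<psi> :: "vec2 \<Rightarrow> real"
  assumes z: "(\<Sum>v\<in>vecs q. \<psi> v) = 0"
  shows "(\<Sum>v\<in>vecs q. \<psi> v * (\<Sum>s\<in>lps. \<psi> (move s v))) \<le> snd_eig * (\<Sum>v\<in>vecs q. (\<psi> v)\<^sup>2)"
proof -
  let ?C = "carrier (ASL2 q)" and ?N = "real (card (carrier (SL2 q)))"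
  have inv_sum: "(\<Sum>g\<in>?C. h (inv\<^bsub>ASL2 q\<^esub> g)) = (\<Sum>g\<in>?C. h g)" for h :: "_ \<Rightarrow> real"
    by (rule sum.reindex_bij_betw, rule bij_betwI[of _ _ _ "m_inv (ASL2 q)"]) auto
  define f where "f g = \<psi> (snd (inv\<^bsub>ASL2 q\<^esub> g))" for g
  have inv_S: "(\<Sum>s\<in>gen ` lps. h (inv\<^bsub>ASL2 q\<^esub> s)) = (\<Sum>s\<in>lps. h (gen s))" for h :: "_ \<Rightarrow> real"
  proof -
    have "(\<Sum>s\<in>gen ` lps. h (inv\<^bsub>ASL2 q\<^esub> s)) = (\<Sum>s\<in>lps. h (gen (qcnj s)))"
      by (subst sum.reindex[OF gen_inj]) (intro sum.cong refl, simp add: inv_gen)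
    also have "\<dots> = (\<Sum>s\<in>lps. h (gen s))"
      by (rule sum.reindex_bij_betw, rule bij_betwI[of _ _ _ qcnj]) (auto intro: lps_qcnj)
    finally show ?thesis .
  qed
  have "(\<Sum>g\<in>?C. f g) = 0"
    unfolding f_def inv_sum[of "\<lambda>g. \<psi> (snd g)"] sum_ASL2_snd z by simp
  then have R: "(\<Sum>g\<in>?C. f g * (\<Sum>s\<in>gen ` lps. f (g \<otimes>\<^bsub>ASL2 q\<^esub> s))) \<le> snd_eig * (\<Sum>g\<in>?C. (f g)\<^sup>2)"
    by (rule C.second_eigenvalue_rayleigh[OF order_ge_2])
  have "(\<Sum>g\<in>?C. f g * (\<Sum>s\<in>gen ` lps. f (g \<otimes>\<^bsub>ASL2 q\<^esub> s)))
      = (\<Sum>g\<in>?C. \<psi> (snd (inv\<^bsub>ASL2 q\<^esub> g)) * (\<Sum>s\<in>lps. \<psi> (move s (snd (inv\<^bsub>ASL2 q\<^esub> g)))))"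
  proof (rule sum.cong[OF refl])
    fix g assume g: "g \<in> ?C"
    have "(\<Sum>s\<in>gen ` lps. f (g \<otimes>\<^bsub>ASL2 q\<^esub> s))
        = (\<Sum>s\<in>gen ` lps. \<psi> (snd (inv\<^bsub>ASL2 q\<^esub> s \<otimes>\<^bsub>ASL2 q\<^esub> inv\<^bsub>ASL2 q\<^esub> g)))"
      unfolding f_def using g gen_carrier by (intro sum.cong refl) (auto simp: G.inv_mult_group)
    also have "\<dots> = (\<Sum>s\<in>lps. \<psi> (snd (gen s \<otimes>\<^bsub>ASL2 q\<^esub> inv\<^bsub>ASL2 q\<^esub> g)))" by (rule inv_S)
    finally show "f g * (\<Sum>s\<in>gen ` lps. f (g \<otimes>\<^bsub>ASL2 q\<^esub> s))
      = \<psi> (snd (inv\<^bsub>ASL2 q\<^esub> g)) * (\<Sum>s\<in>lps. \<psi> (move s (snd (inv\<^bsub>ASL2 q\<^esub> g))))"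
      by (simp only: snd_gen_mult f_def)
  qed
  also have "\<dots> = ?N * (\<Sum>v\<in>vecs q. \<psi> v * (\<Sum>s\<in>lps. \<psi> (move s v)))"
    unfolding inv_sum[of "\<lambda>g. \<psi> (snd g) * (\<Sum>s\<in>lps. \<psi> (move s (snd g)))"]
    by (rule sum_ASL2_snd)
  finally have L: "(\<Sum>g\<in>?C. f g * (\<Sum>s\<in>gen ` lps. f (g \<otimes>\<^bsub>ASL2 q\<^esub> s)))
    = ?N * (\<Sum>v\<in>vecs q. \<psi> v * (\<Sum>s\<in>lps. \<psi> (move s v)))" .
  have "(\<Sum>g\<in>?C. (f g)\<^sup>2) = ?N * (\<Sum>v\<in>vecs q. (\<psi> v)\<^sup>2)"
    unfolding f_def inv_sum[of "\<lambda>g. (\<psi> (snd g))\<^sup>2"] by (rule sum_ASL2_snd)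
  then have le: "?N * (\<Sum>v\<in>vecs q. \<psi> v * (\<Sum>s\<in>lps. \<psi> (move s v))) \<le> ?N * (snd_eig * (\<Sum>v\<in>vecs q. (\<psi> v)\<^sup>2))"
    using R L by (simp add: mult_ac)
  have "card (carrier (SL2 q)) \<noteq> 0"
    using finite_SL2[OF q1(2)] H.one_closed by (metis card_0_eq empty_iff)
  then show ?thesis by (intro mult_left_le_imp_le[OF le]) simp
qed

text \<open>The test function needs three distinct points: the origin and its images under the two
  affine generators, each of which the other generator sends back to the origin.\<close>

lemma shift_t_distinct:
  shows "shift lps_t = (1, 0)" "shift lps_t' \<noteq> (0, 0)" "shift lps_t' \<noteq> (1, 0)"
    "move lps_t (shift lps_t') = (0, 0)" "move lps_t' (shift lps_t) = (0, 0)"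
proof -
  show s1: "shift lps_t = (1, 0)" by (simp add: shift_def)
  show m1: "move lps_t (shift lps_t') = (0, 0)"
    using move_cancel[of lps_t' "(0, 0)"] q1 by (simp add: move_zero)
  show "move lps_t' (shift lps_t) = (0, 0)"
    using move_cancel[of lps_t "(0, 0)"] q1 by (simp add: move_zero)
  show "shift lps_t' \<noteq> (0, 0)" using m1 s1 move_zero[of lps_t] by auto
  show "shift lps_t' \<noteq> (1, 0)"
  proof
    assume "shift lps_t' = (1, 0)"
    moreover have "shift lps_t' = vred q (act (rho lps_t') (-1, 0))" by (simp add: shift_def)
    moreover have "\<dots> = (- (r * (1 - 4 * I)) mod q, 0)"
      unfolding lmat_def vred_act_left by (simp add: algebra_simps)
    ultimately have "(- (r * (1 - 4 * I))) mod q = 1 mod q" using q1 by simp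
    then have d1: "q dvd - (r * (1 - 4 * I)) - 1" by (simp only: mod_eq_dvd_iff)
    obtain k where k: "- (r * (1 - 4 * I)) - 1 = q * k" using d1 by (elim dvdE)
    obtain i where i: "I\<^sup>2 + 1 = q * i" using I_square by (elim dvdE)
    obtain j where j: "17 * r\<^sup>2 - 1 = q * j" using r_square by (elim dvdE)
    \<comment> \<open>If the two images coincided, \<open>r * (1 - 4 * I)\<close> would be -1 modulo
      \<open>q\<close>. Its product with \<open>r * (1 + 4 * I)\<close> is \<open>17 * r^2\<close>,
      that is 1, so the other factor is -1 as well; adding gives \<open>2 * r\<close> congruent to
      -2, and \<open>17 * 4\<close> congruent to 4 makes \<open>q\<close> divide 64.\<close>
    have "r * (1 - 4 * I) * (r * (1 + 4 * I)) = r\<^sup>2 * (17 - 16 * (I\<^sup>2 + 1))"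
      by (simp add: power2_eq_square algebra_simps)
    then have e1: "r * (1 - 4 * I) * (r * (1 + 4 * I)) = 1 + q * (j - 16 * r\<^sup>2 * i)"
      unfolding i using j by (simp add: algebra_simps)
    have "r * (1 - 4 * I) = - 1 - q * k" using k by simp
    then have "(- 1 - q * k) * (r * (1 + 4 * I)) = 1 + q * (j - 16 * r\<^sup>2 * i)" using e1 by simp
    then have e2: "r * (1 + 4 * I) = - 1 - q * (j - 16 * r\<^sup>2 * i + k * (r * (1 + 4 * I)))"
      by (simp add: algebra_simps)
    define e where "e = k + (j - 16 * r\<^sup>2 * i + k * (r * (1 + 4 * I)))"
    have "2 * r = r * (1 - 4 * I) + r * (1 + 4 * I)" by (simp add: algebra_simps)
    also have "\<dots> = - 2 - q * e"
      using k e2 unfolding e_def by (simp add: algebra_simps)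
    finally have r2: "2 * r = - 2 - q * e" .
    have "17 * (2 * r)\<^sup>2 = 4 + 4 * (q * j)" using j by (simp add: power2_eq_square algebra_simps)
    then have "64 = q * (4 * j - 17 * e * (4 + q * e))"
      unfolding r2 by (simp add: power2_eq_square algebra_simps)
    then have "q dvd 64" by (metis dvd_triv_left)
    then show False using q_gt zdvd_imp_le[of q 64] by simp
  qed
qed

text \<open>The test function is \<open>16\<close> at the common fixed point 0 of the sixteen linear generators
  and 1 at its two other neighbours.\<close>

lemma second_eigenvalue_ge: "snd_eig \<ge> 1611 / 100"
proof -
  define u w where "u = shift lps_t" and "w = shift lps_t'"
  note uw = shift_t_distinct[folded u_def w_def]
  have u0: "u \<noteq> (0, 0)" "w \<noteq> u" using uw by auto
  \<comment> \<open>A loop of weight 16 with two pendant edges has top eigenvalue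
    \<open>8 + sqrt 66\<close>, about 16.124, which is also the ratio of the entries of its
    eigenvector; the integer weight 16 loses almost nothing.\<close>
  define \<phi> where "\<phi> v = (if v = (0, 0) then 16 else if v = u \<or> v = w then 1 else 0 :: real)" for v
  have \<phi>v: "\<phi> (0, 0) = 16" "\<phi> u = 1" "\<phi> w = 1" using uw u0 by (simp_all add: \<phi>_def)
  have \<phi>0: "\<phi> v \<ge> 0" for v by (simp add: \<phi>_def)
  have T: "{(0, 0), u, w} \<subseteq> vecs q" using q1 shift_vecs by (auto simp: u_def w_def)
  have supp: "(\<Sum>v\<in>vecs q. F v) = F (0, 0) + F u + F w"
    if "\<And>v. v \<notin> {(0, 0), u, w} \<Longrightarrow> F v = 0" for F :: "vec2 \<Rightarrow> real"
  proof -
    have "(\<Sum>v\<in>vecs q. F v) = (\<Sum>v\<in>{(0, 0), u, w}. F v)"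
      by (rule sum.mono_neutral_right) (use T that in auto)
    moreover have "(0, 0) \<notin> {u, w}" "u \<notin> {w}" using uw(2) u0 by auto
    ultimately show ?thesis by simp
  qed
  have out: "\<phi> v = 0" if "v \<notin> {(0, 0), u, w}" for v using that by (simp add: \<phi>_def)
  have s1: "(\<Sum>v\<in>vecs q. \<phi> v) = 18" using supp[of \<phi>, OF out] by (simp add: \<phi>v)
  have s2: "(\<Sum>v\<in>vecs q. (\<phi> v)\<^sup>2) = 258" using supp[of "\<lambda>v. (\<phi> v)\<^sup>2"] out by (simp add: \<phi>v)
  define B where "B v = (\<Sum>s\<in>lps. \<phi> (move s v))" for v
  have B_ge: "B v \<ge> \<phi> (move s v)" if "s \<in> lps" for s v
    unfolding B_def using that \<phi>0 by (intro member_le_sum) auto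
  \<comment> \<open>Sixteen generators stay at the origin with value 16, the other two reach value
    1.\<close>
  have B0: "B (0, 0) = 258"
  proof -
    have ne: "lps_t' \<in> lps - {lps_t}" by simp
    have "B (0, 0) = \<phi> (shift lps_t) + (\<phi> (shift lps_t') + (\<Sum>s\<in>lps - {lps_t} - {lps_t'}. \<phi> (shift s)))"
      unfolding B_def move_zero
      by (subst sum.remove[of _ lps_t]) (use ne in \<open>simp_all add: sum.remove[of "lps - {lps_t}" lps_t']\<close>)
    also have "(\<Sum>s\<in>lps - {lps_t} - {lps_t'}. \<phi> (shift s)) = (\<Sum>s\<in>lps - {lps_t} - {lps_t'}. 16)"
      by (intro sum.cong refl) (simp add: shift_def \<phi>v)
    also have "\<dots> = 256" using ne by (simp add: card_lps)
    finally show ?thesis by (simp add: \<phi>v flip: u_def w_def)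
  qed
  \<comment> \<open>At \<open>u\<close> and \<open>w\<close> only the edge back to the origin is
    counted, with value 16 each.\<close>
  have "\<phi> (0, 0) * B (0, 0) + \<phi> u * B u + \<phi> w * B w \<ge> 16 * 258 + 1 * 16 + 1 * 16"
    using B0 B_ge[of lps_t' u] B_ge[of lps_t w] uw \<phi>v by simp
  also have "\<phi> (0, 0) * B (0, 0) + \<phi> u * B u + \<phi> w * B w = (\<Sum>v\<in>vecs q. \<phi> v * B v)"
    using supp[of "\<lambda>v. \<phi> v * B v"] out by simp
  finally have T_ge: "(\<Sum>v\<in>vecs q. \<phi> v * B v) \<ge> 4160" by simp
  define n where "n = real_of_int q ^ 2"
  have n: "n = real (card (vecs q))" using q1 by (simp add: n_def card_vecs)
  have n_big: "n \<ge> 10000"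
    using q_gt power_mono[of 100 "real_of_int q" 2] by (simp add: n_def)
  \<comment> \<open>The mean of \<open>\<phi>\<close>. Subtracting it does not increase the squared
    norm, and lowers the quadratic form by \<open>324 * m0\<close>, which is less than 1.\<close>
  define m0 where "m0 = 18 / n"
  have m0: "m0 * n = 18" "m0 \<ge> 0" "m0 \<le> 18 / 10000"
    using n_big by (auto simp: m0_def field_simps)
  define \<psi> where "\<psi> v = \<phi> v - m0" for v
  have z: "(\<Sum>v\<in>vecs q. \<psi> v) = 0" using s1 n m0 by (simp add: \<psi>_def sum_subtractf mult.commute)
  have sq: "(\<Sum>v\<in>vecs q. (\<psi> v)\<^sup>2) \<le> 258"
  proof -
    have "(\<Sum>v\<in>vecs q. (\<psi> v)\<^sup>2) = (\<Sum>v\<in>vecs q. (\<phi> v)\<^sup>2 - 2 * m0 * \<phi> v + m0 * m0)"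
      by (intro sum.cong refl) (simp add: \<psi>_def power2_eq_square algebra_simps)
    also have "\<dots> = (\<Sum>v\<in>vecs q. (\<phi> v)\<^sup>2) - 2 * m0 * (\<Sum>v\<in>vecs q. \<phi> v) + (\<Sum>v\<in>vecs q. m0 * m0)"
      by (simp only: sum.distrib sum_subtractf sum_distrib_left)
    also have "\<dots> = 258 - 2 * m0 * 18 + (m0 * n) * m0"
      by (simp add: s1 s2 n)
    also have "\<dots> \<le> 258" unfolding m0(1) using m0(2) by simp
    finally show ?thesis .
  qed
  have "(\<Sum>v\<in>vecs q. \<psi> v * (\<Sum>s\<in>lps. \<psi> (move s v))) = (\<Sum>v\<in>vecs q. \<phi> v * B v) - 324 * m0"
  proof -
    have "(\<Sum>s\<in>lps. \<psi> (move s v)) = B v - 18 * m0" for v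
      by (simp add: \<psi>_def B_def sum_subtractf card_lps)
    then have "(\<Sum>v\<in>vecs q. \<psi> v * (\<Sum>s\<in>lps. \<psi> (move s v)))
      = (\<Sum>v\<in>vecs q. \<psi> v * B v - \<psi> v * (18 * m0))" by (simp add: right_diff_distrib)
    also have "\<dots> = (\<Sum>v\<in>vecs q. \<psi> v * B v) - (\<Sum>v\<in>vecs q. \<psi> v) * (18 * m0)"
      by (simp only: sum_subtractf sum_distrib_right)
    also have "\<dots> = (\<Sum>v\<in>vecs q. \<phi> v * B v) - m0 * (\<Sum>v\<in>vecs q. B v)"
      unfolding z by (simp add: \<psi>_def left_diff_distrib sum_subtractf sum_distrib_left)
    also have "(\<Sum>v\<in>vecs q. B v) = (\<Sum>s\<in>lps. \<Sum>v\<in>vecs q. \<phi> (move s v))"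
      unfolding B_def by (rule sum.swap)
    also have "\<dots> = (\<Sum>s\<in>lps. 18)" by (intro sum.cong refl) (simp add: sum_move s1)
    finally show ?thesis by (simp add: card_lps)
  qed
  then have "4159 \<le> (\<Sum>v\<in>vecs q. \<psi> v * (\<Sum>s\<in>lps. \<psi> (move s v)))" using T_ge m0(3) by simp
  also have "\<dots> \<le> snd_eig * (\<Sum>v\<in>vecs q. (\<psi> v)\<^sup>2)" by (rule rayleigh_plane[OF z])
  finally have main: "4159 \<le> snd_eig * (\<Sum>v\<in>vecs q. (\<psi> v)\<^sup>2)" .
  have nn: "(\<Sum>v\<in>vecs q. (\<psi> v)\<^sup>2) \<ge> 0" by (intro sum_nonneg) simp
  have "snd_eig > 0"
  proof (rule ccontr)
    assume "\<not> snd_eig > 0"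
    then have "snd_eig * (\<Sum>v\<in>vecs q. (\<psi> v)\<^sup>2) \<le> 0" using nn by (simp add: mult_nonpos_nonneg)
    then show False using main by simp
  qed
  then have "snd_eig * (\<Sum>v\<in>vecs q. (\<psi> v)\<^sup>2) \<le> snd_eig * 258" using sq by (intro mult_left_mono) auto
  then show ?thesis using main by simp
qed

end

context lps_prime
begin

lemma second_eigenvalue_multiplicity_bound:
  assumes gap: "\<And>\<mu> F. (\<And>x. x \<in> carrier (SL2 q) \<Longrightarrow> (\<Sum>s\<in>lps. F (x \<otimes>\<^bsub>SL2 q\<^esub> rho s)) = \<mu> * F x) \<Longrightarrow>
     (\<Sum>x\<in>carrier (SL2 q). F x) = 0 \<Longrightarrow> \<exists>x\<in>carrier (SL2 q). F x \<noteq> 0 \<Longrightarrow> \<mu> < (1611 / 100 :: real)"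
  shows "real (second_eigenvalue_multiplicity (nat_cayley (ASL2 q) (gen ` lps)))
    \<ge> real (order (ASL2 q)) powr (2 / 5) - 1"
proof -
  let ?C = "carrier (ASL2 q)"
  obtain f :: "mat2 \<times> vec2 \<Rightarrow> real" where nz: "\<exists>x\<in>?C. f x \<noteq> 0" and sum0: "(\<Sum>x\<in>?C. f x) = 0"
    and eig: "\<And>x. x \<in> ?C \<Longrightarrow> (\<Sum>s\<in>gen ` lps. f (x \<otimes>\<^bsub>ASL2 q\<^esub> s)) = snd_eig * f x"
    by (rule C.second_eigenvalue_eigenfunction[OF order_ge_2], rule that)
  have "\<exists>v\<in>vecs q. \<exists>x\<in>?C. f (transl q v \<otimes>\<^bsub>ASL2 q\<^esub> x) \<noteq> f x"
  proof (rule ccontr)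
    assume "\<not> ?thesis"
    then have inv: "f (transl q v \<otimes>\<^bsub>ASL2 q\<^esub> x) = f x" if "v \<in> vecs q" "x \<in> ?C" for v x
      using that by blast
    define F where "F A = f (A, (0, 0))" for A
    have fF: "f (A, v) = F A" if A: "A \<in> carrier (SL2 q)" and v: "v \<in> vecs q" for A v
    proof -
      have "(A, (0, 0)) \<in> ?C" using A q1 by (simp only: ASL2_carrier zero_in_vecs simp_thms)
      then show ?thesis using inv[OF v, of "(A, (0, 0))"] transl_mult[OF q1(1) A, of v "(0, 0)"] v
        by (simp add: F_def vred_id)
    qed
    have "(\<Sum>s\<in>lps. F (A \<otimes>\<^bsub>SL2 q\<^esub> rho s)) = snd_eig * F A" if A: "A \<in> carrier (SL2 q)" for A
    proof -
      have A0: "(A, (0, 0)) \<in> ?C" using A q1 by (simp only: ASL2_carrier zero_in_vecs simp_thms)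
      have "(\<Sum>s\<in>lps. F (A \<otimes>\<^bsub>SL2 q\<^esub> rho s)) = (\<Sum>s\<in>lps. f ((A, (0, 0)) \<otimes>\<^bsub>ASL2 q\<^esub> gen s))"
        unfolding gen_def ASL2_mult
        using fF H.m_closed[OF A rho_carrier] q1 by (intro sum.cong refl) (simp only: vred_in_vecs)
      also have "\<dots> = (\<Sum>s\<in>gen ` lps. f ((A, (0, 0)) \<otimes>\<^bsub>ASL2 q\<^esub> s))"
        by (subst sum.reindex[OF gen_inj]) simp
      finally show ?thesis using eig[OF A0] by (simp add: F_def)
    qed
    moreover have "(\<Sum>A\<in>carrier (SL2 q). F A) = 0"
    proof -
      have "(\<Sum>x\<in>?C. f x) = (\<Sum>A\<in>carrier (SL2 q). \<Sum>v\<in>vecs q. f (A, v))"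
        by (subst sum.cartesian_product) (simp add: ASL2_def case_prod_beta)
      also have "\<dots> = (\<Sum>A\<in>carrier (SL2 q). \<Sum>v\<in>vecs q. F A)"
        by (intro sum.cong refl fF)
      also have "\<dots> = real (card (vecs q)) * (\<Sum>A\<in>carrier (SL2 q). F A)"
        by (simp only: sum_constant sum_distrib_left)
      finally show ?thesis using sum0 q1 by (simp add: card_vecs)
    qed
    moreover have "\<exists>A\<in>carrier (SL2 q). F A \<noteq> 0"
    proof -
      obtain x where "x \<in> ?C" "f x \<noteq> 0" using nz by blast
      then show ?thesis using fF by (cases x) (metis ASL2_carrier)
    qed
    ultimately have "snd_eig < 1611 / 100" by (rule gap)
    then show False using second_eigenvalue_ge by simp
  qed
  then obtain v0 x0 where v0: "v0 \<in> vecs q" and x0: "x0 \<in> ?C"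
    and neq: "f (transl q v0 \<otimes>\<^bsub>ASL2 q\<^esub> x0) \<noteq> f x0" by blast
  define fc where "fc x = complex_of_real (f x)" for x
  have eigc: "(\<Sum>s\<in>gen ` lps. fc (x \<otimes>\<^bsub>ASL2 q\<^esub> s)) = complex_of_real snd_eig * fc x" if "x \<in> ?C" for x
    unfolding fc_def of_real_sum[symmetric] eig[OF that] by simp
  have neqc: "fc (transl q v0 \<otimes>\<^bsub>ASL2 q\<^esub> x0) \<noteq> fc x0" using neq by (simp add: fc_def)
  let ?X = "vecs q - {(0, 0)}"
  obtain w :: "vec2 \<Rightarrow> mat2 \<times> vec2 \<Rightarrow> complex" where w:
    "\<And>b x. b \<in> ?X \<Longrightarrow> x \<in> ?C \<Longrightarrow> (\<Sum>s\<in>gen ` lps. w b (x \<otimes>\<^bsub>ASL2 q\<^esub> s)) = complex_of_real snd_eig * w b x"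
    "\<And>b c. b \<in> ?X \<Longrightarrow> c \<in> ?X \<Longrightarrow> b \<noteq> c \<Longrightarrow> (\<Sum>x\<in>?C. w b x * cnj (w c x)) = 0"
    "\<And>b. b \<in> ?X \<Longrightarrow> \<exists>x\<in>?C. w b x \<noteq> 0"
    by (rule ASL2_eigenfunction_family[OF prime_q C.S_carrier eigc x0 v0 neqc]) (assumption, rule that)
  have "card ?X \<le> second_eigenvalue_multiplicity (nat_cayley (ASL2 q) (gen ` lps))"
    by (rule C.second_eigenvalue_multiplicity_ge[where w = w]) (simp, fact w(1), fact w(2), fact w(3))
  moreover have "card ?X = nat q ^ 2 - 1" using q1 by (simp add: card_vecs)
  moreover have "nat q ^ 2 \<ge> 1" using q1 by simp
  ultimately have m: "real (second_eigenvalue_multiplicity (nat_cayley (ASL2 q) (gen ` lps))) \<ge> real (nat q ^ 2) - 1"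
    by linarith
  have "order (ASL2 q) \<le> nat q ^ 3 * nat q ^ 2"
    unfolding order_ASL2 using card_SL2_le[OF prime_q] by (intro mult_right_mono) auto
  then have "real (order (ASL2 q)) \<le> real (nat q ^ 3 * nat q ^ 2)" by (simp only: of_nat_le_iff)
  also have "\<dots> = real (nat q) ^ 5" by (simp flip: power_add)
  also have "\<dots> = real (nat q) powr 5" using q1 powr_realpow[of "real (nat q)" 5] by simp
  finally have "real (order (ASL2 q)) powr (2 / 5) \<le> (real (nat q) powr 5) powr (2 / 5)"
    by (intro powr_mono2) auto
  also have "\<dots> = real (nat q) powr 2" by (simp only: powr_powr) simp
  also have "\<dots> = real (nat q ^ 2)" using q1 by simp
  finally show ?thesis using m by linarith
qed

lemma generate_ASL2:
  assumes gap: "\<And>\<mu> F. (\<And>x. x \<in> carrier (SL2 q) \<Longrightarrow> (\<Sum>s\<in>lps. F (x \<otimes>\<^bsub>SL2 q\<^esub> rho s)) = \<mu> * F x) \<Longrightarrow>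
     (\<Sum>x\<in>carrier (SL2 q). F x) = 0 \<Longrightarrow> \<exists>x\<in>carrier (SL2 q). F x \<noteq> 0 \<Longrightarrow> \<mu> < (1611 / 100 :: real)"
  shows "generate (ASL2 q) (gen ` lps) = carrier (ASL2 q)"
proof -
  define K where "K = generate (ASL2 q) (gen ` lps)"
  have KC: "K \<subseteq> carrier (ASL2 q)" unfolding K_def using G.generate_incl[OF C.S_carrier] .
  interpret K: subgroup K "ASL2 q" unfolding K_def by (rule G.generate_is_subgroup[OF C.S_carrier])
  have genK: "gen s \<in> K" if "s \<in> lps" for s unfolding K_def using that by (intro generate.incl) simp
  define P where "P A \<longleftrightarrow> (\<exists>v. (A, v) \<in> K)" for A
  have P_rho: "P (A \<otimes>\<^bsub>SL2 q\<^esub> rho s)" if PA: "P A" and s: "s \<in> lps" for A s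
  proof -
    obtain v where "(A, v) \<in> K" using PA unfolding P_def by blast
    then have "(A, v) \<otimes>\<^bsub>ASL2 q\<^esub> gen s \<in> K" using genK[OF s] by (rule K.m_closed)
    then show ?thesis unfolding gen_def ASL2_mult P_def by blast
  qed
  have P_rho_iff: "P (A \<otimes>\<^bsub>SL2 q\<^esub> rho s) \<longleftrightarrow> P A" if A: "A \<in> carrier (SL2 q)" and s: "s \<in> lps" for A s
  proof
    assume "P (A \<otimes>\<^bsub>SL2 q\<^esub> rho s)"
    then have "P (A \<otimes>\<^bsub>SL2 q\<^esub> rho s \<otimes>\<^bsub>SL2 q\<^esub> rho (qcnj s))" using P_rho lps_qcnj[OF s] by blast
    moreover have "A \<otimes>\<^bsub>SL2 q\<^esub> rho s \<otimes>\<^bsub>SL2 q\<^esub> rho (qcnj s) = A"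
      by (simp only: H.m_assoc[OF A rho_carrier[OF s] rho_carrier[OF lps_qcnj[OF s]]]
          rho_qcnj_left[OF lps_qcnj[OF s], unfolded qcnj_qcnj] H.r_one[OF A])
    ultimately show "P A" by simp
  qed (rule P_rho[OF _ s])
  have P1: "P (1, 0, 0, 1)" using K.one_closed unfolding P_def ASL2_one by blast
  have P_all: "P A" if A: "A \<in> carrier (SL2 q)" for A
  proof (rule ccontr)
    assume nP: "\<not> P A"
    let ?H = "carrier (SL2 q)"
    define c where "c = (\<Sum>x\<in>?H. if P x then 1 else 0) / real (card ?H)"
    define F where "F x = (if P x then 1 else 0) - c" for x
    have cH: "card ?H \<noteq> 0" using finite_SL2[OF q1(2)] A by (metis card_0_eq empty_iff)
    have "(18 :: real) < 1611 / 100"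
    proof (rule gap[of F 18])
      fix x assume "x \<in> ?H"
      then show "(\<Sum>s\<in>lps. F (x \<otimes>\<^bsub>SL2 q\<^esub> rho s)) = 18 * F x"
        using P_rho_iff by (simp add: F_def card_lps del: SL2_simps)
    next
      have "(\<Sum>x\<in>?H. F x) = (\<Sum>x\<in>?H. if P x then 1 else 0) - (\<Sum>x\<in>?H. c)"
        unfolding F_def by (rule sum_subtractf)
      also have "(\<Sum>x\<in>?H. c) = real (card ?H) * c" by (simp only: sum_constant)
      finally show "(\<Sum>x\<in>?H. F x) = 0" using cH by (simp add: c_def del: SL2_simps)
    next
      have "F A \<noteq> F (1, 0, 0, 1)" using nP P1 by (simp add: F_def)
      then show "\<exists>x\<in>?H. F x \<noteq> 0" using A H.one_closed by (metis SL2_simps(3))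
    qed
    then show False by simp
  qed
  have comm: "transl q (vadd x (vneg y)) \<in> K" if "(A, x) \<in> K" "(A, y) \<in> K" for A x y
  proof -
    have xy: "(A, x) \<in> carrier (ASL2 q)" "(A, y) \<in> carrier (ASL2 q)" using that KC by auto
    have "A \<in> carrier (SL2 q)" "x \<in> vecs q" using xy by (simp_all only: ASL2_carrier)
    then have "transl q (vadd x (vneg y)) \<otimes>\<^bsub>ASL2 q\<^esub> (A, y) = (A, x)"
      by (simp add: transl_mult[OF q1(1)] vadd_assoc vred_id del: SL2_simps)
    then have "transl q (vadd x (vneg y)) = (A, x) \<otimes>\<^bsub>ASL2 q\<^esub> inv\<^bsub>ASL2 q\<^esub> (A, y)"
      using xy transl_carrier[OF q1(1)] by (metis G.inv_solve_right)
    then show ?thesis using that K.m_closed K.m_inv_closed by simp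
  qed
  define J where "J = mred q (-1, 0, 0, -1)"
  have JC: "J \<in> carrier (SL2 q)" unfolding J_def using q1 by (intro mred_in_SL2) simp_all
  obtain z where z: "(J, z) \<in> K" using P_all[OF JC] unfolding P_def by blast
  have zv: "z \<in> vecs q" using z KC by (auto simp only: ASL2_carrier)
  have JA: "J \<otimes>\<^bsub>SL2 q\<^esub> A = A \<otimes>\<^bsub>SL2 q\<^esub> J" for A
    unfolding J_def SL2_simps mred_mmul_left mred_mmul_right by (cases A) simp
  have Jact: "vred q (vadd x (act J y)) = vred q (vadd x (vneg y))" for x y
    unfolding J_def vred_vadd_act_left by (cases y) simp
  have d2: "\<not> q dvd 2" using q_gt zdvd_imp_le[of q 2] by auto
  have "\<exists>x. transl q x \<in> K \<and> vred q x \<noteq> (0, 0)"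
  proof (cases "z = (0, 0)")
    case True
    have g: "gen lps_t \<in> K" by (rule genK) simp
    have "(J, z) \<otimes>\<^bsub>ASL2 q\<^esub> gen lps_t \<in> K" "gen lps_t \<otimes>\<^bsub>ASL2 q\<^esub> (J, z) \<in> K"
      using z g by (auto intro: K.m_closed)
    then have "(J \<otimes>\<^bsub>SL2 q\<^esub> rho lps_t, vred q (vneg (1, 0))) \<in> K" "(J \<otimes>\<^bsub>SL2 q\<^esub> rho lps_t, vred q (1, 0)) \<in> K"
      unfolding gen_def ASL2_mult Jact JA[of "rho lps_t"] True using shift_t_distinct(1)
      by (simp_all del: SL2_simps)
    from comm[OF this] have "transl q (vadd (vred q (vneg (1, 0))) (vneg (vred q (1, 0)))) \<in> K" .
    moreover have "vred q (vadd (vred q (vneg (1, 0))) (vneg (vred q (1, 0)))) = ((- 2) mod q, 0)"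
      using q1 by (simp add: mod_simps)
    moreover have "(- 2) mod q \<noteq> 0" using d2 by (simp add: mod_eq_0_iff_dvd)
    ultimately show ?thesis by (metis prod.inject)
  next
    case False
    define s where "s = Quat 1 0 4 0"
    have s: "s \<in> lps" "shift s = (0, 0)" by (auto simp: s_def lps_def lps_list_def shift_def)
    have g: "gen s \<in> K" by (rule genK[OF s(1)])
    have "(J, z) \<otimes>\<^bsub>ASL2 q\<^esub> gen s \<in> K" "gen s \<otimes>\<^bsub>ASL2 q\<^esub> (J, z) \<in> K"
      using z g by (auto intro: K.m_closed)
    then have "(J \<otimes>\<^bsub>SL2 q\<^esub> rho s, z) \<in> K" "(J \<otimes>\<^bsub>SL2 q\<^esub> rho s, vred q (act (rho s) z)) \<in> K"
      unfolding gen_def ASL2_mult JA[of "rho s"] s(2) using zv by (simp_all add: vred_id del: SL2_simps)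
    from comm[OF this] have "transl q (vadd z (vneg (vred q (act (rho s) z)))) \<in> K" .
    moreover have "vred q (vadd z (vneg (vred q (act (rho s) z)))) \<noteq> (0, 0)"
    proof
      assume e: "vred q (vadd z (vneg (vred q (act (rho s) z)))) = (0, 0)"
      define p where "p = vred q (act (rho s) z)"
      have "z = vred q (vadd (vadd z (vneg p)) p)" using zv by (simp add: vadd_assoc vred_id)
      also have "\<dots> = vred q (vadd (vred q (vadd z (vneg p))) p)" by (rule vred_vadd_left[symmetric])
      also have "\<dots> = vred q p" unfolding e[folded p_def] by simp
      also have "\<dots> = vred q (act (rho s) z)" unfolding p_def by (rule vred_vred)
      finally have fixed: "vred q (act (rho s) z) = z" by (rule sym)
      obtain x y where xy: "z = (x, y)" by (cases z)
      have "vred q (act (r, r * 4, r * - 4, r) z) = z"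
        using fixed by (simp add: lmat_def s_def vred_act_left del: act.simps mred.simps)
      then have "(r * x + r * 4 * y) mod q = x mod q" "(r * - 4 * x + r * y) mod q = y mod q"
        using zv unfolding xy by (auto simp: vecs_def)
      then have "q dvd r * x + r * 4 * y - x" "q dvd r * - 4 * x + r * y - y" by (simp_all only: mod_eq_dvd_iff)
      then obtain a b where a: "r * x + r * 4 * y - x = q * a" and b: "r * - 4 * x + r * y - y = q * b"
        by (elim dvdE)
      obtain j where j: "17 * r\<^sup>2 - 1 = q * j" using r_square by (elim dvdE)
      have d: "(r - 1) * (r - 1) + 16 * (r * r) = 2 * (1 - r) + q * j"
        unfolding j[symmetric] by (simp add: power2_eq_square algebra_simps)
      have "((r - 1) * (r - 1) + 16 * (r * r)) * x = q * ((r - 1) * a - 4 * r * b)"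
      proof -
        have "((r - 1) * (r - 1) + 16 * (r * r)) * x = (r - 1) * (q * a) - 4 * r * (q * b)"
          unfolding a[symmetric] b[symmetric] by (simp add: algebra_simps)
        then show ?thesis by (simp add: algebra_simps)
      qed
      then have "2 * (1 - r) * x = q * ((r - 1) * a - 4 * r * b - j * x)"
        unfolding d by (simp add: algebra_simps)
      then have dx: "q dvd 2 * (1 - r) * x" by simp
      have "((r - 1) * (r - 1) + 16 * (r * r)) * y = q * (4 * r * a + (r - 1) * b)"
      proof -
        have "((r - 1) * (r - 1) + 16 * (r * r)) * y = 4 * r * (q * a) + (r - 1) * (q * b)"
          unfolding a[symmetric] b[symmetric] by (simp add: algebra_simps)
        then show ?thesis by (simp add: algebra_simps)
      qed
      then have "2 * (1 - r) * y = q * (4 * r * a + (r - 1) * b - j * y)"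
        unfolding d by (simp add: algebra_simps)
      then have dy: "q dvd 2 * (1 - r) * y" by simp
      have "\<not> q dvd x \<or> \<not> q dvd y"
        using False zv zdvd_not_zless[of x q] zdvd_not_zless[of y q] unfolding xy by (auto simp: vecs_def)
      then have "q dvd 1 - r"
        using dx dy d2 unfolding prime_dvd_mult_iff[OF prime_q] by blast
      then obtain c where "1 - r = q * c" by (elim dvdE)
      then have r: "r = 1 - q * c" by simp
      have "16 = q * (j + 34 * c - 17 * q * c * c)"
        using j unfolding r by (simp add: power2_eq_square algebra_simps)
      then have "q dvd 16" by (metis dvd_triv_left)
      then show False using q_gt zdvd_imp_le[of q 16] by simp
    qed
    ultimately show ?thesis by blast
  qed
  then obtain x0 where x0: "transl q x0 \<in> K" "vred q x0 \<noteq> (0, 0)" by blast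
  have trK: "transl q y \<in> K" if y: "y \<in> vecs q" for y
  proof (cases "y = (0, 0)")
    case True
    then show ?thesis using K.one_closed by (simp add: transl_def ASL2_one)
  next
    case False
    obtain A where A: "A \<in> carrier (SL2 q)" "vred q (act A (vred q x0)) = y"
      using SL2_transitive[OF prime_q vred_in_vecs[OF q1(2)] x0(2) y False] .
    obtain v where v: "(A, v) \<in> K" using P_all[OF A(1)] unfolding P_def by blast
    have "(A, v) \<otimes>\<^bsub>ASL2 q\<^esub> transl q x0 \<in> K" using v x0(1) by (rule K.m_closed)
    then have "(A, vred q (vadd v y)) \<in> K"
      using H.r_one[OF A(1)] unfolding transl_def ASL2_mult A(2)[symmetric] by simp
    from comm[OF this v] have "transl q (vadd (vred q (vadd v y)) (vneg v)) \<in> K" .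
    also have "transl q (vadd (vred q (vadd v y)) (vneg v)) = transl q (vred q (vadd (vadd v y) (vneg v)))"
      by (simp add: transl_def)
    also have "vadd (vadd v y) (vneg v) = y" by (cases v; cases y) simp
    finally show ?thesis by simp
  qed
  have "carrier (ASL2 q) \<subseteq> K"
  proof
    fix g assume g: "g \<in> carrier (ASL2 q)"
    obtain A w where Aw: "g = (A, w)" by (cases g)
    have A: "A \<in> carrier (SL2 q)" and w: "w \<in> vecs q" using g by (simp_all only: Aw ASL2_carrier)
    obtain v where v: "(A, v) \<in> K" using P_all[OF A] unfolding P_def by blast
    have "transl q (vred q (vadd w (vneg v))) \<otimes>\<^bsub>ASL2 q\<^esub> (A, v) \<in> K"
      by (rule K.m_closed[OF trK[OF vred_in_vecs[OF q1(2)]] v])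
    also have "transl q (vred q (vadd w (vneg v))) \<otimes>\<^bsub>ASL2 q\<^esub> (A, v) = g"
      using transl_mult[OF q1(1) A] w by (simp add: Aw vadd_assoc vred_id del: transl_vred)
    finally show "g \<in> K" .
  qed
  then show ?thesis using KC K_def by blast
qed

end

section \<open>Proof of the theorem\<close>

text \<open>Modulo a prime divisor of \<open>324 y\<^sup>4 - 32 y\<^sup>2 + 1 = (18 y\<^sup>2 - 1)\<^sup>2 + (2 y)\<^sup>2
  = (18 y\<^sup>2 + 1)\<^sup>2 - 17 (2 y)\<^sup>2\<close>, both -1 and 17 are squares.\<close>

lemma exists_lps_prime:
  fixes Q :: int
  obtains q I r where "q \<ge> Q" "lps_prime q I r"
proof -
  define M where "M = max (nat Q) 100"
  define y where "y = int (fact M)"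
  define N where "N = 324 * y ^ 4 - 32 * y\<^sup>2 + 1"
  have y1: "y \<ge> 1" by (simp add: y_def)
  have "y\<^sup>2 * 1 \<le> y\<^sup>2 * y\<^sup>2" using y1 by (intro mult_left_mono) (simp_all add: one_le_power)
  then have "y\<^sup>2 \<le> y ^ 4" by (simp flip: power_add)
  moreover have "y\<^sup>2 \<ge> 1" using y1 by (simp add: one_le_power)
  ultimately have "N > 1" by (simp add: N_def)
  then have "\<bar>N\<bar> \<noteq> 1" by simp
  then obtain q where q: "prime q" "q dvd N" using prime_factor_int by blast
  have q1: "q > 1" using q prime_gt_1_int by blast
  have "\<not> q dvd y"
  proof
    assume "q dvd y"
    then have "q dvd N - y * (324 * y ^ 3 - 32 * y)" using q(2) by (intro dvd_diff) auto
    then have "q dvd 1" by (simp add: N_def algebra_simps power2_eq_square power3_eq_cube power4_eq_xxxx)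
    then show False using q1 by simp
  qed
  have big: "q > int M"
  proof (rule ccontr)
    assume "\<not> q > int M"
    then have "nat q dvd fact M" using q1 by (intro dvd_fact) auto
    then have "int (nat q) dvd int (fact M)" by (simp only: int_dvd_int_iff)
    then have "q dvd y" unfolding y_def using q1 by simp
    then show False using \<open>\<not> q dvd y\<close> by simp
  qed
  then have qQ: "q \<ge> Q" and q100: "q > 100" by (auto simp: M_def)
  have nd: "\<not> q dvd c" if "c > 0" "c < 100" for c
    using that q100 zdvd_imp_le[of q c] by auto
  have d2y: "\<not> q dvd 2 * y" using nd[of 2] \<open>\<not> q dvd y\<close> q(1) by (simp add: prime_dvd_mult_iff)
  have N1: "N = (18 * y\<^sup>2 - 1)\<^sup>2 + (2 * y)\<^sup>2" and N2: "N = (18 * y\<^sup>2 + 1)\<^sup>2 - 17 * (2 * y)\<^sup>2"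
    by (simp_all add: N_def power2_eq_square power4_eq_xxxx algebra_simps)
  have d18: "\<not> q dvd 18 * y\<^sup>2 + 1"
  proof
    assume "q dvd 18 * y\<^sup>2 + 1"
    then have "q dvd (18 * y\<^sup>2 + 1) * (18 * y\<^sup>2 + 1) - N" using q(2) by (intro dvd_diff) auto
    then have "q dvd 17 * (2 * y * (2 * y))" by (simp add: N2 power2_eq_square)
    then show False using nd[of 17] d2y q(1) by (simp only: prime_dvd_mult_iff) simp
  qed
  obtain z where "(2 * y * z) mod q = 1" using mod_inverse_exists[OF q(1) d2y] .
  then have z: "[2 * y * z = 1] (mod q)" using q1 by (simp add: int_cong_def)
  obtain e where "((18 * y\<^sup>2 + 1) * e) mod q = 1" using mod_inverse_exists[OF q(1) d18] .
  then have e: "[(18 * y\<^sup>2 + 1) * e = 1] (mod q)" using q1 by (simp add: int_cong_def)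
  have N0: "[N = 0] (mod q)" using q(2) by (simp add: cong_0_iff)
  have "[((18 * y\<^sup>2 - 1) * z)\<^sup>2 + (2 * y * z)\<^sup>2 = 0] (mod q)"
  proof -
    have "((18 * y\<^sup>2 - 1) * z)\<^sup>2 + (2 * y * z)\<^sup>2 = z\<^sup>2 * N"
      unfolding N1 by (simp add: power2_eq_square algebra_simps)
    then show ?thesis using q(2) by (simp add: cong_0_iff)
  qed
  moreover have "[(2 * y * z)\<^sup>2 = 1\<^sup>2] (mod q)" using z by (rule cong_pow)
  then have "[((18 * y\<^sup>2 - 1) * z)\<^sup>2 + (2 * y * z)\<^sup>2 = ((18 * y\<^sup>2 - 1) * z)\<^sup>2 + 1] (mod q)"
    by (intro cong_add) simp_all
  ultimately have "[((18 * y\<^sup>2 - 1) * z)\<^sup>2 + 1 = 0] (mod q)" by (meson cong_sym cong_trans)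
  then have I: "q dvd ((18 * y\<^sup>2 - 1) * z)\<^sup>2 + 1" by (simp add: cong_0_iff)
  have "[((18 * y\<^sup>2 + 1) * e)\<^sup>2 - e\<^sup>2 * N = 1\<^sup>2 - e\<^sup>2 * 0] (mod q)"
    using e N0 by (intro cong_diff cong_pow cong_mult) simp_all
  moreover have "((18 * y\<^sup>2 + 1) * e)\<^sup>2 - e\<^sup>2 * N = 17 * (2 * y * e)\<^sup>2"
    unfolding N2 by (simp add: power2_eq_square algebra_simps)
  ultimately have "[17 * (2 * y * e)\<^sup>2 = 1] (mod q)" by simp
  then have r: "q dvd 17 * (2 * y * e)\<^sup>2 - 1" by (simp add: cong_iff_dvd_diff)
  have "lps_prime q ((18 * y\<^sup>2 - 1) * z) (2 * y * e)"
    using q(1) q100 I r by unfold_locales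
  then show thesis by (rule that[OF qQ])
qed

lemma digraph_iso_card_verts:
  assumes "digraph_iso G H"
  shows "card (verts G) = card (verts H)"
proof -
  obtain f where "pre_digraph.digraph_isomorphism G f" "H = app_iso f G"
    using assms by (auto simp: digraph_iso_def)
  then show ?thesis
    by (auto simp: pre_digraph.digraph_isomorphism_def app_iso_def card_image)
qed

theorem theorem1p4:
  shows "\<exists>\<G> :: nat pair_pre_digraph set.
           infinite \<G> \<and>
           pairwise (\<lambda>G H. \<not> digraph_iso (with_proj G) (with_proj H)) \<G> \<and>
           (\<forall>G \<in> \<G>. is_cayley_graph G \<and>
              Digraph_Component.connected (with_proj G) \<and>
              regular_graph 18 G \<and>
              real (second_eigenvalue_multiplicity G)
                \<ge> real (card (pverts G)) powr (2 / 5) - 1)"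
proof -
  define P where "P G \<longleftrightarrow> is_cayley_graph G \<and> Digraph_Component.connected (with_proj G) \<and>
      regular_graph 18 G \<and>
      real (second_eigenvalue_multiplicity G) \<ge> real (card (pverts G)) powr (2 / 5) - 1"
    for G :: "nat pair_pre_digraph"
  obtain Q where Q: "\<And>q I r \<mu> F. lps_prime q I r \<Longrightarrow> q \<ge> Q \<Longrightarrow>
     (\<forall>x\<in>carrier (SL2 q). (\<Sum>s\<in>lps. F (x \<otimes>\<^bsub>SL2 q\<^esub> lps_prime.lmat q I r 1 s)) = \<mu> * F x) \<Longrightarrow>
     (\<Sum>x\<in>carrier (SL2 q). F x) = 0 \<Longrightarrow> \<exists>x\<in>carrier (SL2 q). F x \<noteq> 0 \<Longrightarrow> \<mu> < (1611 / 100 :: real)"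
    using SL2_spectral_gap by blast
  have large: "\<exists>G. P G \<and> card (pverts G) > k" for k
  proof -
    obtain q I r where q: "q \<ge> max Q (int k + 1)" and L: "lps_prime q I r" by (rule exists_lps_prime)
    interpret lps_prime q I r by (rule L)
    have gap: "\<mu> < 1611 / 100" if "\<And>x. x \<in> carrier (SL2 q) \<Longrightarrow> (\<Sum>s\<in>lps. F (x \<otimes>\<^bsub>SL2 q\<^esub> rho s)) = \<mu> * F x"
      "(\<Sum>x\<in>carrier (SL2 q). F x) = 0" "\<exists>x\<in>carrier (SL2 q). F x \<noteq> 0" for \<mu> :: real and F
      using that q by (intro Q[OF L, of F]) auto
    let ?X = "nat_cayley (ASL2 q) (gen ` lps)"
    have generates: "generate (ASL2 q) (gen ` lps) = carrier (ASL2 q)"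
      by (rule generate_ASL2) (rule gap)
    have mult: "real (second_eigenvalue_multiplicity ?X) \<ge> real (order (ASL2 q)) powr (2 / 5) - 1"
      by (rule second_eigenvalue_multiplicity_bound) (rule gap)
    have "P ?X"
      unfolding P_def
    proof (intro conjI)
      show "is_cayley_graph ?X" by (rule C.is_cayley_nat_cayley)
      show "Digraph_Component.connected (with_proj ?X)"
        by (rule C.connected_nat_cayley[OF generates])
      show "regular_graph 18 ?X"
        using C.regular_nat_cayley by (simp add: card_image[OF gen_inj] card_lps)
      show "real (second_eigenvalue_multiplicity ?X) \<ge> real (card (pverts ?X)) powr (2 / 5) - 1"
        using mult by simp
    qed
    moreover have "k < card (pverts ?X)"
    proof -
      have "k < nat q" using q by linarith
      also have "\<dots> \<le> nat q ^ 2" using q1 by (simp add: power2_eq_square)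
      also note order_ge
      finally show ?thesis by simp
    qed
    ultimately show ?thesis by blast
  qed
  define \<N> where "\<N> = {n. \<exists>G. P G \<and> card (pverts G) = n}"
  define pick where "pick n = (SOME G. P G \<and> card (pverts G) = n)" for n
  have pick: "P (pick n) \<and> card (pverts (pick n)) = n" if "n \<in> \<N>" for n
    unfolding pick_def using that
    by (intro someI_ex[of "\<lambda>G. P G \<and> card (pverts G) = n"]) (simp only: \<N>_def mem_Collect_eq)
  have inf: "infinite \<N>"
    unfolding infinite_nat_iff_unbounded \<N>_def using large by blast
  have inj: "inj_on pick \<N>" by (rule inj_onI) (metis pick)
  show ?thesis
  proof (intro exI[of _ "pick ` \<N>"] conjI)
    show "infinite (pick ` \<N>)" using inf inj by (simp add: finite_image_iff)
    show "pairwise (\<lambda>G H. \<not> digraph_iso (with_proj G) (with_proj H)) (pick ` \<N>)"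
    proof (rule pairwiseI)
      fix G H assume GH: "G \<in> pick ` \<N>" "H \<in> pick ` \<N>" "G \<noteq> H"
      then have "card (pverts G) \<noteq> card (pverts H)" using pick by (metis imageE)
      then show "\<not> digraph_iso (with_proj G) (with_proj H)"
        using digraph_iso_card_verts[of "with_proj G" "with_proj H"] by auto
    qed
    show "\<forall>G\<in>pick ` \<N>. is_cayley_graph G \<and> Digraph_Component.connected (with_proj G) \<and>
      regular_graph 18 G \<and>
      real (second_eigenvalue_multiplicity G) \<ge> real (card (pverts G)) powr (2 / 5) - 1"
      using pick unfolding P_def by blast
  qed
qed

end
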